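(* Let $p$ be a prime and let $\mathcal{G} \subseteq \mathcal{F}$ be two saturated fusion systems over the same finite $p$-group $S$. Suppose that $\mathrm{Hom}_{\mathcal{G}}(A,B)=\mathrm{Hom}_{\mathcal{F}}(A,B)$ for all subgroups $A,B \leq \mathfrak{hyp}(\mathcal{F})$ with $A,B$ elementary abelian if $p$ is odd, and abelian of exponent at most $4$ if $p=2$. Then $\mathcal{G}=\mathcal{F}$.
   Context: For subgroups $P,Q$ of a finite $p$-group $S$, $\mathrm{Hom}_S(P,Q)$ is the set of homomorphisms $P\to Q$ induced by conjugation by elements of $S$, and $\mathrm{Aut}_S(P)=\mathrm{Hom}_S(P,P)$. A fusion system $\mathcal{F}$ over $S$ is a category whose objects are the subgroups of $S$ and whose morphism sets $\mathrm{Hom}_{\mathcal{F}}(P,Q)$ consist of injective group homomorphisms, contain $\mathrm{Hom}_S(P,Q)$, and are such that every morphism is the composite of an isomorphism in $\mathcal{F}$ followed by an inclusion. Write $\mathrm{Aut}_{\mathcal{F}}(P)=\mathrm{Hom}_{\mathcal{F}}(P,P)$. The fusion system $\mathcal{F}$ is saturated if every subgroup of $S$ is isomorphic in $\mathcal{F}$ to a subgroup $P\le S$ such that (i) $\mathrm{Aut}_S(P)$ is a Sylow $p$-subgroup of $\mathrm{Aut}_{\mathcal{F}}(P)$, and (ii) every isomorphism $\varphi\colon Q\to P$ in $\mathcal{F}$ extends to a morphism in $\mathrm{Hom}_{\mathcal{F}}(N_\varphi,S)$, where $N_\varphi=\{g\in N_S(Q): \varphi\circ c_g\circ\varphi^{-1}\in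 \mathrm{Aut}_S(P)\}$ and $c_g$ denotes conjugation by $g$. The inclusion $\mathcal{G}\subseteq\mathcal{F}$ means $\mathrm{Hom}_{\mathcal{G}}(P,Q)\subseteq\mathrm{Hom}_{\mathcal{F}}(P,Q)$ for all $P,Q\le S$. For a finite group $X$, $O^p(X)$ denotes the smallest normal subgroup of $X$ of $p$-power index. The hyperfocal subgroup $\mathfrak{hyp}(\mathcal{F})$ is the subgroup of $S$ generated by all elements of the form $x^{-1}\varphi(x)$ where $x\in Q$ and $\varphi\in O^p(\mathrm{Aut}_{\mathcal{F}}(Q))$ for some subgroup $Q$ of $S$. *)

theory Defs
  imports "HOL-Algebra.Bij" "HOL-Algebra.Group_Action" "HOL-Algebra.Generated_Groups"
    "HOL-Computational_Algebra.Primes"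
begin

(* Finiteness follows: order S is the cardinality of the carrier, which is 0 for infinite
   carriers, whereas p ^ n > 0. *)
locale finite_p_group = group S for S (structure) +
  fixes p :: nat
  assumes prime_p: "prime p"
    and order_p_power: "\<exists>n. order S = p ^ n"

(* A homomorphism from P to Q is represented by a function that is extensional on P, so that
   equality of functions is equality of homomorphisms with the same domain. *)
definition conj_map :: "('a, 'b) monoid_scheme \<Rightarrow> 'a \<Rightarrow> 'a set \<Rightarrow> 'a \<Rightarrow> 'a"
  where "conj_map S g P = (\<lambda>x\<in>P. g \<otimes>\<^bsub>S\<^esub> x \<otimes>\<^bsub>S\<^esub> inv\<^bsub>S\<^esub> g)"

definition Hom_conj :: "('a, 'b) monoid_scheme \<Rightarrow> 'a set \<Rightarrow> 'a set \<Rightarrow> ('a \<Rightarrow> 'a) set"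
  where "Hom_conj S P Q = {conj_map S g P | g. g \<in> carrier S \<and> conj_map S g P ` P \<subseteq> Q}"

definition fusion_iso :: "('a set \<Rightarrow> 'a set \<Rightarrow> ('a \<Rightarrow> 'a) set) \<Rightarrow> 'a set \<Rightarrow> 'a set \<Rightarrow> ('a \<Rightarrow> 'a) set"
  where "fusion_iso F P Q =
    {\<phi> \<in> F P Q. \<exists>\<psi> \<in> F Q P. compose P \<psi> \<phi> = (\<lambda>x\<in>P. x) \<and> compose Q \<phi> \<psi> = (\<lambda>x\<in>Q. x)}"

(* A fusion system is given by its morphism sets F P Q. Only subgroups of S are objects; for
   other arguments F P Q is empty by convention, so that equality of fusion systems is
   equality of functions. *)
locale fusion_system = finite_p_group S p for S (structure) and p +
  fixes F :: "'a set \<Rightarrow> 'a set \<Rightarrow> ('a \<Rightarrow> 'a) set"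
  assumes objects: "\<not> (subgroup P S \<and> subgroup Q S) \<Longrightarrow> F P Q = {}"
    and injective_hom: "\<lbrakk>subgroup P S; subgroup Q S; \<phi> \<in> F P Q\<rbrakk> \<Longrightarrow>
      \<phi> \<in> hom (S\<lparr>carrier := P\<rparr>) (S\<lparr>carrier := Q\<rparr>) \<and> \<phi> \<in> extensional P \<and> inj_on \<phi> P"
    and identities: "subgroup P S \<Longrightarrow> (\<lambda>x\<in>P. x) \<in> F P P"
    and composition: "\<lbrakk>subgroup P S; subgroup Q S; subgroup R S; \<phi> \<in> F P Q; \<psi> \<in> F Q R\<rbrakk> \<Longrightarrow>
      compose P \<psi> \<phi> \<in> F P R"
    and conj_morphisms: "\<lbrakk>subgroup P S; subgroup Q S\<rbrakk> \<Longrightarrow> Hom_conj S P Q \<subseteq> F P Q"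
    and iso_then_inclusion: "\<lbrakk>subgroup P S; subgroup Q S; \<phi> \<in> F P Q\<rbrakk> \<Longrightarrow>
      \<exists>R \<psi>. subgroup R S \<and> R \<subseteq> Q \<and> \<psi> \<in> fusion_iso F P R \<and> \<phi> = compose P (\<lambda>x\<in>R. x) \<psi>"

(* The members of F P P are injective on the finite set P, hence permutations of P. *)
definition Aut_fusion :: "('a set \<Rightarrow> 'a set \<Rightarrow> ('a \<Rightarrow> 'a) set) \<Rightarrow> 'a set \<Rightarrow> ('a \<Rightarrow> 'a) monoid"
  where "Aut_fusion F P = (BijGroup P)\<lparr>carrier := F P P\<rparr>"

definition sylow_subgroup :: "nat \<Rightarrow> ('a, 'b) monoid_scheme \<Rightarrow> 'a set \<Rightarrow> bool"
  where "sylow_subgroup p X H \<longleftrightarrow> subgroup H X \<and> card H = p ^ multiplicity p (order X)"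

definition extender :: "('a, 'b) monoid_scheme \<Rightarrow> 'a set \<Rightarrow> 'a set \<Rightarrow> ('a \<Rightarrow> 'a) \<Rightarrow> 'a set"
  where "extender S Q P \<phi> =
    {g \<in> normalizer S Q.
      compose P \<phi> (compose P (conj_map S g Q) (inv_into Q \<phi>)) \<in> Hom_conj S P P}"

locale saturated_fusion_system = fusion_system S p F for S (structure) and p and F +
  assumes saturation: "subgroup R S \<Longrightarrow>
    \<exists>P. subgroup P S \<and> fusion_iso F R P \<noteq> {} \<and>
      sylow_subgroup p (Aut_fusion F P) (Hom_conj S P P) \<and>
      (\<forall>Q \<phi>. subgroup Q S \<and> \<phi> \<in> fusion_iso F Q P \<longrightarrow>
        (\<exists>\<psi> \<in> F (extender S Q P \<phi>) (carrier S). \<forall>x\<in>Q. \<psi> x = \<phi> x))"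

definition fusion_subsystem ::
    "('a, 'b) monoid_scheme \<Rightarrow> ('a set \<Rightarrow> 'a set \<Rightarrow> ('a \<Rightarrow> 'a) set) \<Rightarrow>
      ('a set \<Rightarrow> 'a set \<Rightarrow> ('a \<Rightarrow> 'a) set) \<Rightarrow> bool"
  where "fusion_subsystem S G F \<longleftrightarrow>
    (\<forall>P Q. subgroup P S \<and> subgroup Q S \<longrightarrow> G P Q \<subseteq> F P Q)"

(* O^p(X): LEAST is taken in the inclusion order on sets. *)
definition p_residual :: "nat \<Rightarrow> ('a, 'b) monoid_scheme \<Rightarrow> 'a set"
  where "p_residual p X = (LEAST N. N \<lhd> X \<and> (\<exists>n. card (rcosets\<^bsub>X\<^esub> N) = p ^ n))"

definition hyperfocal :: "('a, 'b) monoid_scheme \<Rightarrow> nat \<Rightarrow>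
    ('a set \<Rightarrow> 'a set \<Rightarrow> ('a \<Rightarrow> 'a) set) \<Rightarrow> 'a set"
  where "hyperfocal S p F =
    generate S {inv\<^bsub>S\<^esub> x \<otimes>\<^bsub>S\<^esub> \<phi> x | Q x \<phi>.
      subgroup Q S \<and> x \<in> Q \<and> \<phi> \<in> p_residual p (Aut_fusion F Q)}"

definition group_exponent :: "('a, 'b) monoid_scheme \<Rightarrow> nat"
  where "group_exponent X = (LEAST n. n > 0 \<and> (\<forall>x\<in>carrier X. x [^]\<^bsub>X\<^esub> n = \<one>\<^bsub>X\<^esub>))"

definition elementary_abelian :: "nat \<Rightarrow> ('a, 'b) monoid_scheme \<Rightarrow> bool"
  where "elementary_abelian p X \<longleftrightarrow> comm_group X \<and> (\<forall>x\<in>carrier X. x [^]\<^bsub>X\<^esub> p = \<one>\<^bsub>X\<^esub>)"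

definition test_subgroup :: "('a, 'b) monoid_scheme \<Rightarrow> nat \<Rightarrow> 'a set \<Rightarrow> bool"
  where "test_subgroup S p A \<longleftrightarrow> subgroup A S \<and>
    (if p = 2 then comm_group (S\<lparr>carrier := A\<rparr>) \<and> group_exponent (S\<lparr>carrier := A\<rparr>) \<le> 4
     else elementary_abelian p (S\<lparr>carrier := A\<rparr>))"

end

theory Submission
  imports Defs "HOL-Algebra.Sylow" "HOL-Algebra.Multiplicative_Group"
begin

text \<open>
Write $\mathfrak{h}$ for the hyperfocal subgroup of $F$ and call a subgroup small abelian if it is
elementary abelian ($p$ odd) or abelian of exponent dividing 4 ($p = 2$). The theorem is the case
$A = 1$ of the following statement, proved by downward induction on the order of the small abelian
subgroup $A$ of $\mathfrak{h}$: every morphism of $F$ on a subgroup $X$ that contains and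
normalizes $A$ lies in $G$
(\<open>F_mor_imp_G_mor_over_small_abelian\<close>).

The hypothesis says that $F$ and $G$ agree on $A$ itself, and extending morphisms of $G$ from
conjugates of $A$ to normalizers reduces the claim to morphisms of $F$ that fix a small abelian
subgroup $B$ pointwise. For these there is a version of Alperin's fusion theorem
(\<open>relative_fusion_theorem\<close>): modulo conjugations, they are generated by automorphisms of
order prime to $p$ of subgroups $Z$ that contain and normalize $B$, acting trivially on $B$.

So let $\<alpha>$ be such an automorphism of $Z$. It acts trivially on $Z$ modulo
$T = Z \<inter> \mathfrak{h}$ by definition of the hyperfocal subgroup. If $B$ is not maximal among the
small abelian subgroups of $T$ normalized by $Z$, a larger one shows by induction that $\<alpha>$ is
in $G$. If it is maximal, then $\<alpha>$ is the identity
(\<open>p'_automorphism_detected_on_small_abelian\<close>). That last fact is pure group theory: a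
minimal subgroup of the centralizer of $B$ in $T$ on which automorphisms of this kind act
nontrivially would have class at most two and exponent $p$ or 4, and would supply an element to
adjoin to $B$.
\<close>

section \<open>Counting fixed points of $p$-groups\<close>

lemma obtain_other_element:
  assumes "p dvd card A" "prime p" "a \<in> A"
  obtains b where "b \<in> A" "b \<noteq> a"
proof -
  have "A \<noteq> {a}"
  proof
    assume "A = {a}"
    then have "is_unit p" using assms(1) by simp
    then show False using assms(2) not_prime_unit by blast
  qed
  then show thesis using that assms(3) by blast
qed

text \<open>The orbit of a point that is not fixed has $p$-power length greater than one, so the points outside
the fixed set come in blocks of size divisible by $p$. Sylow's conjugacy theorem, the growth of normalizers and the
existence of central elements in normal sections all come from this count.\<close>

lemma p_group_fixed_points:
  fixes act :: "'g \<Rightarrow> 'x \<Rightarrow> 'x"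
  assumes V: "group V" and ord: "order V = p ^ k" and p: "prime p" and fin: "finite \<Omega>"
    and closed: "\<And>g x. g \<in> carrier V \<Longrightarrow> x \<in> \<Omega> \<Longrightarrow> act g x \<in> \<Omega>"
    and one: "\<And>x. x \<in> \<Omega> \<Longrightarrow> act \<one>\<^bsub>V\<^esub> x = x"
    and mult: "\<And>g h x. g \<in> carrier V \<Longrightarrow> h \<in> carrier V \<Longrightarrow> x \<in> \<Omega> \<Longrightarrow>
      act (g \<otimes>\<^bsub>V\<^esub> h) x = act g (act h x)"
  shows "p dvd card \<Omega> \<longleftrightarrow> p dvd card {x \<in> \<Omega>. \<forall>g\<in>carrier V. act g x = x}"
proof -
  interpret V: group V by fact
  define \<phi> where "\<phi> g = (\<lambda>x\<in>\<Omega>. act g x)" for g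
  have Bij: "\<phi> g \<in> Bij \<Omega>" if g: "g \<in> carrier V" for g
  proof -
    have "bij_betw (\<phi> g) \<Omega> \<Omega>"
    proof (rule bij_betw_byWitness[where f' = "act (inv\<^bsub>V\<^esub> g)"])
      show "\<forall>a\<in>\<Omega>. act (inv\<^bsub>V\<^esub> g) (\<phi> g a) = a"
        using g mult[of "inv\<^bsub>V\<^esub> g" g] one by (simp add: \<phi>_def)
      show "\<forall>a\<in>\<Omega>. \<phi> g (act (inv\<^bsub>V\<^esub> g) a) = a"
        using g mult[of g "inv\<^bsub>V\<^esub> g"] one closed by (simp add: \<phi>_def)
    qed (use g closed in \<open>auto simp: \<phi>_def\<close>)
    then show ?thesis by (simp add: Bij_def \<phi>_def)
  qed
  have "\<phi> (g \<otimes>\<^bsub>V\<^esub> h) = \<phi> g \<otimes>\<^bsub>BijGroup \<Omega>\<^esub> \<phi> h" if "g \<in> carrier V" "h \<in> carrier V" for g h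
    using that Bij mult closed by (auto simp: BijGroup_def \<phi>_def compose_def fun_eq_iff)
  then have "group_action V \<Omega> \<phi>"
    unfolding group_action_def group_hom_def group_hom_axioms_def hom_def
    using V group_BijGroup[of \<Omega>] Bij by (auto simp: BijGroup_def)
  then interpret group_action V \<Omega> \<phi> .
  define Fix where "Fix = {x \<in> \<Omega>. \<forall>g\<in>carrier V. act g x = x}"
  have in_orbit: "y \<in> orbit V \<phi> x \<longleftrightarrow> (\<exists>g\<in>carrier V. y = act g x)" if "x \<in> \<Omega>" for x y
    using that by (auto simp: orbit_def \<phi>_def)
  have orbit_sub: "orbit V \<phi> x \<subseteq> \<Omega>" if "x \<in> \<Omega>" for x
    using that closed by (auto simp: in_orbit)
  define Orb where "Orb = orbit V \<phi> ` (\<Omega> - Fix)"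
  have orbit_dvd: "p dvd card X" if XO: "X \<in> Orb" for X
  proof -
    obtain x where x: "x \<in> \<Omega>" "x \<notin> Fix" "X = orbit V \<phi> x" using XO unfolding Orb_def by blast
    then obtain g where g: "g \<in> carrier V" "act g x \<noteq> x" by (auto simp: Fix_def)
    have "card X dvd p ^ k"
      using orbit_stabilizer_theorem[OF x(1)] ord x(3) by (metis dvd_triv_left)
    then obtain i where i: "card X = p ^ i"
      using p by (auto simp: divides_primepow_nat)
    have "x = act \<one>\<^bsub>V\<^esub> x" using one x by auto
    then have "x \<in> X" "act g x \<in> X" unfolding x(3) in_orbit[OF x(1)] using g by auto
    then have "{x, act g x} \<subseteq> X" "card {x, act g x} = 2" using g by auto
    then have "card X \<noteq> 1"
      using card_mono[of X "{x, act g x}"] finite_subset[OF orbit_sub[OF x(1)] fin] x(3) by auto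
    then show ?thesis using i by (cases i) auto
  qed
  have disj: "disjnt X Y" if XY: "X \<in> Orb" "Y \<in> Orb" "X \<noteq> Y" for X Y
  proof -
    obtain x y where xy: "x \<in> \<Omega>" "y \<in> \<Omega>" "X = orbit V \<phi> x" "Y = orbit V \<phi> y"
      using XY unfolding Orb_def by blast
    have "X = Y" if "z \<in> X" "z \<in> Y" for z
    proof -
      have z: "z \<in> \<Omega>" using that xy orbit_sub by auto
      have "orbit V \<phi> z = orbit V \<phi> u" if u: "u \<in> \<Omega>" "z \<in> orbit V \<phi> u" for u
        using orbit_sym[OF u(1) z u(2)] orbit_trans u z orbit_sub by blast
      then show ?thesis using xy that by auto
    qed
    then show ?thesis using XY by (auto simp: disjnt_def)
  qed
  have Un: "\<Union>Orb = \<Omega> - Fix"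
  proof
    show "\<Union>Orb \<subseteq> \<Omega> - Fix"
    proof
      fix y assume "y \<in> \<Union>Orb"
      then obtain x where x: "x \<in> \<Omega>" "x \<notin> Fix" "y \<in> orbit V \<phi> x" by (auto simp: Orb_def)
      have y: "y \<in> \<Omega>" using x orbit_sub by auto
      have "x \<in> orbit V \<phi> y" using orbit_sym x y by auto
      then obtain g where "g \<in> carrier V" "x = act g y" using in_orbit[OF y] by auto
      moreover have "act g y = y" if "y \<in> Fix"
        using that \<open>g \<in> carrier V\<close> by (simp add: Fix_def)
      ultimately have "y \<notin> Fix" using x by auto
      then show "y \<in> \<Omega> - Fix" using y by blast
    qed
    show "\<Omega> - Fix \<subseteq> \<Union>Orb"
      using orbit_refl by (auto simp: Orb_def)
  qed
  have "card (\<Union>Orb) = sum card Orb"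
  proof (rule card_Union_disjoint)
    show "pairwise disjnt Orb" using disj by (auto simp: pairwise_def)
    show "finite X" if "X \<in> Orb" for X
      using that orbit_sub finite_subset[OF _ fin] unfolding Orb_def by blast
  qed
  then have "p dvd card (\<Omega> - Fix)"
    using Un orbit_dvd by (metis dvd_sum)
  moreover have "card \<Omega> = card Fix + card (\<Omega> - Fix)"
    using fin card_Un_disjoint[of Fix "\<Omega> - Fix"] by (auto simp: Fix_def Un_absorb1 Collect_conv_if intro!: arg_cong[of _ _ card])
  ultimately show ?thesis unfolding Fix_def[symmetric] by (simp add: dvd_add_left_iff)
qed


text \<open>Together with associativity and the rule for inverses of products, these two cancellations rewrite
words in group elements to a normal form.\<close>

lemma (in group) mult_inv_cancel:
  "x \<in> carrier G \<Longrightarrow> y \<in> carrier G \<Longrightarrow> x \<otimes> (inv x \<otimes> y) = y"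
  "x \<in> carrier G \<Longrightarrow> y \<in> carrier G \<Longrightarrow> inv x \<otimes> (x \<otimes> y) = y"
  by (simp_all flip: m_assoc)

lemmas (in group) word_simps = m_assoc inv_mult_group mult_inv_cancel

lemma (in group) r_coset_eq_iff:
  assumes W: "subgroup W G" and x: "x \<in> carrier G" and y: "y \<in> carrier G"
  shows "W #> x = W #> y \<longleftrightarrow> x \<otimes> inv y \<in> W"
  using x y coset_join1[OF _ _ W] coset_join2[OF _ W] subgroup.subset[OF W]
    coset_mult_inv1[of W x y] coset_mult_inv2[of W x y]
  by (metis inv_closed m_closed)

lemma (in group) card_cosets_in_subgroup:
  assumes W: "subgroup W G" and Z: "subgroup Z G" and sub: "W \<subseteq> Z"
  shows "card ((\<lambda>z. W #> z) ` Z) * card W = card Z"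
proof -
  have "(\<lambda>z. W #> z) ` Z = rcosets\<^bsub>G\<lparr>carrier := Z\<rparr>\<^esub> W"
    by (auto simp: RCOSETS_def r_coset_def)
  then show ?thesis
    using group.lagrange[OF subgroup.subgroup_is_group[OF Z is_group] subgroup_incl[OF W Z sub]]
    by (simp add: order_def)
qed

text \<open>A group $V$ mapped into $Z$ by $f$ acts on the right cosets of $W$ in $Z$; the coset of $z$ is fixed
exactly when $z$ conjugates the image of $V$ into $W$. If the index is prime to $p$, a fixed coset
exists and this becomes Sylow's conjugacy theorem; if $V = W$ is a proper subgroup of a $p$-group, a
second fixed coset exists and normalizers grow.\<close>

lemma (in group) p_group_fixes_cosets:
  assumes V: "group V" and ord: "order V = p ^ k" and p: "prime p" and fin: "finite (carrier G)"
    and f: "f \<in> hom V G" and fZ: "f ` carrier V \<subseteq> Z"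
    and W: "subgroup W G" and Z: "subgroup Z G" and sub: "W \<subseteq> Z"
  shows "p dvd card ((\<lambda>z. W #> z) ` Z) \<longleftrightarrow>
    p dvd card ((\<lambda>z. W #> z) ` {z \<in> Z. \<forall>v\<in>carrier V. z \<otimes> f v \<otimes> inv z \<in> W})"
proof -
  interpret V: group V by fact
  interpret W: subgroup W G by fact
  interpret Z: subgroup Z G by fact
  interpret f: group_hom V G f by unfold_locales (use f in auto)
  let ?\<Omega> = "(\<lambda>z. W #> z) ` Z"
  have fZ': "f v \<in> Z" if "v \<in> carrier V" for v using that fZ by auto
  have coset: "(W #> z) #> inv (f v) = W #> (z \<otimes> inv (f v))" if "z \<in> Z" "v \<in> carrier V" for z v
    using that coset_mult_assoc[OF W.subset, of z "inv (f v)"] by auto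
  have "p dvd card ?\<Omega> \<longleftrightarrow>
      p dvd card {C \<in> ?\<Omega>. \<forall>v\<in>carrier V. C #> inv (f v) = C}"
  proof (rule p_group_fixed_points[OF V ord p])
    show "finite ?\<Omega>" using fin finite_subset[OF Z.subset] by auto
    show "C #> inv (f v) \<in> ?\<Omega>" if "v \<in> carrier V" "C \<in> ?\<Omega>" for v C
      using that fZ' by (auto simp: coset)
    show "C #> inv (f \<one>\<^bsub>V\<^esub>) = C" if C: "C \<in> ?\<Omega>" for C
    proof -
      obtain z where "z \<in> Z" "C = W #> z" using C by auto
      then show ?thesis using coset[of z "\<one>\<^bsub>V\<^esub>"] by simp
    qed
    show "C #> inv (f (g \<otimes>\<^bsub>V\<^esub> h)) = C #> inv (f h) #> inv (f g)"
      if gh: "g \<in> carrier V" "h \<in> carrier V" and "C \<in> ?\<Omega>" for g h C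
    proof -
      obtain z where z: "z \<in> Z" "C = W #> z" using \<open>C \<in> ?\<Omega>\<close> by auto
      then have zh: "z \<otimes> inv (f h) \<in> Z" "z \<in> carrier G" using gh fZ' by auto
      have "C #> inv (f h) #> inv (f g) = W #> (z \<otimes> inv (f h) \<otimes> inv (f g))"
        using coset[OF z(1) gh(2)] coset[OF zh(1) gh(1)] z(2) by simp
      also have "\<dots> = C #> inv (f (g \<otimes>\<^bsub>V\<^esub> h))"
        using coset[OF z(1), of "g \<otimes>\<^bsub>V\<^esub> h"] z zh(2) gh by (simp add: word_simps)
      finally show ?thesis by simp
    qed
  qed
  also have "{C \<in> ?\<Omega>. \<forall>v\<in>carrier V. C #> inv (f v) = C} =
      (\<lambda>z. W #> z) ` {z \<in> Z. \<forall>v\<in>carrier V. z \<otimes> f v \<otimes> inv z \<in> W}"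
  proof -
    have *: "(W #> z) #> inv (f v) = W #> z \<longleftrightarrow> z \<otimes> f v \<otimes> inv z \<in> W"
      if "z \<in> Z" "v \<in> carrier V" for z v
    proof -
      have zv: "z \<in> carrier G" "f v \<in> carrier G" using that by auto
      then have "W #> (z \<otimes> inv (f v)) = W #> z \<longleftrightarrow> z \<otimes> inv (z \<otimes> inv (f v)) \<in> W"
        by (subst eq_commute) (simp add: r_coset_eq_iff[OF W])
      also have "z \<otimes> inv (z \<otimes> inv (f v)) = z \<otimes> f v \<otimes> inv z"
        using zv by (simp add: word_simps)
      finally show ?thesis using coset[OF that] by simp
    qed
    show ?thesis using * by blast
  qed
  finally show ?thesis .
qed

context finite_p_group
begin

lemma finite_carrier [simp]: "finite (carrier S)"
  using order_p_power prime_p order_gt_0_iff_finite by (metis prime_gt_0_nat zero_less_power)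

lemma finite_subgroup: "subgroup H S \<Longrightarrow> finite H"
  using subgroup.subset finite_subset finite_carrier by blast

lemma card_subgroup: "subgroup H S \<Longrightarrow> \<exists>k. card H = p ^ k"
  using order_p_power lagrange prime_p divides_primepow_nat by (metis dvd_triv_right)

lemma subgroup_group: "subgroup H S \<Longrightarrow> group (S\<lparr>carrier := H\<rparr>)"
  using subgroup.subgroup_is_group is_group by blast

lemma p_dvd_index:
  assumes W: "subgroup W S" and Z: "subgroup Z S" and sub: "W \<subset> Z"
  shows "p dvd card ((\<lambda>z. W #> z) ` Z)"
proof -
  let ?n = "card ((\<lambda>z. W #> z) ` Z)"
  have n: "?n * card W = card Z" using card_cosets_in_subgroup[OF W Z] sub by auto
  then obtain i where i: "?n = p ^ i"
    using card_subgroup[OF Z] prime_p divides_primepow_nat by (metis dvd_triv_left)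
  have "?n \<noteq> 1" using n psubset_card_mono[OF finite_subgroup[OF Z] sub] by auto
  then show ?thesis using i by (cases i) auto
qed

lemma normalizers_grow:
  assumes M: "subgroup M S" and L: "subgroup L S" and sub: "M \<subset> L"
  shows "\<exists>g\<in>L - M. \<forall>m\<in>M. g \<otimes> m \<otimes> inv g \<in> M"
proof -
  interpret M: subgroup M S by fact
  interpret L: subgroup L S by fact
  obtain k where k: "card M = p ^ k" using card_subgroup[OF M] by auto
  let ?N = "{z \<in> L. \<forall>v\<in>M. z \<otimes> v \<otimes> inv z \<in> M}"
  have "p dvd card ((\<lambda>z. M #> z) ` ?N)"
    using p_group_fixes_cosets[OF subgroup_group[OF M] _ prime_p finite_carrier _ _ M L,
        of k "\<lambda>x. x"] p_dvd_index[OF M L sub] sub k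
    by (auto simp: order_def hom_def)
  moreover have "M #> \<one> \<in> (\<lambda>z. M #> z) ` ?N" by (rule imageI) auto
  ultimately obtain C where "C \<in> (\<lambda>z. M #> z) ` ?N" "C \<noteq> M #> \<one>"
    by (rule obtain_other_element[OF _ prime_p])
  then obtain z where z: "z \<in> ?N" "M #> z \<noteq> M #> \<one>" by blast
  then have "z \<notin> M" using coset_join2[OF _ M] M.subset by auto
  then show ?thesis using z by auto
qed

text \<open>This says that the center of $X/B$ meets the normal subgroup $D/B$ nontrivially (when $B, D$ lie in
$X$); it is obtained by letting $X$ act by conjugation on the cosets of $B$ in $D$, which avoids the
quotient group.\<close>

lemma fixed_point_in_normal_section:
  assumes X: "subgroup X S" and B: "subgroup B S" and D: "subgroup D S" and sub: "B \<subset> D"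
    and D_norm: "\<And>g d. g \<in> X \<Longrightarrow> d \<in> D \<Longrightarrow> g \<otimes> d \<otimes> inv g \<in> D"
    and B_norm: "\<And>g b. g \<in> X \<Longrightarrow> b \<in> B \<Longrightarrow> g \<otimes> b \<otimes> inv g \<in> B"
  shows "\<exists>y\<in>D - B. \<forall>g\<in>X. g \<otimes> y \<otimes> inv g \<otimes> inv y \<in> B"
proof -
  interpret X: subgroup X S by fact
  interpret B: subgroup B S by fact
  interpret D: subgroup D S by fact
  let ?\<Omega> = "(\<lambda>z. B #> z) ` D"
  let ?act = "\<lambda>g C. (\<lambda>c. g \<otimes> c \<otimes> inv g) ` C"
  obtain k where k: "card X = p ^ k" using card_subgroup[OF X] by auto
  have act: "?act g (B #> y) = B #> (g \<otimes> y \<otimes> inv g)" if g: "g \<in> X" and y: "y \<in> D" for g y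
  proof
    have c: "g \<otimes> (b \<otimes> y) \<otimes> inv g = (g \<otimes> b \<otimes> inv g) \<otimes> (g \<otimes> y \<otimes> inv g)" if "b \<in> B" for b
    proof -
      have "b \<in> carrier S" "y \<in> carrier S" "g \<in> carrier S" using that g y by auto
      then show ?thesis by (simp add: word_simps)
    qed
    show "?act g (B #> y) \<subseteq> B #> (g \<otimes> y \<otimes> inv g)"
      using c B_norm[OF g] unfolding r_coset_def by auto
    show "B #> (g \<otimes> y \<otimes> inv g) \<subseteq> ?act g (B #> y)"
    proof
      fix u assume "u \<in> B #> (g \<otimes> y \<otimes> inv g)"
      then obtain b where b: "b \<in> B" "u = b \<otimes> (g \<otimes> y \<otimes> inv g)" by (auto simp: r_coset_def)
      let ?b = "inv g \<otimes> b \<otimes> g"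
      have b': "?b \<in> B" using B_norm[of "inv g" b] g b by auto
      have "b \<in> carrier S" "y \<in> carrier S" "g \<in> carrier S" using b g y by auto
      then have "g \<otimes> ?b \<otimes> inv g = b" by (simp add: word_simps)
      then have "u = g \<otimes> (?b \<otimes> y) \<otimes> inv g" using c[OF b'] b by simp
      then show "u \<in> ?act g (B #> y)" using b' by (auto simp: r_coset_def)
    qed
  qed
  have "p dvd card ?\<Omega> \<longleftrightarrow> p dvd card {C \<in> ?\<Omega>. \<forall>g\<in>carrier (S\<lparr>carrier := X\<rparr>). ?act g C = C}"
  proof (rule p_group_fixed_points[OF subgroup_group[OF X] _ prime_p])
    show "order (S\<lparr>carrier := X\<rparr>) = p ^ k" using k by (simp add: order_def)
    show "finite ?\<Omega>" using finite_subgroup[OF D] by auto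
    show "?act g C \<in> ?\<Omega>" if "g \<in> carrier (S\<lparr>carrier := X\<rparr>)" "C \<in> ?\<Omega>" for g C
      using that D_norm by (auto simp: act)
    show "?act \<one>\<^bsub>S\<lparr>carrier := X\<rparr>\<^esub> C = C" if C: "C \<in> ?\<Omega>" for C
    proof -
      obtain z where "z \<in> D" "C = B #> z" using C by auto
      then show ?thesis using act[OF X.one_closed, of z] by simp
    qed
    show "?act (g \<otimes>\<^bsub>S\<lparr>carrier := X\<rparr>\<^esub> h) C = ?act g (?act h C)"
      if gh: "g \<in> carrier (S\<lparr>carrier := X\<rparr>)" "h \<in> carrier (S\<lparr>carrier := X\<rparr>)" and "C \<in> ?\<Omega>" for g h C
    proof -
      obtain y where y: "y \<in> D" "C = B #> y" using \<open>C \<in> ?\<Omega>\<close> by auto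
      have c: "g \<in> carrier S" "h \<in> carrier S" "y \<in> carrier S" using gh y by auto
      have "?act g (?act h C) = B #> (g \<otimes> (h \<otimes> y \<otimes> inv h) \<otimes> inv g)"
        using gh y D_norm[of h y] act[of h y] act[of g "h \<otimes> y \<otimes> inv h"] by simp
      also have "g \<otimes> (h \<otimes> y \<otimes> inv h) \<otimes> inv g = (g \<otimes> h) \<otimes> y \<otimes> inv (g \<otimes> h)"
        using c by (simp add: word_simps)
      finally show ?thesis using gh y act[of "g \<otimes> h" y] by simp
    qed
  qed
  then have "p dvd card {C \<in> ?\<Omega>. \<forall>g\<in>X. ?act g C = C}" (is "p dvd card ?Fix")
    using p_dvd_index[OF B D sub] by simp
  moreover have "B #> \<one> \<in> ?Fix"
    using act[of _ \<one>] by auto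
  ultimately obtain C where "C \<in> ?Fix" "C \<noteq> B #> \<one>"
    by (rule obtain_other_element[OF _ prime_p])
  then obtain y where y: "y \<in> D" "B #> y \<noteq> B #> \<one>" "\<forall>g\<in>X. ?act g (B #> y) = B #> y" by blast
  have "y \<notin> B" using y coset_join2[OF _ B] B.subset by auto
  moreover have "g \<otimes> y \<otimes> inv g \<otimes> inv y \<in> B" if g: "g \<in> X" for g
  proof -
    have "B #> (g \<otimes> y \<otimes> inv g) = B #> y" using y act[OF g] g by auto
    moreover have "g \<in> carrier S" "y \<in> carrier S" using g y by auto
    ultimately show ?thesis using r_coset_eq_iff[OF B] by simp
  qed
  ultimately show ?thesis using y(1) by blast
qed

end

text \<open>Applied to conjugations and to automorphisms of a subgroup $X$; the latter are homomorphisms on $X$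
only, hence the restricted hypotheses on $\<tau>$.\<close>

lemma (in group) generate_closed_under_hom:
  assumes X: "subgroup X G" and A: "A \<subseteq> X"
    and hom: "\<And>x y. x \<in> X \<Longrightarrow> y \<in> X \<Longrightarrow> \<tau> (x \<otimes> y) = \<tau> x \<otimes> \<tau> y"
    and closed: "\<And>x. x \<in> X \<Longrightarrow> \<tau> x \<in> carrier G"
    and gen: "\<And>a. a \<in> A \<Longrightarrow> \<tau> a \<in> generate G A" and x: "x \<in> generate G A"
  shows "\<tau> x \<in> generate G A"
proof -
  interpret X: subgroup X G by fact
  have AG: "A \<subseteq> carrier G" using A X.subset by auto
  interpret gen: subgroup "generate G A" G by (rule generate_is_subgroup[OF AG])
  have sub: "generate G A \<subseteq> X" using generate_subgroup_incl[OF A X] .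
  have one: "\<tau> \<one> = \<one>"
    using hom[OF X.one_closed X.one_closed] closed[OF X.one_closed] by simp
  show ?thesis using x
  proof (induction rule: generate.induct)
    case one
    then show ?case using \<open>\<tau> \<one> = \<one>\<close> by simp
  next
    case (incl h)
    then show ?case using gen by simp
  next
    case (inv h)
    have h: "h \<in> X" using inv A by auto
    have "\<tau> (inv h) \<otimes> \<tau> h = \<one>" using hom[of "inv h" h] one h by auto
    then have "\<tau> (inv h) = inv (\<tau> h)"
      using inv_equality[OF _ closed closed, of "inv h" h] h by simp
    then show ?case using gen[OF inv] by simp
  next
    case (eng h1 h2)
    then have "h1 \<in> X" "h2 \<in> X" using sub by auto
    then show ?case using eng hom by simp
  qed
qed

lemma (in group) subgroup_commuting:
  assumes A: "A \<subseteq> carrier G"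
  shows "subgroup {g \<in> carrier G. \<forall>a\<in>A. g \<otimes> a = a \<otimes> g} G" (is "subgroup ?C G")
proof (rule subgroupI)
  show "?C \<subseteq> carrier G" by auto
  have "\<one> \<in> ?C" using A by auto
  then show "?C \<noteq> {}" by blast
  show "inv g \<in> ?C" if g: "g \<in> ?C" for g
  proof -
    have "inv g \<otimes> a = a \<otimes> inv g" if a: "a \<in> A" for a
    proof -
      have ga: "g \<in> carrier G" "a \<in> carrier G" "g \<otimes> a = a \<otimes> g" using g a A by auto
      then have "inv g \<otimes> (g \<otimes> a) \<otimes> inv g = inv g \<otimes> (a \<otimes> g) \<otimes> inv g" by simp
      then show ?thesis using ga(1,2) by (simp add: word_simps)
    qed
    then show ?thesis using g by auto
  qed
  show "g \<otimes> h \<in> ?C" if gh: "g \<in> ?C" "h \<in> ?C" for g h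
  proof -
    have "g \<otimes> h \<otimes> a = a \<otimes> (g \<otimes> h)" if a: "a \<in> A" for a
    proof -
      have "g \<in> carrier G" "h \<in> carrier G" "a \<in> carrier G" "g \<otimes> a = a \<otimes> g" "h \<otimes> a = a \<otimes> h"
        using gh a A by auto
      then show ?thesis by (metis m_assoc)
    qed
    then show ?thesis using gh by auto
  qed
qed

text \<open>Moving each factor $b$ past the factors $a$ that follow it creates one commutator $c$ per pair. So
the power map is a homomorphism as soon as $c$ has order dividing the binomial coefficient.\<close>

lemma (in group) pow_mult_class_two:
  assumes a: "a \<in> carrier G" and b: "b \<in> carrier G" and c: "c \<in> carrier G"
    and ba: "b \<otimes> a = a \<otimes> b \<otimes> c" and ca: "c \<otimes> a = a \<otimes> c" and cb: "c \<otimes> b = b \<otimes> c"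
  shows "(a \<otimes> b) [^] (n::nat) = a [^] n \<otimes> b [^] n \<otimes> c [^] (n choose 2)"
proof -
  have move: "b [^] n \<otimes> a = a \<otimes> b [^] n \<otimes> c [^] n" for n :: nat
  proof (induction n)
    case (Suc n)
    have cn: "c \<otimes> c [^] n = c [^] n \<otimes> c" using group_commutes_pow[of c c n] c by simp
    have "b [^] Suc n \<otimes> a = b [^] n \<otimes> (a \<otimes> b \<otimes> c)" using a b ba by (simp add: m_assoc)
    also have "\<dots> = (b [^] n \<otimes> a) \<otimes> (b \<otimes> c)" using a b c by (simp add: m_assoc)
    also have "\<dots> = a \<otimes> b [^] n \<otimes> (c [^] n \<otimes> b) \<otimes> c" using a b c by (simp add: Suc m_assoc)
    also have "c [^] n \<otimes> b = b \<otimes> c [^] n"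
      using group_commutes_pow[of c b n] b c cb by simp
    finally show ?case using a b c by (simp add: m_assoc)
  qed (use a b c in simp)
  show ?thesis
  proof (induction n)
    case (Suc n)
    have ct: "c [^] k \<otimes> (a \<otimes> b) = a \<otimes> b \<otimes> c [^] k" for k :: nat
      using group_commutes_pow[of c "a \<otimes> b" k] a b c ca cb by (metis m_assoc m_closed)
    have cn: "c [^] n \<otimes> b = b \<otimes> c [^] n" using group_commutes_pow[of c b n] b c cb by simp
    have "(a \<otimes> b) [^] Suc n = a [^] n \<otimes> b [^] n \<otimes> (c [^] (n choose 2) \<otimes> (a \<otimes> b))"
      using a b c by (simp add: Suc m_assoc)
    also have "\<dots> = a [^] n \<otimes> (b [^] n \<otimes> a) \<otimes> b \<otimes> c [^] (n choose 2)"
      using a b c by (simp add: ct m_assoc)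
    also have "\<dots> = a [^] n \<otimes> a \<otimes> b [^] n \<otimes> (c [^] n \<otimes> b) \<otimes> c [^] (n choose 2)"
      using a b c by (simp add: move m_assoc)
    also have "\<dots> = a [^] Suc n \<otimes> b [^] Suc n \<otimes> (c [^] n \<otimes> c [^] (n choose 2))"
      using a b c by (simp add: cn m_assoc)
    also have "c [^] n \<otimes> c [^] (n choose 2) = c [^] (Suc n choose 2)"
      using c by (simp add: nat_pow_mult numeral_2_eq_2)
    finally show ?case .
  qed (use a b c in \<open>simp add: binomial_eq_0\<close>)
qed

context finite_p_group
begin

text \<open>A subgroup of index $p$ is normal with cyclic quotient of order $p$, so it contains all $p$-th
powers and commutators. Hence these elements generate a proper subgroup of $D$.\<close>

lemma exists_proper_frattini_container:
  assumes D: "subgroup D S" and nontriv: "D \<noteq> {\<one>}"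
  shows "\<exists>M. subgroup M S \<and> M \<subset> D \<and> (\<forall>x\<in>D. x [^] p \<in> M) \<and>
    (\<forall>x\<in>D. \<forall>y\<in>D. x \<otimes> y \<otimes> inv x \<otimes> inv y \<in> M)"
proof -
  interpret D: subgroup D S by fact
  let ?D = "S\<lparr>carrier := D\<rparr>"
  interpret GD: group ?D by (rule subgroup_group[OF D])
  obtain k where k: "card D = p ^ k" using card_subgroup[OF D] by auto
  have "k \<noteq> 0"
  proof
    assume "k = 0"
    then have "card D = 1" using k by simp
    then show False
      using nontriv card_seteq[OF finite_subgroup[OF D], of "{\<one>}"] D.one_closed by auto
  qed
  then obtain j where j: "k = Suc j" by (cases k) auto
  have "\<exists>M. subgroup M ?D \<and> card M = p ^ j"
    using sylow_thm[OF prime_p GD.is_group, of j p] k j finite_subgroup[OF D] by (simp add: order_def)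
  then obtain M where MD: "subgroup M ?D" and cM: "card M = p ^ j" by auto
  have M: "subgroup M S" using incl_subgroup[OF D MD] .
  interpret M: subgroup M S by fact
  have sub: "M \<subseteq> D" using subgroup.subset[OF MD] by simp
  have psub: "M \<subset> D" using sub cM k j prime_p by (auto simp: prime_nat_iff)
  have index: "card ((\<lambda>z. M #> z) ` D) = p"
    using card_cosets_in_subgroup[OF M D sub] cM k j prime_gt_0_nat[OF prime_p] by simp
  let ?N = "{z \<in> D. \<forall>v\<in>M. z \<otimes> v \<otimes> inv z \<in> M}"
  have "p dvd card ((\<lambda>z. M #> z) ` ?N)"
    using p_group_fixes_cosets[OF subgroup_group[OF M] _ prime_p finite_carrier _ _ M D,
        of j "\<lambda>x. x"] index sub cM by (auto simp: order_def hom_def)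
  moreover have "card ((\<lambda>z. M #> z) ` ?N) \<noteq> 0"
    using M.subset finite_subgroup[OF D] by (auto intro!: exI[of _ \<one>])
  ultimately have "card ((\<lambda>z. M #> z) ` D) \<le> card ((\<lambda>z. M #> z) ` ?N)"
    using index dvd_imp_le by auto
  then have all: "(\<lambda>z. M #> z) ` ?N = (\<lambda>z. M #> z) ` D"
    using finite_subgroup[OF D] by (intro card_seteq) auto
  have norm: "z \<otimes> v \<otimes> inv z \<in> M" if z: "z \<in> D" and v: "v \<in> M" for z v
  proof -
    have "M #> z \<in> (\<lambda>z. M #> z) ` ?N" unfolding all using z by simp
    then obtain n where n: "n \<in> ?N" "M #> z = M #> n" by blast
    have c: "z \<in> carrier S" "n \<in> carrier S" "v \<in> carrier S" using z n v by auto
    have m: "z \<otimes> inv n \<in> M" using n r_coset_eq_iff[OF M] c by simp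
    have "(z \<otimes> inv n) \<otimes> (n \<otimes> v \<otimes> inv n) \<otimes> inv (z \<otimes> inv n) \<in> M"
      using M.m_closed[OF M.m_closed[OF m] M.m_inv_closed[OF m]] n v by simp
    also have "(z \<otimes> inv n) \<otimes> (n \<otimes> v \<otimes> inv n) \<otimes> inv (z \<otimes> inv n) = z \<otimes> v \<otimes> inv z"
      using c by (simp add: word_simps)
    finally show ?thesis .
  qed
  have "M \<lhd> ?D"
    unfolding GD.normal_inv_iff using MD norm m_inv_consistent[OF D] by simp
  then interpret N: normal M ?D .
  interpret Q: group "?D Mod M" by (rule N.factorgroup_is_group)
  have rcos: "carrier (?D Mod M) = (\<lambda>z. M #> z) ` D"
    by (auto simp: FactGroup_def RCOSETS_def r_coset_def)
  have ord: "order (?D Mod M) = p" using index by (simp add: order_def rcos)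
  have mult: "(M #> x) \<otimes>\<^bsub>?D Mod M\<^esub> (M #> y) = M #> (x \<otimes> y)" if "x \<in> D" "y \<in> D" for x y
    using N.rcos_sum[of x y] that by (simp add: FactGroup_def r_coset_def)
  have pow: "x [^] p \<in> M" if x: "x \<in> D" for x
  proof -
    have "(M #>\<^bsub>?D\<^esub> x) [^]\<^bsub>?D Mod M\<^esub> p = \<one>\<^bsub>?D Mod M\<^esub>"
      using Q.pow_order_eq_1 x ord by (auto simp: rcos r_coset_def)
    then have "M #> (x [^] p) = M"
      using N.FactGroup_pow[of x p] nat_pow_consistent[of x p D] x by (simp add: r_coset_def FactGroup_def)
    then show ?thesis using coset_join1[OF _ _ M] M.subset x by auto
  qed
  have comm: "x \<otimes> y \<otimes> inv x \<otimes> inv y \<in> M" if x: "x \<in> D" and y: "y \<in> D" for x y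
  proof -
    obtain d where d: "d \<in> D - M" "\<forall>g\<in>D. g \<otimes> d \<otimes> inv g \<otimes> inv d \<in> M"
      using fixed_point_in_normal_section[OF D M D psub] norm by blast
    define K where "K = {q \<in> carrier (?D Mod M). \<forall>a\<in>carrier (?D Mod M). q \<otimes>\<^bsub>?D Mod M\<^esub> a = a \<otimes>\<^bsub>?D Mod M\<^esub> q}"
    have K: "subgroup K (?D Mod M)" unfolding K_def by (rule Q.subgroup_commuting) simp
    have eq: "M #> (u \<otimes> v) = M #> (v \<otimes> u) \<longleftrightarrow> u \<otimes> v \<otimes> inv u \<otimes> inv v \<in> M" if "u \<in> D" "v \<in> D" for u v
      using r_coset_eq_iff[OF M, of "u \<otimes> v" "v \<otimes> u"] that D.mem_carrier by (simp add: inv_mult_group m_assoc)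
    have "M #> (d \<otimes> g) = M #> (g \<otimes> d)" if "g \<in> D" for g using eq[of g d] d that by auto
    then have "(M #> d) \<otimes>\<^bsub>?D Mod M\<^esub> (M #> g) = (M #> g) \<otimes>\<^bsub>?D Mod M\<^esub> (M #> d)" if "g \<in> D" for g
      using d(1) that mult by (metis DiffD1)
    then have "M #> d \<in> K" using d(1) unfolding K_def rcos by blast
    moreover have "M #> d \<noteq> M" using coset_join1[OF _ _ M] M.subset d(1) by auto
    moreover have "\<one>\<^bsub>?D Mod M\<^esub> = M" by (simp add: FactGroup_def)
    ultimately have "card K \<noteq> 1"
      using subgroup.one_closed[OF K] by (auto simp: card_1_singleton_iff)
    moreover have "card K dvd p" using Q.lagrange[OF K] ord by (metis dvd_triv_right)
    ultimately have "card K = card (carrier (?D Mod M))"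
      using prime_p ord by (auto simp: prime_nat_iff order_def)
    then have "K = carrier (?D Mod M)"
      using finite_subgroup[OF D] by (intro card_seteq) (auto simp: K_def rcos)
    then have "M #> x \<in> K" "M #> y \<in> carrier (?D Mod M)" using x y by (simp_all only: rcos) auto
    then have "(M #> x) \<otimes>\<^bsub>?D Mod M\<^esub> (M #> y) = (M #> y) \<otimes>\<^bsub>?D Mod M\<^esub> (M #> x)"
      unfolding K_def by blast
    then have "M #> (x \<otimes> y) = M #> (y \<otimes> x)" unfolding mult[OF x y] mult[OF y x] .
    then show ?thesis using eq[OF x y] by blast
  qed
  show ?thesis using M psub pow comm by blast
qed

end

section \<open>Automorphisms of order prime to $p$\<close>

context finite_p_group
begin

definition normalized_by :: "'a set \<Rightarrow> 'a set \<Rightarrow> bool"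
  where "normalized_by X B \<longleftrightarrow> (\<forall>g\<in>X. \<forall>b\<in>B. g \<otimes> b \<otimes> inv g \<in> B)"

text \<open>For $p$ odd these are the elementary abelian subgroups, for $p = 2$ the abelian subgroups of
exponent dividing 4. The exponent is chosen so that in a group of class two with commutators of
order $p$ the corresponding power map is a homomorphism.\<close>

definition small_abelian :: "'a set \<Rightarrow> bool"
  where "small_abelian B \<longleftrightarrow> subgroup B S \<and> (\<forall>x\<in>B. \<forall>y\<in>B. x \<otimes> y = y \<otimes> x) \<and>
    (\<forall>x\<in>B. x [^] (if p = 2 then 4 else p) = \<one>)"

text \<open>An automorphism of $X$ of order prime to $p$, given by a plain function that is looked at on $X$
only; bijectivity on $X$ is a consequence of the last condition.\<close>

definition p'_automorphism :: "'a set \<Rightarrow> ('a \<Rightarrow> 'a) \<Rightarrow> bool"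
  where "p'_automorphism X \<sigma> \<longleftrightarrow> \<sigma> ` X \<subseteq> X \<and> (\<forall>x\<in>X. \<forall>y\<in>X. \<sigma> (x \<otimes> y) = \<sigma> x \<otimes> \<sigma> y) \<and>
    (\<exists>n. coprime n p \<and> (\<forall>x\<in>X. (\<sigma> ^^ n) x = x))"

lemma normalized_byD: "normalized_by X B \<Longrightarrow> g \<in> X \<Longrightarrow> b \<in> B \<Longrightarrow> g \<otimes> b \<otimes> inv g \<in> B"
  by (simp add: normalized_by_def)

lemma p'_automorphismD:
  assumes "p'_automorphism X \<sigma>"
  shows "x \<in> X \<Longrightarrow> \<sigma> x \<in> X" "x \<in> X \<Longrightarrow> y \<in> X \<Longrightarrow> \<sigma> (x \<otimes> y) = \<sigma> x \<otimes> \<sigma> y"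
  using assms by (auto simp: p'_automorphism_def)

text \<open>If $\<sigma>$ fixes $c = x^{-1} \<sigma>(x)$, then $\<sigma>^i(x) = x c^i$, so the order of $c$
divides a number prime to $p$ as well as the order of $S$. This is the only form of coprime action
that the argument uses.\<close>

lemma p'_automorphism_unipotent:
  assumes X: "subgroup X S" and \<sigma>: "p'_automorphism X \<sigma>" and x: "x \<in> X"
    and fixed: "\<sigma> (inv x \<otimes> \<sigma> x) = inv x \<otimes> \<sigma> x"
  shows "\<sigma> x = x"
proof -
  interpret X: subgroup X S by fact
  define c where "c = inv x \<otimes> \<sigma> x"
  obtain n where n: "coprime n p" "(\<sigma> ^^ n) x = x"
    using \<sigma> x by (auto simp: p'_automorphism_def)
  have cX: "c \<in> X" using x p'_automorphismD(1)[OF \<sigma>] by (auto simp: c_def)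
  have xc: "x \<in> carrier S" "c \<in> carrier S" using x cX by auto
  have \<sigma>x: "\<sigma> x = x \<otimes> c" using p'_automorphismD(1)[OF \<sigma> x] xc by (simp add: c_def mult_inv_cancel)
  have \<sigma>c: "\<sigma> c = c" using fixed by (simp add: c_def)
  have cn: "c [^] i \<in> X \<and> \<sigma> (c [^] i) = c [^] i" for i :: nat
  proof (induction i)
    case 0
    have "\<sigma> \<one> \<otimes> \<sigma> \<one> = \<sigma> \<one>" using p'_automorphismD(2)[OF \<sigma>, of \<one> \<one>] by simp
    then have "\<sigma> \<one> = \<one>" using p'_automorphismD(1)[OF \<sigma>, of \<one>] by simp
    then show ?case by simp
  next
    case (Suc i)
    then show ?case using p'_automorphismD(2)[OF \<sigma>, of "c [^] i" c] cX \<sigma>c by simp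
  qed
  have "(\<sigma> ^^ i) x = x \<otimes> c [^] i" for i
  proof (induction i)
    case (Suc i)
    then show ?case
      using p'_automorphismD(2)[OF \<sigma> x, of "c [^] i"] cn xc
      by (simp add: \<sigma>x m_assoc group_commutes_pow)
  qed (use xc in simp)
  then have "x \<otimes> c [^] n = x" using n by metis
  then have "c [^] n = \<one>" using xc by simp
  then have "ord c dvd n" using pow_eq_id[OF xc(2)] by simp
  moreover obtain k where "order S = p ^ k" using order_p_power by auto
  moreover have "ord c dvd order S" using ord_dvd_group_order[OF xc(2)] .
  ultimately have "ord c dvd 1"
    using coprime_common_divisor[of n "p ^ k" "ord c"] n(1) by simp
  then have "c = \<one>" using pow_eq_id[OF xc(2), of 1] xc by simp
  then show ?thesis using \<sigma>x xc by simp
qed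

lemma p'_automorphism_bij:
  assumes X: "subgroup X S" and \<sigma>: "p'_automorphism X \<sigma>"
  shows "bij_betw \<sigma> X X"
proof -
  obtain n where n: "coprime n p" "\<And>x. x \<in> X \<Longrightarrow> (\<sigma> ^^ n) x = x"
    using \<sigma> by (auto simp: p'_automorphism_def)
  have "n \<noteq> 0" using n prime_p by (metis coprime_0_left_iff not_prime_unit)
  then obtain m where m: "n = Suc m" by (cases n) auto
  have "inj_on \<sigma> X"
    by (rule inj_on_inverseI[where g = "\<sigma> ^^ m"]) (use n m in \<open>simp add: funpow_swap1\<close>)
  moreover have "\<sigma> ` X \<subseteq> X" using p'_automorphismD(1)[OF \<sigma>] by auto
  ultimately show ?thesis
    using finite_subgroup[OF X] by (simp add: bij_betw_def endo_inj_surj)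
qed

lemma p'_automorphism_conj:
  assumes X: "subgroup X S" and \<sigma>: "p'_automorphism X \<sigma>" and \<tau>: "bij_betw \<tau> X Y"
    and hom: "\<And>x y. x \<in> X \<Longrightarrow> y \<in> X \<Longrightarrow> \<tau> (x \<otimes> y) = \<tau> x \<otimes> \<tau> y"
  shows "p'_automorphism Y (\<lambda>y. \<tau> (\<sigma> (inv_into X \<tau> y)))"
proof -
  let ?\<sigma> = "\<lambda>y. \<tau> (\<sigma> (inv_into X \<tau> y))"
  interpret X: subgroup X S by fact
  have Y: "\<tau> ` X = Y" and inj: "inj_on \<tau> X" using \<tau> by (auto simp: bij_betw_def)
  have s: "?\<sigma> (\<tau> x) = \<tau> (\<sigma> x)" if "x \<in> X" for x using that inj by simp
  obtain n where n: "coprime n p" "\<And>x. x \<in> X \<Longrightarrow> (\<sigma> ^^ n) x = x"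
    using \<sigma> by (auto simp: p'_automorphism_def)
  have pow: "(\<sigma> ^^ i) x \<in> X \<and> (?\<sigma> ^^ i) (\<tau> x) = \<tau> ((\<sigma> ^^ i) x)" if "x \<in> X" for i x
    by (induction i) (use that p'_automorphismD(1)[OF \<sigma>] s in auto)
  show ?thesis
    unfolding p'_automorphism_def
  proof (intro conjI)
    show "?\<sigma> ` Y \<subseteq> Y" using p'_automorphismD(1)[OF \<sigma>] s by (auto simp flip: Y)
    show "\<forall>x\<in>Y. \<forall>y\<in>Y. ?\<sigma> (x \<otimes> y) = ?\<sigma> x \<otimes> ?\<sigma> y"
    proof (intro ballI)
      fix x y assume "x \<in> Y" "y \<in> Y"
      then obtain a b where ab: "a \<in> X" "b \<in> X" "x = \<tau> a" "y = \<tau> b" using Y by blast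
      then have "?\<sigma> (\<tau> (a \<otimes> b)) = \<tau> (\<sigma> a) \<otimes> \<tau> (\<sigma> b)"
        using s[of "a \<otimes> b"] hom p'_automorphismD[OF \<sigma>] by simp
      then show "?\<sigma> (x \<otimes> y) = ?\<sigma> x \<otimes> ?\<sigma> y" using ab hom s by simp
    qed
    show "\<exists>n. coprime n p \<and> (\<forall>x\<in>Y. (?\<sigma> ^^ n) x = x)"
      using n pow by (intro exI[of _ n]) (auto simp flip: Y)
  qed
qed

text \<open>The product $B \langle y \rangle$ is again small abelian, and it is normalized by $X$ because $y$ is
central modulo $B$.\<close>

lemma small_abelian_adjoin:
  assumes B: "small_abelian B" and y: "y \<in> carrier S" "y [^] (if p = 2 then 4 else p) = \<one>"
    and comm: "\<And>b. b \<in> B \<Longrightarrow> y \<otimes> b = b \<otimes> y"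
    and X: "X \<subseteq> carrier S" and BX: "normalized_by X B"
    and yX: "\<And>g. g \<in> X \<Longrightarrow> g \<otimes> y \<otimes> inv g \<otimes> inv y \<in> B"
    and T: "subgroup T S" "B \<subseteq> T" "y \<in> T"
  shows "\<exists>B'. small_abelian B' \<and> insert y B \<subseteq> B' \<and> B' \<subseteq> T \<and> normalized_by X B'"
proof -
  let ?q = "if p = 2 then 4 else p"
  interpret B: subgroup B S using B by (simp add: small_abelian_def)
  interpret T: subgroup T S by fact
  have B': "x \<otimes> z = z \<otimes> x" "x [^] ?q = \<one>" if "x \<in> B" "z \<in> B" for x z
    using B that by (auto simp: small_abelian_def)
  define B' where "B' = {b \<otimes> y [^] i |b i. b \<in> B \<and> i \<in> (UNIV :: int set)}"
  have com: "y [^] i \<otimes> b = b \<otimes> y [^] i" if b: "b \<in> B" for b and i :: int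
  proof -
    have "b \<in> carrier S" using b by auto
    have n: "y [^] n \<otimes> b = b \<otimes> y [^] n" for n :: nat
      using group_commutes_pow[OF comm[OF b]] y \<open>b \<in> carrier S\<close> by simp
    moreover have "inv (y [^] n) \<otimes> b = b \<otimes> inv (y [^] n)" for n :: nat
    proof -
      have "inv (y [^] n) \<otimes> b = inv (y [^] n) \<otimes> (b \<otimes> y [^] n) \<otimes> inv (y [^] n)"
        using y \<open>b \<in> carrier S\<close> by (simp add: word_simps)
      also have "\<dots> = b \<otimes> inv (y [^] n)"
        using y \<open>b \<in> carrier S\<close> unfolding n[symmetric] by (simp add: word_simps)
      finally show ?thesis .
    qed
    ultimately show ?thesis
      by (cases i rule: int_cases2) (simp_all only: int_pow_int int_pow_neg_int[OF y(1)])
  qed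
  have mult: "(b \<otimes> y [^] i) \<otimes> (c \<otimes> y [^] j) = (b \<otimes> c) \<otimes> y [^] (i + j)"
    if "b \<in> B" "c \<in> B" for b c and i j :: int
  proof -
    have bc: "b \<in> carrier S" "c \<in> carrier S" using that by auto
    have "(b \<otimes> y [^] i) \<otimes> (c \<otimes> y [^] j) = b \<otimes> (y [^] i \<otimes> c) \<otimes> y [^] j"
      using bc y by (simp add: m_assoc)
    also have "\<dots> = (b \<otimes> c) \<otimes> (y [^] i \<otimes> y [^] j)"
      unfolding com[OF that(2)] using bc y by (simp add: m_assoc)
    finally show ?thesis using y by (simp add: int_pow_mult)
  qed
  have inB': "b \<otimes> y [^] i \<in> B'" if "b \<in> B" for b and i :: int using that by (auto simp: B'_def)
  have "subgroup B' S"
  proof (rule subgroupI)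
    show "B' \<subseteq> carrier S" using y by (auto simp: B'_def)
    show "B' \<noteq> {}" using inB'[OF B.one_closed] by auto
    show "inv a \<in> B'" if a: "a \<in> B'" for a
    proof -
      obtain b i where b: "b \<in> B" "a = b \<otimes> y [^] (i::int)" using a by (auto simp: B'_def)
      have "inv a = inv b \<otimes> y [^] (- i)"
        using b y com[of "inv b" "- i"] by (simp add: inv_mult_group int_pow_neg)
      then show ?thesis using inB' b by simp
    qed
    show "a \<otimes> c \<in> B'" if ac: "a \<in> B'" "c \<in> B'" for a c
    proof -
      obtain b i d j where "b \<in> B" "a = b \<otimes> y [^] (i::int)" "d \<in> B" "c = d \<otimes> y [^] (j::int)"
        using ac by (auto simp: B'_def)
      then show ?thesis using mult[of b d i j] inB'[of "b \<otimes> d" "i + j"] by simp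
    qed
  qed
  moreover have "x \<otimes> z = z \<otimes> x" if xz: "x \<in> B'" "z \<in> B'" for x z
  proof -
    obtain b i c j where "b \<in> B" "x = b \<otimes> y [^] (i::int)" "c \<in> B" "z = c \<otimes> y [^] (j::int)"
      using xz by (auto simp: B'_def)
    then show ?thesis using mult[of b c i j] mult[of c b j i] B'(1)[of b c] by (simp add: add.commute)
  qed
  moreover have "x [^] ?q = \<one>" if x: "x \<in> B'" for x
  proof -
    obtain b i where b: "b \<in> B" "x = b \<otimes> y [^] (i::int)" using x by (auto simp: B'_def)
    have "x [^] ?q = b [^] ?q \<otimes> (y [^] i) [^] ?q"
      unfolding b(2) using b y com[OF b(1), of i] by (intro pow_mult_distrib) auto
    also have "(y [^] i) [^] ?q = (y [^] ?q) [^] i"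
      using int_pow_pow[OF y(1), of i "int ?q"] int_pow_pow[OF y(1), of "int ?q" i]
      unfolding int_pow_int by (simp only: mult.commute)
    also have "\<dots> = \<one>" unfolding y(2) by simp
    finally show ?thesis using B'(2) b by simp
  qed
  ultimately have "small_abelian B'" by (auto simp: small_abelian_def)
  moreover have "insert y B \<subseteq> B'"
    using inB'[OF B.one_closed, of 1] inB'[of _ 0] y by auto
  moreover have "B' \<subseteq> T"
    using T subgroup_int_pow_closed[OF T(1), of y] by (auto simp: B'_def)
  moreover have "normalized_by X B'"
    unfolding normalized_by_def
  proof (intro ballI)
    fix g x assume g: "g \<in> X" and "x \<in> B'"
    then obtain b i where b: "b \<in> B" "x = b \<otimes> y [^] (i::int)" by (auto simp: B'_def)
    have gS: "g \<in> carrier S" using g X by auto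
    let ?c = "g \<otimes> y \<otimes> inv g \<otimes> inv y"
    have c: "?c \<in> B" using yX[OF g] .
    have "(\<lambda>u. g \<otimes> u \<otimes> inv g) \<in> hom S S"
      using gS by (auto simp: hom_def word_simps)
    then have "g \<otimes> y [^] i \<otimes> inv g = (g \<otimes> y \<otimes> inv g) [^] i"
      using hom_int_pow[of "\<lambda>u. g \<otimes> u \<otimes> inv g" S S y i] y is_group by simp
    also have "g \<otimes> y \<otimes> inv g = ?c \<otimes> y" using gS y by (simp add: word_simps)
    also have "(?c \<otimes> y) [^] i = ?c [^] i \<otimes> y [^] i"
      using comm[OF c] c y by (intro int_pow_mult_distrib) auto
    finally have gy: "g \<otimes> y [^] i \<otimes> inv g = ?c [^] i \<otimes> y [^] i" .
    have "g \<otimes> x \<otimes> inv g = (g \<otimes> b \<otimes> inv g) \<otimes> (g \<otimes> y [^] i \<otimes> inv g)"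
      using b gS y B.mem_carrier[OF b(1)] by (simp add: word_simps)
    also have "\<dots> = (g \<otimes> b \<otimes> inv g \<otimes> ?c [^] i) \<otimes> y [^] i"
      unfolding gy
      by (rule m_assoc[symmetric]) (use gS y B.mem_carrier[OF c] B.mem_carrier[OF b(1)] in simp_all)
    finally have "g \<otimes> x \<otimes> inv g = (g \<otimes> b \<otimes> inv g \<otimes> ?c [^] i) \<otimes> y [^] i" .
    moreover have "g \<otimes> b \<otimes> inv g \<otimes> ?c [^] i \<in> B"
      using normalized_byD[OF BX g b(1)] subgroup_int_pow_closed[OF B.subgroup_axioms c] by auto
    ultimately show "g \<otimes> x \<otimes> inv g \<in> B'" using inB' by simp
  qed
  ultimately show ?thesis by blast
qed

end

context finite_p_group
begin

text \<open>The family of all these automorphisms is stable under conjugation by its members and by elements of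
$X$. This is why the whole family, rather than one automorphism, is considered: the subgroups
generated by the displacements $x^{-1}\<sigma>(x)$ are then normalized by $X$.\<close>

definition relative_p'_automorphism :: "'a set \<Rightarrow> 'a set \<Rightarrow> 'a set \<Rightarrow> ('a \<Rightarrow> 'a) \<Rightarrow> bool"
  where "relative_p'_automorphism X T B \<sigma> \<longleftrightarrow> p'_automorphism X \<sigma> \<and>
    (\<forall>x\<in>X. inv x \<otimes> \<sigma> x \<in> T) \<and> (\<forall>b\<in>B. \<sigma> b = b)"

lemma relative_p'_automorphism_conj:
  assumes X: "subgroup X S" and sub: "T \<subseteq> X" "B \<subseteq> X" and \<sigma>: "relative_p'_automorphism X T B \<sigma>"
    and \<tau>: "bij_betw \<tau> X X" and hom: "\<And>x y. x \<in> X \<Longrightarrow> y \<in> X \<Longrightarrow> \<tau> (x \<otimes> y) = \<tau> x \<otimes> \<tau> y"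
    and T: "\<tau> ` T \<subseteq> T" and B: "\<tau> ` B \<subseteq> B"
  shows "\<exists>\<sigma>'. relative_p'_automorphism X T B \<sigma>' \<and> (\<forall>x\<in>X. \<tau> (\<sigma> x) = \<sigma>' (\<tau> x))"
proof (intro exI conjI)
  interpret X: subgroup X S by fact
  let ?\<sigma> = "\<lambda>y. \<tau> (\<sigma> (inv_into X \<tau> y))"
  have \<sigma>': "p'_automorphism X \<sigma>" using \<sigma> by (simp add: relative_p'_automorphism_def)
  have img: "\<tau> ` X = X" and inj: "inj_on \<tau> X" using \<tau> by (auto simp: bij_betw_def)
  show s: "\<forall>x\<in>X. \<tau> (\<sigma> x) = ?\<sigma> (\<tau> x)" using inj by simp
  have one: "\<tau> \<one> = \<one>" using hom[of \<one> \<one>] img X.mem_carrier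
    by (metis X.one_closed image_eqI one_closed r_cancel_one' X.mem_carrier)
  have tinv: "\<tau> (inv x) = inv (\<tau> x)" if "x \<in> X" for x
    using hom[of "inv x" x] that one img by (metis X.m_inv_closed X.mem_carrier image_eqI inv_equality l_inv)
  have "inv x \<otimes> ?\<sigma> x \<in> T" if x: "x \<in> X" for x
  proof -
    obtain y where y: "y \<in> X" "x = \<tau> y" using x img by blast
    then have "inv y \<otimes> \<sigma> y \<in> T" using \<sigma> by (simp add: relative_p'_automorphism_def)
    moreover have "\<tau> (inv y \<otimes> \<sigma> y) = inv x \<otimes> ?\<sigma> x"
      using y s hom[of "inv y" "\<sigma> y"] tinv p'_automorphismD(1)[OF \<sigma>'] by simp
    ultimately show ?thesis using T by auto
  qed
  moreover have "?\<sigma> b = b" if b: "b \<in> B" for b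
  proof -
    have "inj_on \<tau> B" using inj sub(2) by (rule inj_on_subset)
    then have "\<tau> ` B = B"
      using endo_inj_surj[OF _ B] finite_subset[OF sub(2) finite_subgroup[OF X]] by simp
    then obtain c where c: "c \<in> B" "b = \<tau> c" using b by blast
    then have "\<sigma> c = c" using \<sigma> by (simp add: relative_p'_automorphism_def)
    then show ?thesis using s c sub by force
  qed
  ultimately show "relative_p'_automorphism X T B ?\<sigma>"
    using p'_automorphism_conj[OF X \<sigma>' \<tau> hom] by (simp add: relative_p'_automorphism_def)
qed

text \<open>The group-theoretic heart of the theorem. Let $Y$ be the family of automorphisms of $X$ of order
prime to $p$ that act trivially on $X/T$ and on $B$, and suppose that $Y$ is nontrivial. Then $Y$
moves $C = C_T(B)$: otherwise each displacement $x^{-1}\<sigma>(x)$ would centralize $C$, hence lie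
in $C$ and be fixed. Take $D \<le> C$ minimal among the subgroups normalized by $X$, invariant under
$Y$ and not fixed pointwise. By minimality $D$ is generated by its displacements, and every proper
invariant subgroup of $D$ is fixed by $Y$ and therefore central in $D$. So $D$ has class at most two,
its commutators and $p$-th powers are central and fixed, and its power map with exponent $p$ (or 4)
is a homomorphism that kills the displacements, hence kills $D$. An element of $D$ outside $B$ that is
central modulo $B \<inter> D$ for the action of $X$ can now be adjoined to $B$, against maximality.

Applying the minimality argument to all of $Y$ replaces both Thompson's critical subgroup and
Alperin's theorem on maximal normal abelian subgroups.\<close>

lemma p'_automorphism_detected_on_small_abelian:
  assumes X: "subgroup X S" and T: "subgroup T S" "T \<subseteq> X" "normalized_by X T"
    and B: "small_abelian B" "B \<subseteq> T" "normalized_by X B"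
    and max: "\<And>B'. small_abelian B' \<Longrightarrow> B \<subseteq> B' \<Longrightarrow> B' \<subseteq> T \<Longrightarrow> normalized_by X B' \<Longrightarrow> B' = B"
    and \<sigma>0: "relative_p'_automorphism X T B \<sigma>0" and x0: "x0 \<in> X"
  shows "\<sigma>0 x0 = x0"
proof (rule ccontr)
  assume nontriv: "\<sigma>0 x0 \<noteq> x0"
  interpret X: subgroup X S by fact
  interpret T: subgroup T S by fact
  interpret B: subgroup B S using B by (simp add: small_abelian_def)
  let ?q = "if p = 2 then 4 else p"
  define Y where "Y = {\<sigma>. relative_p'_automorphism X T B \<sigma>}"
  have Y: "p'_automorphism X \<sigma>" "\<sigma> x \<in> X" "inv x \<otimes> \<sigma> x \<in> T" "y \<in> X \<Longrightarrow> \<sigma> (x \<otimes> y) = \<sigma> x \<otimes> \<sigma> y"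
    if "\<sigma> \<in> Y" "x \<in> X" for \<sigma> x y
    using that p'_automorphismD[of X \<sigma>] by (auto simp: Y_def relative_p'_automorphism_def)
  have YB: "\<sigma> b = b" if "\<sigma> \<in> Y" "b \<in> B" for \<sigma> b
    using that by (auto simp: Y_def relative_p'_automorphism_def)
  have YT: "\<sigma> t \<in> T" if "\<sigma> \<in> Y" "t \<in> T" for \<sigma> t
  proof -
    have t: "t \<in> X" "t \<in> carrier S" "\<sigma> t \<in> carrier S" using that T Y(2) by auto
    have "t \<otimes> (inv t \<otimes> \<sigma> t) \<in> T" using that Y(3)[OF that(1) t(1)] by blast
    then show ?thesis using t by (simp add: mult_inv_cancel)
  qed
  have YY: "\<exists>\<sigma>'\<in>Y. \<forall>x\<in>X. \<tau> (\<sigma> x) = \<sigma>' (\<tau> x)" if "\<sigma> \<in> Y" "\<tau> \<in> Y" for \<sigma> \<tau>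
  proof -
    have "\<tau> ` T \<subseteq> T" "\<tau> ` B \<subseteq> B" using YT[OF that(2)] by (auto simp: YB[OF that(2)])
    then show ?thesis
      using relative_p'_automorphism_conj[OF X T(2) _ _ p'_automorphism_bij[OF X Y(1)[OF that(2) X.one_closed]],
          of B \<sigma>] B(2) T(2) that Y(4)[OF that(2)] by (auto simp: Y_def)
  qed
  have bij_conj: "bij_betw (\<lambda>x. g \<otimes> x \<otimes> inv g) X X" if g: "g \<in> X" for g
    by (rule bij_betw_byWitness[where f' = "\<lambda>x. inv g \<otimes> x \<otimes> g"])
      (use g in \<open>auto simp: word_simps intro!: X.m_closed\<close>)
  have XY: "\<exists>\<sigma>'\<in>Y. \<forall>x\<in>X. g \<otimes> \<sigma> x \<otimes> inv g = \<sigma>' (g \<otimes> x \<otimes> inv g)" if "\<sigma> \<in> Y" "g \<in> X" for \<sigma> g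
  proof -
    have "(\<lambda>x. g \<otimes> x \<otimes> inv g) ` T \<subseteq> T" "(\<lambda>x. g \<otimes> x \<otimes> inv g) ` B \<subseteq> B"
      using that normalized_byD[OF T(3)] normalized_byD[OF B(3)] by auto
    moreover have "g \<otimes> (x \<otimes> y) \<otimes> inv g = (g \<otimes> x \<otimes> inv g) \<otimes> (g \<otimes> y \<otimes> inv g)"
      if "x \<in> X" "y \<in> X" for x y
      using that X.mem_carrier[OF \<open>g \<in> X\<close>] X.mem_carrier by (simp add: word_simps)
    ultimately show ?thesis
      using relative_p'_automorphism_conj[OF X T(2) _ _ bij_conj[OF that(2)], of B \<sigma>] B(2) T(2) that
      by (auto simp: Y_def)
  qed
  define fixes_pointwise where "fixes_pointwise A \<longleftrightarrow> (\<forall>\<sigma>\<in>Y. \<forall>a\<in>A. \<sigma> a = a)" for A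
  define invariant where "invariant D \<longleftrightarrow> subgroup D S \<and> D \<subseteq> X \<and> normalized_by X D \<and> (\<forall>\<sigma>\<in>Y. \<sigma> ` D \<subseteq> D)" for D
  have invariant_generate: "invariant (generate S A)"
    if A: "A \<subseteq> X" and XA: "\<And>g a. g \<in> X \<Longrightarrow> a \<in> A \<Longrightarrow> g \<otimes> a \<otimes> inv g \<in> A"
      and YA: "\<And>\<sigma> a. \<sigma> \<in> Y \<Longrightarrow> a \<in> A \<Longrightarrow> \<sigma> a \<in> A" for A
    unfolding invariant_def normalized_by_def
  proof (intro conjI ballI)
    show "subgroup (generate S A) S" using A by (intro generate_is_subgroup) auto
    show "generate S A \<subseteq> X" using generate_subgroup_incl[OF A X] .
    show "g \<otimes> a \<otimes> inv g \<in> generate S A" if g: "g \<in> X" and a: "a \<in> generate S A" for g a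
      by (rule generate_closed_under_hom[OF X A _ _ _ a, of "\<lambda>x. g \<otimes> x \<otimes> inv g"])
        (use g XA in \<open>auto simp: word_simps intro: generate.incl\<close>)
    show "\<sigma> ` generate S A \<subseteq> generate S A" if s: "\<sigma> \<in> Y" for \<sigma>
    proof (rule image_subsetI)
      fix a assume a: "a \<in> generate S A"
      show "\<sigma> a \<in> generate S A"
        by (rule generate_closed_under_hom[OF X A _ _ _ a])
          (use s YA Y in \<open>auto intro: generate.incl\<close>)
    qed
  qed
  define C where "C = {t \<in> T. \<forall>b\<in>B. t \<otimes> b = b \<otimes> t}"
  have C: "invariant C"
    unfolding invariant_def
  proof (intro conjI ballI)
    show "subgroup C S"
    proof -
      have "C = T \<inter> {g \<in> carrier S. \<forall>b\<in>B. g \<otimes> b = b \<otimes> g}" by (auto simp: C_def)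
      then show ?thesis
        using subgroups_Inter_pair[OF T(1) subgroup_commuting[OF B.subset]] by simp
    qed
    show "C \<subseteq> X" using T(2) by (auto simp: C_def)
    show "normalized_by X C"
      unfolding normalized_by_def
    proof (intro ballI)
      fix g c assume g: "g \<in> X" and c: "c \<in> C"
      have "(g \<otimes> c \<otimes> inv g) \<otimes> b = b \<otimes> (g \<otimes> c \<otimes> inv g)" if b: "b \<in> B" for b
      proof -
        have cr: "g \<in> carrier S" "c \<in> carrier S" "b \<in> carrier S" using g c b by (auto simp: C_def)
        have "inv g \<otimes> b \<otimes> inv (inv g) \<in> B" using normalized_byD[OF B(3)] g b by blast
        then have eq: "c \<otimes> (inv g \<otimes> b \<otimes> g) = (inv g \<otimes> b \<otimes> g) \<otimes> c" using c cr by (simp add: C_def)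
        have "(g \<otimes> c \<otimes> inv g) \<otimes> b = g \<otimes> (c \<otimes> (inv g \<otimes> b \<otimes> g)) \<otimes> inv g" using cr by (simp add: word_simps)
        also have "\<dots> = b \<otimes> (g \<otimes> c \<otimes> inv g)" unfolding eq using cr by (simp add: word_simps)
        finally show ?thesis .
      qed
      then show "g \<otimes> c \<otimes> inv g \<in> C" using normalized_byD[OF T(3) g] c by (auto simp: C_def)
    qed
    show "\<sigma> ` C \<subseteq> C" if s: "\<sigma> \<in> Y" for \<sigma>
    proof (rule image_subsetI)
      fix c assume c: "c \<in> C"
      have "\<sigma> c \<otimes> b = b \<otimes> \<sigma> c" if b: "b \<in> B" for b
      proof -
        have "c \<in> X" "b \<in> X" "c \<otimes> b = b \<otimes> c" using c b B(2) T(2) by (auto simp: C_def)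
        then show ?thesis using Y(4)[OF s] YB[OF s b] by metis
      qed
      then show "\<sigma> c \<in> C" using YT[OF s] c by (auto simp: C_def)
    qed
  qed
  have "\<not> fixes_pointwise C"
  proof
    assume fC: "fixes_pointwise C"
    have s0: "\<sigma>0 \<in> Y" using \<sigma>0 by (simp add: Y_def)
    \<comment> \<open>the displacement of x0 centralizes C, since C is normalized by X and fixed by Y\<close>
    let ?z = "inv x0 \<otimes> \<sigma>0 x0"
    have BC: "B \<subseteq> C" using B(1,2) by (auto simp: C_def small_abelian_def)
    have "?z \<otimes> c = c \<otimes> ?z" if c: "c \<in> C" for c
    proof -
      have cr: "c \<in> X" "c \<in> carrier S" "x0 \<in> carrier S" "\<sigma>0 x0 \<in> carrier S"
        using c x0 C Y(2)[OF s0 x0] by (auto simp: invariant_def)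
      have "x0 \<otimes> c \<otimes> inv x0 \<in> C" using C normalized_byD x0 c by (auto simp: invariant_def)
      then have "\<sigma>0 (x0 \<otimes> c \<otimes> inv x0) = x0 \<otimes> c \<otimes> inv x0" "\<sigma>0 c = c"
        using fC s0 c by (auto simp: fixes_pointwise_def)
      then have "(x0 \<otimes> c \<otimes> inv x0) \<otimes> \<sigma>0 x0 = \<sigma>0 (x0 \<otimes> c \<otimes> inv x0 \<otimes> x0)"
        using Y(4)[OF s0 _ x0, of "x0 \<otimes> c \<otimes> inv x0"] x0 cr by simp
      also have "x0 \<otimes> c \<otimes> inv x0 \<otimes> x0 = x0 \<otimes> c" using cr by (simp add: m_assoc)
      also have "\<sigma>0 (x0 \<otimes> c) = \<sigma>0 x0 \<otimes> c" using Y(4)[OF s0 x0 cr(1)] \<open>\<sigma>0 c = c\<close> by simp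
      finally have "inv x0 \<otimes> ((x0 \<otimes> c \<otimes> inv x0) \<otimes> \<sigma>0 x0) = inv x0 \<otimes> (\<sigma>0 x0 \<otimes> c)" by simp
      then show ?thesis using cr by (simp add: word_simps)
    qed
    then have "?z \<in> C" using BC Y(3)[OF s0 x0] by (auto simp: C_def)
    then have "\<sigma>0 ?z = ?z" using fC s0 by (auto simp: fixes_pointwise_def)
    then show False
      using p'_automorphism_unipotent[OF X Y(1)[OF s0 x0] x0] nontriv by simp
  qed
  then obtain D where D: "invariant D" "D \<subseteq> C" "\<not> fixes_pointwise D"
    and D_min: "\<And>E. invariant E \<Longrightarrow> E \<subseteq> C \<Longrightarrow> \<not> fixes_pointwise E \<Longrightarrow> card D \<le> card E"
    using ex_has_least_nat[of "\<lambda>D. invariant D \<and> D \<subseteq> C \<and> \<not> fixes_pointwise D" C card] C by blast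
  have DS: "subgroup D S" and DX: "D \<subseteq> X" and XD: "normalized_by X D"
    and YD: "\<And>\<sigma> d. \<sigma> \<in> Y \<Longrightarrow> d \<in> D \<Longrightarrow> \<sigma> d \<in> D"
    using D(1) by (auto simp: invariant_def)
  interpret D: subgroup D S by fact
  have small: "fixes_pointwise E" if "invariant E" "E \<subset> D" for E
    using D_min[OF that(1)] psubset_card_mono[OF finite_subgroup[OF DS] that(2)] that(2) D(2) by force
  define W where "W = {inv x \<otimes> \<sigma> x |x \<sigma>. x \<in> D \<and> \<sigma> \<in> Y}"
  have WD: "W \<subseteq> D" using YD by (auto simp: W_def)
  have invW: "invariant (generate S W)"
  proof (rule invariant_generate)
    show "W \<subseteq> X" using WD DX by auto
    show "g \<otimes> a \<otimes> inv g \<in> W" if g: "g \<in> X" and a: "a \<in> W" for g a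
    proof -
      obtain x \<sigma> where x: "x \<in> D" "\<sigma> \<in> Y" "a = inv x \<otimes> \<sigma> x" using a by (auto simp: W_def)
      obtain \<sigma>' where s: "\<sigma>' \<in> Y" "g \<otimes> \<sigma> x \<otimes> inv g = \<sigma>' (g \<otimes> x \<otimes> inv g)" using XY[OF x(2) g] x DX by blast
      have "g \<in> carrier S" "x \<in> carrier S" "\<sigma> x \<in> carrier S" using g x YD by auto
      then have "g \<otimes> a \<otimes> inv g = inv (g \<otimes> x \<otimes> inv g) \<otimes> (g \<otimes> \<sigma> x \<otimes> inv g)"
        unfolding x(3) by (simp add: word_simps)
      then show ?thesis using s normalized_byD[OF XD g x(1)] unfolding W_def by auto
    qed
    show "\<tau> a \<in> W" if t: "\<tau> \<in> Y" and a: "a \<in> W" for \<tau> a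
    proof -
      obtain x \<sigma> where x: "x \<in> D" "\<sigma> \<in> Y" "a = inv x \<otimes> \<sigma> x" using a by (auto simp: W_def)
      have xX: "x \<in> X" "\<sigma> x \<in> X" "inv x \<in> X" using x DX YD by auto
      obtain \<sigma>' where s: "\<sigma>' \<in> Y" "\<tau> (\<sigma> x) = \<sigma>' (\<tau> x)" using YY[OF x(2) t] xX by blast
      have "\<tau> (inv x) \<otimes> \<tau> x = \<tau> \<one>" using Y(4)[OF t xX(3) xX(1)] xX by simp
      moreover have "\<tau> \<one> = \<one>" using YB[OF t B.one_closed] .
      ultimately have "\<tau> (inv x) = inv (\<tau> x)"
        using inv_equality Y(2)[OF t] xX by (metis X.mem_carrier)
      then have "\<tau> a = inv (\<tau> x) \<otimes> \<sigma>' (\<tau> x)" using Y(4)[OF t xX(3) xX(2)] s x(3) by simp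
      then show ?thesis using s(1) YD[OF t x(1)] unfolding W_def by blast
    qed
  qed
  have genW: "generate S W = D"
  proof (rule ccontr)
    assume neq: "generate S W \<noteq> D"
    have "generate S W \<subseteq> D" using generate_subgroup_incl[OF WD DS] .
    then have f: "fixes_pointwise (generate S W)" using small[OF invW] neq by blast
    have "\<sigma> x = x" if "\<sigma> \<in> Y" "x \<in> D" for \<sigma> x
    proof -
      have "inv x \<otimes> \<sigma> x \<in> generate S W" using that by (auto simp: W_def intro: generate.incl)
      then show ?thesis
        using p'_automorphism_unipotent[OF X Y(1)[OF that(1)]] that DX f
        by (auto simp: fixes_pointwise_def)
    qed
    then show False using D(3) by (auto simp: fixes_pointwise_def)
  qed
  have "D \<noteq> {\<one>}" using D(3) YB[OF _ B.one_closed] by (auto simp: fixes_pointwise_def)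
  then obtain M where M: "subgroup M S" "M \<subset> D" "\<And>x. x \<in> D \<Longrightarrow> x [^] p \<in> M"
      "\<And>x y. x \<in> D \<Longrightarrow> y \<in> D \<Longrightarrow> x \<otimes> y \<otimes> inv x \<otimes> inv y \<in> M"
    using exists_proper_frattini_container[OF DS] by blast
  define N0 where "N0 = {x [^] p |x. x \<in> D} \<union> {x \<otimes> y \<otimes> inv x \<otimes> inv y |x y. x \<in> D \<and> y \<in> D}"
  have N0M: "N0 \<subseteq> M" using M by (auto simp: N0_def)
  have ND: "generate S N0 \<subset> D" using generate_subgroup_incl[OF N0M M(1)] M(2) by auto
  have invN: "invariant (generate S N0)"
  proof (rule invariant_generate)
    show "N0 \<subseteq> X" using N0M M(2) DX by auto
    have map_N0: "\<tau> a \<in> N0" if a: "a \<in> N0" and hom: "\<And>x y. x \<in> D \<Longrightarrow> y \<in> D \<Longrightarrow> \<tau> (x \<otimes> y) = \<tau> x \<otimes> \<tau> y"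
      and D: "\<And>x. x \<in> D \<Longrightarrow> \<tau> x \<in> D" for \<tau> a
    proof -
      have th: "\<tau> \<in> hom (S\<lparr>carrier := D\<rparr>) S" using hom D by (auto simp: hom_def)
      interpret t: group_hom "S\<lparr>carrier := D\<rparr>" S \<tau>
        by (simp add: group_hom_def group_hom_axioms_def subgroup_group[OF DS] th)
      from a consider x where "x \<in> D" "a = x [^] p"
        | x y where "x \<in> D" "y \<in> D" "a = x \<otimes> y \<otimes> inv x \<otimes> inv y" by (auto simp: N0_def)
      then show ?thesis
      proof cases
        case 1
        have "\<tau> a = \<tau> x [^] p" using t.hom_nat_pow[of x p] 1 by (simp flip: nat_pow_consistent)
        then show ?thesis using D 1 by (auto simp: N0_def)
      next
        case 2
        have "\<tau> (inv z) = inv (\<tau> z)" if "z \<in> D" for z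
          using t.hom_inv[of z] that by (simp add: m_inv_consistent[OF DS])
        then have "\<tau> a = \<tau> x \<otimes> \<tau> y \<otimes> inv (\<tau> x) \<otimes> inv (\<tau> y)" using 2 hom by simp
        then show ?thesis using D[OF 2(1)] D[OF 2(2)] unfolding N0_def by blast
      qed
    qed
    show "g \<otimes> a \<otimes> inv g \<in> N0" if g: "g \<in> X" and a: "a \<in> N0" for g a
      by (rule map_N0[OF a]) (use g normalized_byD[OF XD g] in \<open>auto simp: word_simps\<close>)
    show "\<sigma> a \<in> N0" if s: "\<sigma> \<in> Y" and a: "a \<in> N0" for \<sigma> a
      by (rule map_N0[OF a]) (use Y(4)[OF s] YD[OF s] DX in auto)
  qed
  have YN: "\<sigma> n = n" if "\<sigma> \<in> Y" "n \<in> generate S N0" for \<sigma> n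
    using small[OF invN ND] that by (auto simp: fixes_pointwise_def)
  have central: "d \<otimes> n = n \<otimes> d" if d: "d \<in> D" and n: "n \<in> generate S N0" for d n
  proof -
    have nD: "n \<in> D" "n \<in> carrier S" using n ND by auto
    \<comment> \<open>both n and its conjugate by x are fixed, so x and its image conjugate n to the same element\<close>
    have "W \<subseteq> {g \<in> carrier S. \<forall>a\<in>{n}. g \<otimes> a = a \<otimes> g}"
    proof
      fix w assume "w \<in> W"
      then obtain x \<sigma> where x: "x \<in> D" "\<sigma> \<in> Y" "w = inv x \<otimes> \<sigma> x" by (auto simp: W_def)
      have cr: "x \<in> carrier S" "\<sigma> x \<in> carrier S" "x \<in> X" "n \<in> X" using x YD DX nD by auto
      have "x \<otimes> n \<otimes> inv x \<in> generate S N0"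
        using invN normalized_byD[OF _ cr(3) n] by (auto simp: invariant_def)
      then have "\<sigma> (x \<otimes> n \<otimes> inv x) = x \<otimes> n \<otimes> inv x" "\<sigma> n = n" using YN x n by auto
      then have "(x \<otimes> n \<otimes> inv x) \<otimes> \<sigma> x = \<sigma> (x \<otimes> n \<otimes> inv x \<otimes> x)"
        using Y(4)[OF x(2) _ cr(3), of "x \<otimes> n \<otimes> inv x"] cr by simp
      also have "x \<otimes> n \<otimes> inv x \<otimes> x = x \<otimes> n" using cr nD by (simp add: m_assoc)
      also have "\<sigma> (x \<otimes> n) = \<sigma> x \<otimes> n" using Y(4)[OF x(2) cr(3,4)] \<open>\<sigma> n = n\<close> by simp
      finally have "inv x \<otimes> ((x \<otimes> n \<otimes> inv x) \<otimes> \<sigma> x) = inv x \<otimes> (\<sigma> x \<otimes> n)" by simp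
      then show "w \<in> {g \<in> carrier S. \<forall>a\<in>{n}. g \<otimes> a = a \<otimes> g}"
        using cr nD x(3) by (simp add: word_simps)
    qed
    then have "generate S W \<subseteq> {g \<in> carrier S. \<forall>a\<in>{n}. g \<otimes> a = a \<otimes> g}"
      using generate_subgroup_incl subgroup_commuting[of "{n}"] nD by simp
    then show ?thesis using genW d by auto
  qed
  have powN: "x [^] p \<in> generate S N0" if "x \<in> D" for x
    using that by (auto simp: N0_def intro: generate.incl)
  have qp: "x [^] ?q \<in> generate S N0" if x: "x \<in> D" for x
  proof -
    have gN: "subgroup (generate S N0) S" using invN by (simp add: invariant_def)
    have k: "(x [^] p) [^] k \<in> generate S N0" for k :: nat
      by (induction k) (use subgroup.one_closed[OF gN] subgroup.m_closed[OF gN _ powN[OF x]] in simp_all)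
    have "p * (?q div p) = ?q" by (cases "p = 2") (use prime_gt_0_nat[OF prime_p] in auto)
    then have "x [^] ?q = (x [^] p) [^] (?q div p)" using nat_pow_pow[of x p "?q div p"] x by simp
    then show ?thesis using k by simp
  qed
  have pow_mult: "(a \<otimes> b) [^] ?q = a [^] ?q \<otimes> b [^] ?q" if a: "a \<in> D" and b: "b \<in> D" for a b
  proof -
    have ab: "a \<in> carrier S" "b \<in> carrier S" using a b by auto
    define c where "c = inv b \<otimes> inv a \<otimes> b \<otimes> a"
    have cN: "c \<in> generate S N0"
    proof -
      have "c = inv b \<otimes> inv a \<otimes> inv (inv b) \<otimes> inv (inv a)" using ab by (simp add: c_def)
      then have "c \<in> N0" using a b unfolding N0_def by blast
      then show ?thesis by (rule generate.incl)
    qed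
    have c: "c \<in> carrier S" using ab by (simp add: c_def)
    have ba: "b \<otimes> a = a \<otimes> b \<otimes> c" using ab by (simp add: c_def word_simps)
    have "c [^] p = \<one>"
    proof -
      \<comment> \<open>conjugation by b fixes the central element a [^] p, but multiplies a by the inverse of c\<close>
      have conj: "inv b \<otimes> a \<otimes> b = a \<otimes> inv c"
        using ab by (simp add: c_def word_simps)
      have "(inv b \<otimes> a \<otimes> b) [^] n = inv b \<otimes> a [^] n \<otimes> b" for n :: nat
        by (induction n) (use ab in \<open>simp_all add: word_simps\<close>)
      then have "(a \<otimes> inv c) [^] p = inv b \<otimes> a [^] p \<otimes> b" unfolding conj .
      also have "\<dots> = inv b \<otimes> (b \<otimes> a [^] p)" using central[OF b powN[OF a]] ab by (simp add: m_assoc)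
      also have "\<dots> = a [^] p" using ab by (simp add: mult_inv_cancel)
      finally have "(a \<otimes> inv c) [^] p = a [^] p" .
      moreover have "(a \<otimes> inv c) [^] p = a [^] p \<otimes> inv c [^] p"
      proof (rule pow_mult_distrib)
        have "inv c \<in> generate S N0" using cN invN subgroup.m_inv_closed by (auto simp: invariant_def)
        then show "a \<otimes> inv c = inv c \<otimes> a" using central[OF a] by simp
      qed (use ab c in simp_all)
      ultimately have "a [^] p \<otimes> inv c [^] p = a [^] p" by simp
      then have "inv c [^] p = \<one>" using ab c by simp
      then show ?thesis using c by (simp add: nat_pow_inv)
    qed
    moreover have "p dvd (?q choose 2)"
    proof (cases "p = 2")
      case True
      then show ?thesis by (simp add: choose_two)
    next
      case False
      then obtain m where "p = 2 * m + 1"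
        using prime_odd_nat[OF prime_p] prime_ge_2_nat[OF prime_p] by (metis le_neq_implies_less oddE)
      then have "p choose 2 = p * m" by (simp add: choose_two)
      then show ?thesis using False by simp
    qed
    ultimately have "c [^] (?q choose 2) = \<one>"
      using pow_eq_id[OF c] dvd_trans by blast
    then show ?thesis
      using pow_mult_class_two[OF ab c ba, of ?q] central[OF a cN] central[OF b cN] ab by simp
  qed
  have exp: "x [^] ?q = \<one>" if "x \<in> D" for x
  proof -
    let ?E = "{x \<in> D. x [^] ?q = \<one>}"
    have "subgroup ?E S"
    proof (rule subgroupI)
      have "\<one> \<in> ?E" using D.one_closed by simp
      then show "?E \<noteq> {}" by blast
      show "inv a \<in> ?E" if "a \<in> ?E" for a
      proof -
        have "a \<in> D" "a [^] ?q = \<one>" using that by blast+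
        then show ?thesis using nat_pow_inv[of a ?q] by simp
      qed
      show "a \<otimes> b \<in> ?E" if "a \<in> ?E" "b \<in> ?E" for a b
      proof -
        have "a \<in> D" "a [^] ?q = \<one>" "b \<in> D" "b [^] ?q = \<one>" using that by blast+
        then show ?thesis using pow_mult[of a b] by simp
      qed
      show "?E \<subseteq> carrier S" using D.subset by blast
    qed
    moreover have "W \<subseteq> ?E"
    proof
      fix w assume "w \<in> W"
      then obtain x \<sigma> where x: "x \<in> D" "\<sigma> \<in> Y" "w = inv x \<otimes> \<sigma> x" by (auto simp: W_def)
      have "\<sigma> x [^] ?q = x [^] ?q"
      proof -
        have "\<sigma> (x [^] n) = \<sigma> x [^] n" for n :: nat
        proof (induction n)
          case 0
          then show ?case using YB[OF x(2) B.one_closed] by simp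
        next
          case (Suc n)
          have "x [^] n \<in> D" using x(1) by (induction n) auto
          then show ?case using Suc Y(4)[OF x(2), of "x [^] n" x] x DX by auto
        qed
        then show ?thesis using YN[OF x(2) qp[OF x(1)]] by simp
      qed
      then have "w [^] ?q = \<one>"
        using pow_mult[of "inv x" "\<sigma> x"] x YD nat_pow_inv[of x ?q] by simp
      then show "w \<in> ?E" using x WD \<open>w \<in> W\<close> by auto
    qed
    ultimately have "generate S W \<subseteq> ?E" using generate_subgroup_incl by blast
    then show ?thesis using genW that by auto
  qed
  have "\<not> D \<subseteq> B" using D(3) YB by (auto simp: fixes_pointwise_def)
  then have "B \<inter> D \<subset> D" by auto
  then have "\<exists>y\<in>D - B \<inter> D. \<forall>g\<in>X. g \<otimes> y \<otimes> inv g \<otimes> inv y \<in> B \<inter> D"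
  proof (rule fixed_point_in_normal_section[OF X subgroups_Inter_pair[OF B.subgroup_axioms DS] DS])
    show "g \<otimes> d \<otimes> inv g \<in> D" if "g \<in> X" "d \<in> D" for g d
      using normalized_byD[OF XD that] .
    show "g \<otimes> b \<otimes> inv g \<in> B \<inter> D" if "g \<in> X" "b \<in> B \<inter> D" for g b
      using normalized_byD[OF XD] normalized_byD[OF B(3)] that by simp
  qed
  then obtain y where y: "y \<in> D - B \<inter> D" "\<forall>g\<in>X. g \<otimes> y \<otimes> inv g \<otimes> inv y \<in> B \<inter> D" ..
  have "\<exists>B'. small_abelian B' \<and> insert y B \<subseteq> B' \<and> B' \<subseteq> T \<and> normalized_by X B'"
  proof (rule small_abelian_adjoin[OF B(1) _ _ _ X.subset B(3) _ T(1) B(2)])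
    show "y [^] ?q = \<one>" using exp y by auto
    show "y \<otimes> b = b \<otimes> y" if "b \<in> B" for b using that y D(2) by (auto simp: C_def)
    show "y \<in> T" using y D(2) by (auto simp: C_def)
  qed (use y in auto)
  then show False using max y(1) by blast
qed

end

section \<open>Sylow subgroups and $O^p$\<close>

context group
begin

lemma exists_sylow_subgroup:
  assumes Z: "subgroup Z G" and fin: "finite (carrier G)" and q: "prime q"
  shows "\<exists>W. sylow_subgroup q (G\<lparr>carrier := Z\<rparr>) W"
proof -
  have "q ^ multiplicity q (card Z) dvd card Z" by (rule multiplicity_dvd)
  then obtain m where "card Z = q ^ multiplicity q (card Z) * m" ..
  then show ?thesis
    using sylow_thm[OF q subgroup.subgroup_is_group[OF Z is_group]] finite_subset[OF subgroup.subset[OF Z] fin]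
    by (auto simp: sylow_subgroup_def order_def)
qed

lemma sylow_subgroupD:
  assumes Z: "subgroup Z G" and W: "sylow_subgroup q (G\<lparr>carrier := Z\<rparr>) W"
  shows "subgroup W G" "W \<subseteq> Z" "card W = q ^ multiplicity q (card Z)"
  using W incl_subgroup[OF Z] subgroup.subset by (fastforce simp: sylow_subgroup_def order_def)+

lemma p_group_conjugate_into_sylow:
  assumes fin: "finite (carrier G)" and p: "prime p" and V: "group V" and ord: "order V = p ^ k"
    and f: "f \<in> hom V G" "f ` carrier V \<subseteq> Z"
    and Z: "subgroup Z G" and W: "sylow_subgroup p (G\<lparr>carrier := Z\<rparr>) W"
  shows "\<exists>z\<in>Z. \<forall>v\<in>carrier V. z \<otimes> f v \<otimes> inv z \<in> W"
proof -
  note WZ = sylow_subgroupD[OF Z W]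
  let ?n = "card ((\<lambda>z. W #> z) ` Z)"
  have n: "?n * card W = card Z" using card_cosets_in_subgroup[OF WZ(1) Z WZ(2)] .
  have "card Z \<noteq> 0"
    using subgroup.one_closed[OF Z] finite_subset[OF subgroup.subset[OF Z] fin] by auto
  have "\<not> p dvd ?n"
  proof
    assume "p dvd ?n"
    then obtain m where "?n = p * m" ..
    then have "p ^ Suc (multiplicity p (card Z)) dvd card Z"
      using n WZ(3) by (metis dvd_triv_left mult.assoc mult.commute power_Suc)
    moreover have "\<not> is_unit p" using p not_prime_unit by blast
    ultimately show False using power_dvd_iff_le_multiplicity[of "card Z" p] \<open>card Z \<noteq> 0\<close> by (simp del: power_Suc)
  qed
  then have "{z \<in> Z. \<forall>v\<in>carrier V. z \<otimes> f v \<otimes> inv z \<in> W} \<noteq> {}"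
    using p_group_fixes_cosets[OF V ord p fin f WZ(1) Z WZ(2)]
    by (metis (no_types, lifting) card.empty dvd_0_right image_empty)
  then show ?thesis by blast
qed

text \<open>A Sylow subgroup of $Z$ is a $p$-group and so has a conjugate inside $U$; that conjugate is a Sylow
subgroup of the correspondingly conjugated $Z$.\<close>

lemma exists_conjugate_with_sylow_in:
  assumes fin: "finite (carrier G)" and p: "prime p"
    and U: "sylow_subgroup p G U" and Z: "subgroup Z G"
  shows "\<exists>\<kappa>\<in>carrier G. \<exists>W. subgroup ((\<lambda>z. \<kappa> \<otimes> z \<otimes> inv \<kappa>) ` Z) G \<and>
    sylow_subgroup p (G\<lparr>carrier := (\<lambda>z. \<kappa> \<otimes> z \<otimes> inv \<kappa>) ` Z\<rparr>) W \<and> W \<subseteq> U"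
proof -
  obtain W0 where W0: "sylow_subgroup p (G\<lparr>carrier := Z\<rparr>) W0"
    using exists_sylow_subgroup[OF Z fin p] by auto
  note W0' = sylow_subgroupD[OF Z W0]
  have "\<exists>\<kappa>\<in>carrier G. \<forall>v\<in>carrier (G\<lparr>carrier := W0\<rparr>). \<kappa> \<otimes> v \<otimes> inv \<kappa> \<in> U"
    by (rule p_group_conjugate_into_sylow[OF fin p subgroup.subgroup_is_group[OF W0'(1) is_group], of "multiplicity p (card Z)" "\<lambda>x. x"])
      (use W0' subgroup.subset[OF W0'(1)] U subgroup_self in \<open>auto simp: order_def hom_def\<close>)
  then obtain \<kappa> where \<kappa>: "\<kappa> \<in> carrier G" "\<And>v. v \<in> W0 \<Longrightarrow> \<kappa> \<otimes> v \<otimes> inv \<kappa> \<in> U" by auto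
  let ?c = "\<lambda>z. \<kappa> \<otimes> z \<otimes> inv \<kappa>"
  interpret c: group_hom G G ?c
    by unfold_locales (use \<kappa> in \<open>auto simp: hom_def word_simps\<close>)
  have inj: "inj_on ?c (carrier G)" using \<kappa> by (auto simp: inj_on_def)
  have sub: "subgroup (?c ` Z) G" "subgroup (?c ` W0) G"
    using c.subgroup_img_is_subgroup Z W0'(1) by auto
  have "card (?c ` W0) = card W0" "card (?c ` Z) = card Z"
    using card_image inj_on_subset[OF inj] subgroup.subset[OF W0'(1)] subgroup.subset[OF Z] by blast+
  moreover have "subgroup (?c ` W0) (G\<lparr>carrier := ?c ` Z\<rparr>)"
    using subgroup_incl[OF sub(2,1)] W0'(2) by auto
  ultimately have "sylow_subgroup p (G\<lparr>carrier := ?c ` Z\<rparr>) (?c ` W0)"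
    using W0'(3) by (simp add: sylow_subgroup_def order_def)
  then show ?thesis using \<kappa> sub(1) by blast
qed

text \<open>For a prime $r \<noteq> p$, the elements of a Sylow $r$-subgroup have order prime to $p$.\<close>

lemma prime_power_in_subgroup_with_p'_elements:
  assumes fin: "finite (carrier G)" and Z: "subgroup Z G" and H: "subgroup H G"
    and p': "\<And>x n. x \<in> Z \<Longrightarrow> coprime n p \<Longrightarrow> x [^] (n::nat) = \<one> \<Longrightarrow> x \<in> H"
    and p: "prime p" and r: "prime r" "r \<noteq> p"
  shows "multiplicity r (card Z) \<le> multiplicity r (card H)"
proof -
  obtain R where R: "sylow_subgroup r (G\<lparr>carrier := Z\<rparr>) R"
    using exists_sylow_subgroup[OF Z fin r(1)] by auto
  note R' = sylow_subgroupD[OF Z R]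
  have "x \<in> H" if x: "x \<in> R" for x
  proof (rule p')
    show "x \<in> Z" using x R' by auto
    show "coprime (r ^ multiplicity r (card Z)) p" using p r primes_coprime by auto
    have "x [^]\<^bsub>G\<lparr>carrier := R\<rparr>\<^esub> order (G\<lparr>carrier := R\<rparr>) = \<one>\<^bsub>G\<lparr>carrier := R\<rparr>\<^esub>"
      by (rule group.pow_order_eq_1[OF subgroup.subgroup_is_group[OF R'(1) is_group]]) (use x in simp)
    then show "x [^] (r ^ multiplicity r (card Z)) = \<one>"
      using R'(3) by (simp add: order_def flip: nat_pow_consistent)
  qed
  then have "card R dvd card H"
    using card_cosets_in_subgroup[OF R'(1) H] by (metis dvd_triv_right subsetI)
  moreover have "card H \<noteq> 0"
    using subgroup.one_closed[OF H] finite_subset[OF subgroup.subset[OF H] fin] by auto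
  ultimately show ?thesis
    using R'(3) power_dvd_iff_le_multiplicity[of "card H" r] r(1) not_prime_unit by auto
qed

text \<open>A finite group is generated by one Sylow $p$-subgroup and the elements of order prime to $p$: the
order of the generated subgroup is divisible by the full power of every prime. In the fusion system,
the Sylow part consists of conjugations, so only automorphisms of order prime to $p$ remain to be
examined.\<close>

lemma sylow_and_p'_elements_exhaust:
  assumes fin: "finite (carrier G)" and p: "prime p" and Z: "subgroup Z G" and H: "subgroup H G"
    and W: "sylow_subgroup p (G\<lparr>carrier := Z\<rparr>) W" "W \<subseteq> H"
    and p': "\<And>x n. x \<in> Z \<Longrightarrow> coprime n p \<Longrightarrow> x [^] (n::nat) = \<one> \<Longrightarrow> x \<in> H"
  shows "Z \<subseteq> H"
proof -
  note W' = sylow_subgroupD[OF Z W(1)]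
  have HZ: "subgroup (H \<inter> Z) G" using subgroups_Inter_pair[OF H Z] .
  have fZ: "finite Z" using finite_subset[OF subgroup.subset[OF Z] fin] .
  have c: "card (H \<inter> Z) \<noteq> 0" "card Z \<noteq> 0"
    using subgroup.one_closed[OF H] subgroup.one_closed[OF Z] fZ by auto
  have "card Z dvd card (H \<inter> Z)"
  proof (rule multiplicity_le_imp_dvd)
    fix r :: nat assume r: "prime r"
    show "multiplicity r (card Z) \<le> multiplicity r (card (H \<inter> Z))"
    proof (cases "r = p")
      case True
      have "W \<subseteq> H \<inter> Z" using W(2) W'(2) by auto
      then have "card W dvd card (H \<inter> Z)"
        using card_cosets_in_subgroup[OF W'(1) HZ] by (metis dvd_triv_right)
      then show ?thesis
        using W'(3) power_dvd_iff_le_multiplicity[of "card (H \<inter> Z)" p] c p not_prime_unit True by auto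
    next
      case False
      show ?thesis
        by (rule prime_power_in_subgroup_with_p'_elements[OF fin Z HZ _ p r False]) (use p' in auto)
    qed
  qed (use c in simp)
  then have "card Z \<le> card (H \<inter> Z)" using c by (intro dvd_imp_le) auto
  then have "H \<inter> Z = Z" using fZ by (intro card_seteq) auto
  then show ?thesis by auto
qed

text \<open>The elements of order prime to $p$ lie in every normal subgroup of $p$-power index, and the subgroup
that they generate is itself such a subgroup, by comparison with a Sylow $p$-subgroup.\<close>

lemma p_residual_generated_by_p'_elements:
  assumes fin: "finite (carrier G)" and p: "prime p"
  shows "p_residual p G = generate G {x \<in> carrier G. \<exists>n::nat. coprime n p \<and> x [^] n = \<one>}"
proof -
  define A where "A = {x \<in> carrier G. \<exists>n::nat. coprime n p \<and> x [^] n = \<one>}"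
  have A: "A \<subseteq> carrier G" by (auto simp: A_def)
  have sub: "subgroup (generate G A) G" using generate_is_subgroup[OF A] .
  interpret gen: subgroup "generate G A" G by fact
  have norm: "generate G A \<lhd> G"
    unfolding normal_inv_iff
  proof (intro conjI ballI sub)
    fix g a assume g: "g \<in> carrier G" and a: "a \<in> generate G A"
    show "g \<otimes> a \<otimes> inv g \<in> generate G A"
    proof (rule generate_closed_under_hom[OF subgroup_self A _ _ _ a, of "\<lambda>x. g \<otimes> x \<otimes> inv g"])
      fix x assume "x \<in> A"
      then obtain n where x: "x \<in> carrier G" and n: "coprime (n::nat) p" "x [^] n = \<one>" by (auto simp: A_def)
      have "(g \<otimes> x \<otimes> inv g) [^] i = g \<otimes> x [^] i \<otimes> inv g" for i :: nat
        by (induction i) (use g x in \<open>simp_all add: word_simps\<close>)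
      then have "g \<otimes> x \<otimes> inv g \<in> A" using n g x by (auto simp: A_def)
      then show "g \<otimes> x \<otimes> inv g \<in> generate G A" by (rule generate.incl)
    qed (use g in \<open>auto simp: word_simps\<close>)
  qed
  obtain W where W: "sylow_subgroup p (G\<lparr>carrier := carrier G\<rparr>) W"
    using exists_sylow_subgroup[OF subgroup_self fin p] by auto
  note W' = sylow_subgroupD[OF subgroup_self W]
  have "generate G A \<noteq> {}" using gen.one_closed by blast
  then have pos: "card (generate G A) \<noteq> 0" "order G \<noteq> 0" "card W \<noteq> 0"
    using finite_subset[OF gen.subset fin] fin W'(3) p prime_gt_0_nat
      by (auto simp: order_def)
  have "order G dvd card (generate G A) * card W"
  proof (rule multiplicity_le_imp_dvd)
    fix r :: nat assume r: "prime r"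
    have eq: "multiplicity r (card (generate G A) * card W) =
        multiplicity r (card (generate G A)) + multiplicity r (card W)"
      using pos r by (intro prime_elem_multiplicity_mult_distrib) auto
    show "multiplicity r (order G) \<le> multiplicity r (card (generate G A) * card W)"
    proof (cases "r = p")
      case True
      then show ?thesis using W'(3) p unfolding eq by (simp add: order_def)
    next
      case False
      have "multiplicity r (card (carrier G)) \<le> multiplicity r (card (generate G A))"
        by (rule prime_power_in_subgroup_with_p'_elements[OF fin subgroup_self sub _ p r False])
          (auto simp: A_def intro: generate.incl)
      then show ?thesis unfolding eq by (simp add: order_def)
    qed
  qed (use pos in simp)
  then have "card (rcosets generate G A) * card (generate G A) dvd card W * card (generate G A)"
    using lagrange[OF sub] by (simp add: mult.commute)
  then have "card (rcosets generate G A) dvd p ^ multiplicity p (card (carrier G))"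
    using pos(1) unfolding W'(3)[symmetric] by simp
  then have ind: "\<exists>n. card (rcosets generate G A) = p ^ n"
    using divides_primepow_nat[OF p] by blast
  have "p_residual p G = generate G A"
    unfolding p_residual_def
  proof (rule Least_equality)
    show "generate G A \<lhd> G \<and> (\<exists>n. card (rcosets generate G A) = p ^ n)" using norm ind by simp
    fix N assume N: "N \<lhd> G \<and> (\<exists>n. card (rcosets N) = p ^ n)"
    then interpret N: normal N G by simp
    interpret Q: group "G Mod N" by (rule N.factorgroup_is_group)
    obtain k where k: "order (G Mod N) = p ^ k" using N by (auto simp: FactGroup_def order_def)
    have "A \<subseteq> N"
    proof
      fix x assume "x \<in> A"
      then obtain n where x: "x \<in> carrier G" and n: "coprime (n::nat) p" "x [^] n = \<one>" by (auto simp: A_def)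
      have xQ: "N #> x \<in> carrier (G Mod N)" using x by (auto simp: FactGroup_def RCOSETS_def)
      have "(N #> x) [^]\<^bsub>G Mod N\<^esub> n = \<one>\<^bsub>G Mod N\<^esub>"
        using N.FactGroup_pow[OF x, of n] n N.subset by (simp add: FactGroup_def)
      then have "Q.ord (N #> x) dvd n" using Q.pow_eq_id[OF xQ] by simp
      moreover have "Q.ord (N #> x) dvd p ^ k" using Q.ord_dvd_group_order[OF xQ] k by simp
      ultimately have "Q.ord (N #> x) dvd 1"
        using coprime_common_divisor[of n "p ^ k" "Q.ord (N #> x)"] n(1) by simp
      then have "(N #> x) [^]\<^bsub>G Mod N\<^esub> (1::nat) = \<one>\<^bsub>G Mod N\<^esub>" using Q.pow_eq_id[OF xQ] by blast
      then have "N #> x = \<one>\<^bsub>G Mod N\<^esub>" using Q.nat_pow_eone[OF xQ] by metis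
      then have "N #> x = N" by (simp add: FactGroup_def)
      then show "x \<in> N" using coset_join1[OF _ x N.subgroup_axioms] N.subset by auto
    qed
    then show "generate G A \<subseteq> N" using generate_subgroup_incl[OF _ N.subgroup_axioms] by auto
  qed
  then show ?thesis by (simp add: A_def)
qed

end

section \<open>Morphisms and extension axioms of a fusion system\<close>

context fusion_system
begin

text \<open>A morphism is identified with its restriction to the source, regarded as a map into all of $S$. This
allows arbitrary functions in place of extensional ones and makes codomains disappear: restriction,
composition and inversion on the image are total operations.\<close>

definition mor :: "'a set \<Rightarrow> ('a \<Rightarrow> 'a) \<Rightarrow> bool"
  where "mor P \<phi> \<longleftrightarrow> subgroup P S \<and> restrict \<phi> P \<in> F P (carrier S)"

lemma mor_cong: "(\<And>x. x \<in> P \<Longrightarrow> \<phi> x = \<psi> x) \<Longrightarrow> mor P \<phi> \<longleftrightarrow> mor P \<psi>"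
  unfolding mor_def by (metis restrict_ext)

lemma inclusion_morphism:
  assumes "subgroup P S" "subgroup Q S" "P \<subseteq> Q"
  shows "(\<lambda>x\<in>P. x) \<in> F P Q"
proof -
  have "conj_map S \<one> P = (\<lambda>x\<in>P. x)"
    using subgroup.mem_carrier[OF assms(1)] by (auto simp: conj_map_def fun_eq_iff)
  then have "(\<lambda>x\<in>P. x) \<in> Hom_conj S P Q"
    using assms(3) unfolding Hom_conj_def by (auto intro!: exI[of _ \<one>])
  then show ?thesis using conj_morphisms assms by blast
qed

lemma mor_subgroup: "mor P \<phi> \<Longrightarrow> subgroup P S"
  by (simp add: mor_def)

lemma mor_injective_hom:
  assumes "mor P \<phi>"
  shows "inj_on \<phi> P" "x \<in> P \<Longrightarrow> \<phi> x \<in> carrier S" "x \<in> P \<Longrightarrow> y \<in> P \<Longrightarrow> \<phi> (x \<otimes> y) = \<phi> x \<otimes> \<phi> y"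
    "x \<in> P \<Longrightarrow> \<phi> (inv x) = inv (\<phi> x)" "\<phi> \<one> = \<one>"
proof -
  interpret P: subgroup P S using assms by (simp add: mor_def)
  have h: "restrict \<phi> P \<in> hom (S\<lparr>carrier := P\<rparr>) S" and i: "inj_on (restrict \<phi> P) P"
    using injective_hom[OF P.subgroup_axioms subgroup_self, of "restrict \<phi> P"] assms
    unfolding mor_def by simp_all
  show "inj_on \<phi> P" using i by (simp add: inj_on_restrict_eq)
  show c: "x \<in> P \<Longrightarrow> \<phi> x \<in> carrier S" for x using hom_in_carrier[OF h, of x] by simp
  show m: "x \<in> P \<Longrightarrow> y \<in> P \<Longrightarrow> \<phi> (x \<otimes> y) = \<phi> x \<otimes> \<phi> y" for x y using h by (auto simp: hom_def)
  show o: "\<phi> \<one> = \<one>" using m[of \<one> \<one>] c[of \<one>] by simp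
  show "x \<in> P \<Longrightarrow> \<phi> (inv x) = inv (\<phi> x)"
    using m[of "inv x" x] c o inv_equality[of "\<phi> (inv x)" "\<phi> x"] by simp
qed

lemma mor_conjugate:
  assumes "mor P \<phi>" "x \<in> P" "y \<in> P"
  shows "\<phi> (x \<otimes> y \<otimes> inv x) = \<phi> x \<otimes> \<phi> y \<otimes> inv (\<phi> x)"
proof -
  interpret P: subgroup P S using assms(1) by (simp add: mor_def)
  show ?thesis using mor_injective_hom[OF assms(1)] assms(2,3) by simp
qed

lemma fusion_iso_image:
  assumes "subgroup P S" "subgroup Q S" "\<phi> \<in> fusion_iso F P Q"
  shows "\<phi> ` P = Q"
proof -
  obtain \<psi> where \<psi>: "\<phi> \<in> F P Q" "\<psi> \<in> F Q P" "compose Q \<phi> \<psi> = (\<lambda>x\<in>Q. x)"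
    using assms(3) by (auto simp: fusion_iso_def)
  have "\<phi> ` P \<subseteq> Q" "\<psi> ` Q \<subseteq> P"
    using injective_hom[OF assms(1,2) \<psi>(1)] injective_hom[OF assms(2,1) \<psi>(2)] by (auto simp: hom_def)
  moreover have "\<phi> (\<psi> y) = y" if "y \<in> Q" for y
    using fun_cong[OF \<psi>(3), of y] that by (simp add: compose_def)
  ultimately show ?thesis by force
qed

text \<open>Because every morphism is an isomorphism followed by an inclusion, the image of a morphism is an
object, and the morphism is an isomorphism onto it.\<close>

lemma mor_fusion_iso:
  assumes "mor P \<phi>"
  shows "subgroup (\<phi> ` P) S" "restrict \<phi> P \<in> fusion_iso F P (\<phi> ` P)"
proof -
  have P: "subgroup P S" using assms by (simp add: mor_def)
  obtain R \<psi> where R: "subgroup R S" "\<psi> \<in> fusion_iso F P R" "restrict \<phi> P = compose P (\<lambda>x\<in>R. x) \<psi>"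
    using iso_then_inclusion[OF P subgroup_self, of "restrict \<phi> P"] assms by (auto simp: mor_def)
  have im: "\<psi> ` P = R" using fusion_iso_image[OF P R(1,2)] .
  have "\<psi> \<in> extensional P" using injective_hom[OF P R(1)] R(2) by (auto simp: fusion_iso_def)
  moreover have v: "\<psi> x = \<phi> x" if "x \<in> P" for x
    using fun_cong[OF R(3), of x] that im by (auto simp: compose_def)
  ultimately have "\<psi> = restrict \<phi> P" by (auto simp: fun_eq_iff extensional_def)
  moreover have "\<phi> ` P = R" using v im by auto
  ultimately show "subgroup (\<phi> ` P) S" "restrict \<phi> P \<in> fusion_iso F P (\<phi> ` P)" using R by auto
qed

lemma mor_into:
  assumes "mor P \<phi>" "subgroup Q S" "\<phi> ` P \<subseteq> Q"
  shows "restrict \<phi> P \<in> F P Q"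
proof -
  have P: "subgroup P S" using assms by (simp add: mor_def)
  note iso = mor_fusion_iso[OF assms(1)]
  have "restrict \<phi> P \<in> F P (\<phi> ` P)" using iso by (auto simp: fusion_iso_def)
  then have "compose P (\<lambda>x\<in>\<phi> ` P. x) (restrict \<phi> P) \<in> F P Q"
    by (rule composition[OF P iso(1) assms(2) _ inclusion_morphism[OF iso(1) assms(2,3)]])
  moreover have "compose P (\<lambda>x\<in>\<phi> ` P. x) (restrict \<phi> P) = restrict \<phi> P"
    by (auto simp: compose_def fun_eq_iff)
  ultimately show ?thesis by metis
qed

lemma morphism_iff_mor:
  assumes P: "subgroup P S" and Q: "subgroup Q S"
  shows "\<phi> \<in> F P Q \<longleftrightarrow> \<phi> \<in> extensional P \<and> mor P \<phi> \<and> \<phi> ` P \<subseteq> Q"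
proof
  assume \<phi>: "\<phi> \<in> F P Q"
  have h: "\<phi> \<in> extensional P" "\<phi> ` P \<subseteq> Q" using injective_hom[OF P Q \<phi>] by (auto simp: hom_def)
  have "compose P (\<lambda>x\<in>Q. x) \<phi> \<in> F P (carrier S)"
    using composition[OF P Q subgroup_self \<phi>] inclusion_morphism[OF Q subgroup_self subgroup.subset[OF Q]] by simp
  moreover have "compose P (\<lambda>x\<in>Q. x) \<phi> = restrict \<phi> P"
    using h by (auto simp: compose_def fun_eq_iff)
  ultimately show "\<phi> \<in> extensional P \<and> mor P \<phi> \<and> \<phi> ` P \<subseteq> Q" using P h by (auto simp: mor_def)
next
  assume "\<phi> \<in> extensional P \<and> mor P \<phi> \<and> \<phi> ` P \<subseteq> Q"
  then show "\<phi> \<in> F P Q" using mor_into[of P \<phi> Q] Q by (metis extensional_restrict)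
qed

lemma mor_restrict:
  assumes "mor P \<phi>" "subgroup Q S" "Q \<subseteq> P"
  shows "mor Q \<phi>"
proof -
  have P: "subgroup P S" using assms by (simp add: mor_def)
  have "compose Q (restrict \<phi> P) (\<lambda>x\<in>Q. x) \<in> F Q (carrier S)"
    using composition[OF assms(2) P subgroup_self inclusion_morphism[OF assms(2) P assms(3)]] assms(1)
    by (simp add: mor_def)
  moreover have "compose Q (restrict \<phi> P) (\<lambda>x\<in>Q. x) = restrict \<phi> Q"
    using assms(3) by (auto simp: compose_def fun_eq_iff)
  ultimately show ?thesis using assms(2) by (simp add: mor_def)
qed

lemma mor_comp:
  assumes "mor P \<phi>" "mor (\<phi> ` P) \<psi>"
  shows "mor P (\<lambda>x. \<psi> (\<phi> x))"
proof -
  have P: "subgroup P S" and Q: "subgroup (\<phi> ` P) S" using assms by (auto simp: mor_def)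
  have "compose P (restrict \<psi> (\<phi> ` P)) (restrict \<phi> P) \<in> F P (carrier S)"
    using composition[OF P Q subgroup_self mor_into[OF assms(1) Q]] assms(2) by (simp add: mor_def)
  moreover have "compose P (restrict \<psi> (\<phi> ` P)) (restrict \<phi> P) = restrict (\<lambda>x. \<psi> (\<phi> x)) P"
    by (auto simp: compose_def fun_eq_iff)
  ultimately show ?thesis using P by (simp add: mor_def)
qed

lemma mor_inv_into:
  assumes "mor P \<phi>"
  shows "mor (\<phi> ` P) (inv_into P \<phi>)"
proof -
  have P: "subgroup P S" using assms by (simp add: mor_def)
  note iso = mor_fusion_iso[OF assms]
  obtain \<psi> where \<psi>: "\<psi> \<in> F (\<phi> ` P) P" "compose P \<psi> (restrict \<phi> P) = (\<lambda>x\<in>P. x)"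
    using iso(2) by (auto simp: fusion_iso_def)
  have "\<psi> (\<phi> x) = x" if "x \<in> P" for x
    using fun_cong[OF \<psi>(2), of x] that by (simp add: compose_def)
  then have "inv_into P \<phi> y = \<psi> y" if "y \<in> \<phi> ` P" for y
    using that mor_injective_hom(1)[OF assms] by auto
  then have "mor (\<phi> ` P) (inv_into P \<phi>) \<longleftrightarrow> mor (\<phi> ` P) \<psi>" by (rule mor_cong)
  then show ?thesis using \<psi>(1) morphism_iff_mor[OF iso(1) P] by simp
qed

lemma mor_conj:
  assumes "subgroup P S" "g \<in> carrier S"
  shows "mor P (\<lambda>x. g \<otimes> x \<otimes> inv g)"
proof -
  have "conj_map S g P \<in> Hom_conj S P (carrier S)"
    using assms subgroup.mem_carrier[OF assms(1)] unfolding Hom_conj_def by (auto simp: conj_map_def)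
  then show ?thesis using conj_morphisms[OF assms(1) subgroup_self] assms(1)
    by (auto simp: mor_def conj_map_def)
qed

lemma mor_id: "subgroup P S \<Longrightarrow> mor P (\<lambda>x. x)"
  using inclusion_morphism[OF _ subgroup_self] subgroup.subset by (auto simp: mor_def)

lemma Aut_fusion_simps:
  assumes P: "subgroup P S"
  shows "carrier (Aut_fusion F P) = F P P" "\<one>\<^bsub>Aut_fusion F P\<^esub> = (\<lambda>x\<in>P. x)"
    "\<phi> \<in> F P P \<Longrightarrow> \<psi> \<in> F P P \<Longrightarrow> \<phi> \<otimes>\<^bsub>Aut_fusion F P\<^esub> \<psi> = compose P \<phi> \<psi>"
    "\<phi> \<in> F P P \<longleftrightarrow> \<phi> \<in> extensional P \<and> mor P \<phi> \<and> \<phi> ` P = P"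
    "group (Aut_fusion F P)" "finite (carrier (Aut_fusion F P))"
proof -
  show aut: "\<phi> \<in> F P P \<longleftrightarrow> \<phi> \<in> extensional P \<and> mor P \<phi> \<and> \<phi> ` P = P" for \<phi>
    using morphism_iff_mor[OF P P, of \<phi>] mor_injective_hom(1)[of P \<phi>]
      endo_inj_surj[OF finite_subgroup[OF P], of \<phi>] by auto
  have Bij: "F P P \<subseteq> Bij P"
    unfolding Bij_def bij_betw_def using aut mor_injective_hom(1) by auto
  have sub: "subgroup (F P P) (BijGroup P)"
  proof (rule group.subgroupI[OF group_BijGroup])
    show "F P P \<subseteq> carrier (BijGroup P)" using Bij by (simp add: BijGroup_def)
    show "F P P \<noteq> {}" using identities[OF P] by auto
    show "inv\<^bsub>BijGroup P\<^esub> a \<in> F P P" if "a \<in> F P P" for a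
    proof -
      have a: "mor P a" "a ` P = P" "a \<in> Bij P" using that aut Bij by auto
      have "mor P (inv_into P a)" using mor_inv_into[OF a(1)] a(2) by simp
      then have "restrict (inv_into P a) P \<in> F P P"
        using mor_into[OF _ P] a(2) inv_into_into[of _ a P] by (metis image_subsetI)
      then show ?thesis using inv_BijGroup[OF a(3)] by simp
    qed
    show "a \<otimes>\<^bsub>BijGroup P\<^esub> b \<in> F P P" if "a \<in> F P P" "b \<in> F P P" for a b
      using that composition[OF P P P that(2,1)] Bij by (auto simp: BijGroup_def)
  qed
  show "group (Aut_fusion F P)" unfolding Aut_fusion_def
    using subgroup.subgroup_is_group[OF sub group_BijGroup] .
  show "carrier (Aut_fusion F P) = F P P" "\<one>\<^bsub>Aut_fusion F P\<^esub> = (\<lambda>x\<in>P. x)"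
    by (simp_all add: Aut_fusion_def BijGroup_def)
  show "\<phi> \<in> F P P \<Longrightarrow> \<psi> \<in> F P P \<Longrightarrow> \<phi> \<otimes>\<^bsub>Aut_fusion F P\<^esub> \<psi> = compose P \<phi> \<psi>"
    using Bij by (auto simp: Aut_fusion_def BijGroup_def)
  have "F P P \<subseteq> P \<rightarrow>\<^sub>E P" using aut by (auto simp: PiE_def)
  then show "finite (carrier (Aut_fusion F P))"
    using finite_subset finite_PiE[OF finite_subgroup[OF P] finite_subgroup[OF P]] by (simp add: Aut_fusion_def)
qed

lemma Aut_fusion_pow:
  assumes P: "subgroup P S" and \<phi>: "\<phi> \<in> F P P" and x: "x \<in> P"
  shows "(\<phi> [^]\<^bsub>Aut_fusion F P\<^esub> n) x = (\<phi> ^^ n) x"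
  using x
proof (induction n arbitrary: x)
  case 0
  then show ?case by (simp add: Aut_fusion_simps(2)[OF P])
next
  case (Suc n)
  interpret A: group "Aut_fusion F P" by (rule Aut_fusion_simps(5)[OF P])
  have "\<phi> [^]\<^bsub>Aut_fusion F P\<^esub> n \<in> F P P" using A.nat_pow_closed[of \<phi> n] \<phi> by (simp add: Aut_fusion_simps(1)[OF P])
  moreover have "\<phi> x \<in> P" using \<phi> Suc(2) Aut_fusion_simps(4)[OF P] by auto
  ultimately show ?case
    using Suc \<phi> by (simp add: Aut_fusion_simps(3)[OF P] compose_def funpow_Suc_right del: funpow.simps)
qed

lemma Aut_fusion_inv:
  assumes P: "subgroup P S" and \<phi>: "\<phi> \<in> F P P"
  shows "x \<in> P \<Longrightarrow> (inv\<^bsub>Aut_fusion F P\<^esub> \<phi>) (\<phi> x) = x" "inv\<^bsub>Aut_fusion F P\<^esub> \<phi> \<in> F P P"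
proof -
  interpret A: group "Aut_fusion F P" by (rule Aut_fusion_simps(5)[OF P])
  have c: "\<phi> \<in> carrier (Aut_fusion F P)" using \<phi> Aut_fusion_simps(1)[OF P] by simp
  then show i: "inv\<^bsub>Aut_fusion F P\<^esub> \<phi> \<in> F P P" using A.inv_closed Aut_fusion_simps(1)[OF P] by simp
  have "compose P (inv\<^bsub>Aut_fusion F P\<^esub> \<phi>) \<phi> = (\<lambda>x\<in>P. x)"
    using A.l_inv[OF c] Aut_fusion_simps(2)[OF P] Aut_fusion_simps(3)[OF P i \<phi>] by simp
  then show "(inv\<^bsub>Aut_fusion F P\<^esub> \<phi>) (\<phi> x) = x" if "x \<in> P" for x
    using that by (metis compose_eq restrict_apply')
qed

text \<open>Transport along $\<eta>$ of conjugation by $g$; as $g$ varies over a subgroup normalizing $M$, these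
maps form the $p$-group of automorphisms of $P$ to which Sylow's theorem is applied.\<close>

lemma transported_conj_in_Aut_fusion:
  assumes \<eta>: "mor M \<eta>" "\<eta> ` M = P" and g: "g \<in> carrier S" "normalized_by {g} M"
  shows "(\<lambda>y\<in>P. \<eta> (g \<otimes> inv_into M \<eta> y \<otimes> inv g)) \<in> F P P" (is "?f \<in> _")
proof -
  have M: "subgroup M S" and P: "subgroup P S"
    using mor_subgroup[OF \<eta>(1)] mor_fusion_iso(1)[OF \<eta>(1)] \<eta>(2) by auto
  have 1: "mor P (inv_into M \<eta>)" using mor_inv_into[OF \<eta>(1)] \<eta>(2) by simp
  have im1: "inv_into M \<eta> ` P = M"
    using mor_injective_hom(1)[OF \<eta>(1)] by (simp add: image_image flip: \<eta>(2))
  have 2: "mor P (\<lambda>y. g \<otimes> inv_into M \<eta> y \<otimes> inv g)"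
    using mor_comp[OF 1, of "\<lambda>y. g \<otimes> y \<otimes> inv g"] mor_conj[OF M g(1)] im1 by simp
  have sub2: "(\<lambda>y. g \<otimes> inv_into M \<eta> y \<otimes> inv g) ` P \<subseteq> M"
    using im1 normalized_byD[OF g(2)] by auto
  have 3: "mor ((\<lambda>y. g \<otimes> inv_into M \<eta> y \<otimes> inv g) ` P) \<eta>"
    using mor_restrict[OF \<eta>(1) mor_fusion_iso(1)[OF 2] sub2] .
  have "mor P ?f" using mor_comp[OF 2 3] mor_cong[of P ?f] by simp
  moreover have "?f ` P \<subseteq> P" using sub2 \<eta>(2) by auto
  ultimately show ?thesis using morphism_iff_mor[OF P P] by simp
qed

definition automized :: "'a set \<Rightarrow> bool"
  where "automized P \<longleftrightarrow> subgroup P S \<and> sylow_subgroup p (Aut_fusion F P) (Hom_conj S P P)"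

text \<open>Condition (ii) of saturation, with the largest possible domain $N_\<phi>$ replaced by any subgroup
$N$ contained in it, so that $N_\<phi>$ itself need not be handled.\<close>

definition receptive :: "'a set \<Rightarrow> bool"
  where "receptive P \<longleftrightarrow> subgroup P S \<and>
    (\<forall>Q \<phi> N. mor Q \<phi> \<and> \<phi> ` Q = P \<and> subgroup N S \<and> Q \<subseteq> N \<and> normalized_by N Q \<and>
      (\<forall>g\<in>N. \<exists>h\<in>carrier S. \<forall>x\<in>Q. \<phi> (g \<otimes> x \<otimes> inv g) = h \<otimes> \<phi> x \<otimes> inv h) \<longrightarrow>
      (\<exists>\<psi>. mor N \<psi> \<and> (\<forall>x\<in>Q. \<psi> x = \<phi> x)))"

lemma receptiveD:
  assumes "receptive P" "mor Q \<phi>" "\<phi> ` Q = P" "subgroup N S" "Q \<subseteq> N" "normalized_by N Q"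
    "\<And>g. g \<in> N \<Longrightarrow> \<exists>h\<in>carrier S. \<forall>x\<in>Q. \<phi> (g \<otimes> x \<otimes> inv g) = h \<otimes> \<phi> x \<otimes> inv h"
  shows "\<exists>\<psi>. mor N \<psi> \<and> (\<forall>x\<in>Q. \<psi> x = \<phi> x)"
  using assms unfolding receptive_def by blast

text \<open>Conjugation by $V$, transported to $P$ by $\<eta>$, gives a $p$-subgroup of $Z$, which some
$\<kappa> \<in> Z$ conjugates into the Sylow subgroup $W$. Since $W$ consists of conjugations by
elements of $S$, receptivity extends $\<kappa>\<eta>$ to $N$. With $Z$ the full automorphism group
this is the usual extension to normalizers; with $Z$ the automorphisms fixing the image of a subgroup
$B$ it is the corresponding statement for the part of the fusion system that centralizes $B$.\<close>

lemma extend_up_to_automorphism: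
  assumes rec: "receptive P" and Z: "subgroup Z (Aut_fusion F P)"
    and W: "sylow_subgroup p ((Aut_fusion F P)\<lparr>carrier := Z\<rparr>) W" "W \<subseteq> Hom_conj S P P"
    and \<eta>: "mor M \<eta>" "\<eta> ` M = P" and V: "subgroup V S" "normalized_by V M"
    and VZ: "\<And>g. g \<in> V \<Longrightarrow> (\<lambda>y\<in>P. \<eta> (g \<otimes> inv_into M \<eta> y \<otimes> inv g)) \<in> Z"
    and N: "subgroup N S" "M \<subseteq> N" "normalized_by N M"
    and NV: "\<And>g. g \<in> N \<Longrightarrow> \<exists>m\<in>M. \<exists>v\<in>V. g = m \<otimes> v"
  shows "\<exists>\<kappa>\<in>Z. \<exists>\<psi>. mor N \<psi> \<and> (\<forall>x\<in>M. \<psi> x = \<kappa> (\<eta> x))"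
proof -
  have P: "subgroup P S" using rec by (simp add: receptive_def)
  interpret M: subgroup M S using \<eta>(1) by (rule mor_subgroup)
  interpret V: subgroup V S by fact
  interpret A: group "Aut_fusion F P" by (rule Aut_fusion_simps(5)[OF P])
  note A = Aut_fusion_simps[OF P]
  let ?A = "Aut_fusion F P"
  have ZF: "Z \<subseteq> F P P" using subgroup.subset[OF Z] A(1) by simp
  define f where "f g = (\<lambda>y\<in>P. \<eta> (g \<otimes> inv_into M \<eta> y \<otimes> inv g))" for g
  have fF: "f g \<in> F P P" if "g \<in> V" for g using VZ[OF that] ZF by (auto simp: f_def)
  have f: "f g (\<eta> x) = \<eta> (g \<otimes> x \<otimes> inv g)" if "x \<in> M" for g x
    using that \<eta>(2) mor_injective_hom(1)[OF \<eta>(1)] by (auto simp: f_def)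
  have "f (g \<otimes> h) = compose P (f g) (f h)" if "g \<in> V" "h \<in> V" for g h
  proof
    fix y
    show "f (g \<otimes> h) y = compose P (f g) (f h) y"
    proof (cases "y \<in> P")
      case True
      then obtain x where x: "x \<in> M" "y = \<eta> x" using \<eta>(2) by auto
      have "h \<otimes> x \<otimes> inv h \<in> M" using normalized_byD[OF V(2)] that x by auto
      moreover have "g \<in> carrier S" "h \<in> carrier S" "x \<in> carrier S" using that x by auto
      ultimately show ?thesis using x True by (simp add: compose_def f word_simps)
    qed (simp add: f_def compose_def)
  qed
  then have hom: "f \<in> hom (S\<lparr>carrier := V\<rparr>) (Aut_fusion F P)"
    using fF A(1,3) by (auto simp: hom_def)
  obtain k where "card V = p ^ k" using card_subgroup[OF V(1)] by auto
  then obtain \<kappa> where \<kappa>: "\<kappa> \<in> Z"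
      "\<And>v. v \<in> V \<Longrightarrow> \<kappa> \<otimes>\<^bsub>?A\<^esub> f v \<otimes>\<^bsub>?A\<^esub> inv\<^bsub>?A\<^esub> \<kappa> \<in> W"
    using A.p_group_conjugate_into_sylow[OF A(6) prime_p subgroup_group[OF V(1)] _ hom _ Z W(1), of k] VZ
    by (auto simp: order_def f_def[symmetric])
  have \<kappa>F: "\<kappa> \<in> F P P" using \<kappa>(1) ZF by auto
  then have \<kappa>P: "mor P \<kappa>" "\<kappa> ` P = P" using A(4) by auto
  have conj: "\<exists>h\<in>carrier S. \<forall>x\<in>M. \<kappa> (\<eta> (v \<otimes> x \<otimes> inv v)) = h \<otimes> \<kappa> (\<eta> x) \<otimes> inv h" if v: "v \<in> V" for v
  proof -
    have fF: "f v \<in> F P P" using fF[OF v] .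
    obtain h where h: "h \<in> carrier S"
        "\<kappa> \<otimes>\<^bsub>?A\<^esub> f v \<otimes>\<^bsub>?A\<^esub> inv\<^bsub>?A\<^esub> \<kappa> = conj_map S h P"
      using \<kappa>(2)[OF v] W(2) unfolding Hom_conj_def by auto
    have "\<kappa> \<otimes>\<^bsub>?A\<^esub> f v = conj_map S h P \<otimes>\<^bsub>?A\<^esub> \<kappa>"
      unfolding h(2)[symmetric] using \<kappa>F fF unfolding A(1)[symmetric] by (simp add: A.m_assoc)
    then have eq: "compose P \<kappa> (f v) = compose P (conj_map S h P) \<kappa>"
      using A(3)[OF \<kappa>F fF] A(3)[OF _ \<kappa>F, of "conj_map S h P"] \<kappa>(2)[OF v] h(2)
        A.sylow_subgroupD(2)[OF Z W(1)] ZF by auto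
    have "\<kappa> (\<eta> (v \<otimes> x \<otimes> inv v)) = h \<otimes> \<kappa> (\<eta> x) \<otimes> inv h" if x: "x \<in> M" for x
    proof -
      have "\<eta> x \<in> P" "\<kappa> (\<eta> x) \<in> P" using x \<eta>(2) \<kappa>P(2) by auto
      then show ?thesis using fun_cong[OF eq, of "\<eta> x"] f[OF x] by (simp add: compose_def conj_map_def)
    qed
    then show ?thesis using h(1) by blast
  qed
  have \<kappa>\<eta>: "mor M (\<lambda>x. \<kappa> (\<eta> x))" using mor_comp[OF \<eta>(1)] \<eta>(2) \<kappa>P(1) by simp
  have "\<exists>\<psi>. mor N \<psi> \<and> (\<forall>x\<in>M. \<psi> x = \<kappa> (\<eta> x))"
  proof (rule receptiveD[OF rec \<kappa>\<eta> _ N])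
    show "(\<lambda>x. \<kappa> (\<eta> x)) ` M = P" using \<eta>(2) \<kappa>P(2) by auto
    fix g assume g: "g \<in> N"
    then obtain m v where mv: "m \<in> M" "v \<in> V" "g = m \<otimes> v" using NV by blast
    obtain h where h: "h \<in> carrier S" "\<And>x. x \<in> M \<Longrightarrow> \<kappa> (\<eta> (v \<otimes> x \<otimes> inv v)) = h \<otimes> \<kappa> (\<eta> x) \<otimes> inv h"
      using conj[OF mv(2)] by auto
    let ?m = "\<kappa> (\<eta> m)"
    note mc = mor_injective_hom(2)[OF \<kappa>\<eta>]
    have "\<kappa> (\<eta> (g \<otimes> x \<otimes> inv g)) = (?m \<otimes> h) \<otimes> \<kappa> (\<eta> x) \<otimes> inv (?m \<otimes> h)" if x: "x \<in> M" for x
    proof -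
      have "v \<otimes> x \<otimes> inv v \<in> M" using normalized_byD[OF V(2) mv(2) x] .
      moreover have "g \<otimes> x \<otimes> inv g = m \<otimes> (v \<otimes> x \<otimes> inv v) \<otimes> inv m"
        using mv x by (simp add: word_simps)
      ultimately have "\<kappa> (\<eta> (g \<otimes> x \<otimes> inv g)) = ?m \<otimes> (h \<otimes> \<kappa> (\<eta> x) \<otimes> inv h) \<otimes> inv ?m"
        using mor_conjugate[OF \<kappa>\<eta> mv(1)] h(2)[OF x] by simp
      then show ?thesis using mc[OF mv(1)] mc[OF x] h(1) by (simp add: word_simps)
    qed
    then show "\<exists>h\<in>carrier S. \<forall>x\<in>M. \<kappa> (\<eta> (g \<otimes> x \<otimes> inv g)) = h \<otimes> \<kappa> (\<eta> x) \<otimes> inv h"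
      using h(1) mc[OF mv(1)] by (intro bexI[of _ "?m \<otimes> h"]) auto
  qed
  then show ?thesis using \<kappa>(1) by blast
qed

end

lemma (in saturated_fusion_system) exists_automized_receptive:
  assumes R: "subgroup R S"
  shows "\<exists>\<phi>. mor R \<phi> \<and> automized (\<phi> ` R) \<and> receptive (\<phi> ` R)"
proof -
  obtain P \<phi> where P: "subgroup P S" and \<phi>: "\<phi> \<in> fusion_iso F R P"
    and syl: "sylow_subgroup p (Aut_fusion F P) (Hom_conj S P P)"
    and ext: "\<And>Q \<phi>. subgroup Q S \<Longrightarrow> \<phi> \<in> fusion_iso F Q P \<Longrightarrow>
        \<exists>\<psi> \<in> F (extender S Q P \<phi>) (carrier S). \<forall>x\<in>Q. \<psi> x = \<phi> x"
    using saturation[OF R] by blast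
  have im: "\<phi> ` R = P" using fusion_iso_image[OF R P \<phi>] .
  have "mor R \<phi>" using \<phi> morphism_iff_mor[OF R P] by (simp add: fusion_iso_def)
  moreover have "receptive P"
    unfolding receptive_def
  proof (intro conjI P allI impI, elim conjE)
    fix Q \<eta> N
    assume \<eta>: "mor Q \<eta>" "\<eta> ` Q = P" and N: "subgroup N S" "Q \<subseteq> N" "normalized_by N Q"
      and conj: "\<forall>g\<in>N. \<exists>h\<in>carrier S. \<forall>x\<in>Q. \<eta> (g \<otimes> x \<otimes> inv g) = h \<otimes> \<eta> x \<otimes> inv h"
    interpret N: subgroup N S by fact
    have Q: "subgroup Q S" using mor_subgroup \<eta> by blast
    interpret Q: subgroup Q S by fact
    let ?\<eta> = "restrict \<eta> Q"
    have inj: "inj_on ?\<eta> Q" using mor_injective_hom(1)[OF \<eta>(1)] by (simp add: inj_on_restrict_eq)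
    have iso: "?\<eta> \<in> fusion_iso F Q P" using mor_fusion_iso[OF \<eta>(1)] \<eta>(2) by simp
    have "N \<subseteq> extender S Q P ?\<eta>"
    proof
      fix g assume g: "g \<in> N"
      have gS: "g \<in> carrier S" using g by auto
      have "g <# Q #> inv g = Q"
      proof
        show "g <# Q #> inv g \<subseteq> Q"
          using normalized_byD[OF N(3) g] by (auto simp: l_coset_def r_coset_def)
        show "Q \<subseteq> g <# Q #> inv g"
        proof
          fix q assume q: "q \<in> Q"
          have "inv g \<otimes> q \<otimes> inv (inv g) \<in> Q" using normalized_byD[OF N(3) _ q] g by blast
          moreover have "g \<otimes> (inv g \<otimes> q \<otimes> inv (inv g)) \<otimes> inv g = q"
            using gS Q.mem_carrier[OF q] by (simp add: word_simps)
          ultimately show "q \<in> g <# Q #> inv g" unfolding l_coset_def r_coset_def by force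
        qed
      qed
      then have "g \<in> normalizer S Q" using gS Q.subset by (simp add: normalizer_def stabilizer_def)
      moreover obtain h where h: "h \<in> carrier S" "\<And>x. x \<in> Q \<Longrightarrow> \<eta> (g \<otimes> x \<otimes> inv g) = h \<otimes> \<eta> x \<otimes> inv h"
        using conj g by blast
      have val: "compose P ?\<eta> (compose P (conj_map S g Q) (inv_into Q ?\<eta>)) = conj_map S h P"
      proof
        fix y
        show "compose P ?\<eta> (compose P (conj_map S g Q) (inv_into Q ?\<eta>)) y = conj_map S h P y"
        proof (cases "y \<in> P")
          case True
          then obtain x where x: "x \<in> Q" "y = \<eta> x" using \<eta>(2) by auto
          have "inv_into Q ?\<eta> y = x" using inv_into_f_f[OF inj x(1)] x by simp
          then show ?thesis
            using True x h(2)[OF x(1)] normalized_byD[OF N(3) g x(1)] by (simp add: compose_def conj_map_def)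
        qed (simp add: compose_def conj_map_def)
      qed
      have "conj_map S h P ` P \<subseteq> P"
      proof (rule image_subsetI)
        fix y assume y: "y \<in> P"
        then obtain x where x: "x \<in> Q" "y = \<eta> x" using \<eta>(2) by auto
        then have "conj_map S h P y = \<eta> (g \<otimes> x \<otimes> inv g)" using h(2) y by (simp add: conj_map_def)
        then show "conj_map S h P y \<in> P" using normalized_byD[OF N(3) g x(1)] \<eta>(2) by auto
      qed
      then have "conj_map S h P \<in> Hom_conj S P P" using h(1) by (auto simp: Hom_conj_def)
      ultimately show "g \<in> extender S Q P ?\<eta>" using val by (simp add: extender_def)
    qed
    moreover obtain \<psi> where \<psi>: "\<psi> \<in> F (extender S Q P ?\<eta>) (carrier S)" "\<forall>x\<in>Q. \<psi> x = ?\<eta> x"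
      using ext[OF Q iso] by blast
    moreover have "subgroup (extender S Q P ?\<eta>) S" using objects \<psi>(1) by blast
    ultimately have "mor N \<psi>"
      using mor_restrict[OF _ N(1)] morphism_iff_mor[OF _ subgroup_self] by blast
    then show "\<exists>\<psi>. mor N \<psi> \<and> (\<forall>x\<in>Q. \<psi> x = \<eta> x)" using \<psi>(2) by auto
  qed
  ultimately show ?thesis using P syl im by (auto simp: automized_def)
qed

section \<open>A fusion theorem relative to a pointwise fixed subgroup\<close>

context finite_p_group
begin

text \<open>When $M$ normalizes $B$, this is the product $M C_S(B)$, described by the automorphisms of $B$ that
its elements induce.\<close>

definition times_centralizer :: "'a set \<Rightarrow> 'a set \<Rightarrow> 'a set"
  where "times_centralizer M B =
    {g \<in> carrier S. \<exists>m\<in>M. \<forall>b\<in>B. g \<otimes> b \<otimes> inv g = m \<otimes> b \<otimes> inv m}"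

lemma subgroup_times_centralizer:
  assumes M: "subgroup M S" and B: "B \<subseteq> carrier S" and norm: "normalized_by M B"
  shows "subgroup (times_centralizer M B) S"
proof (rule subgroupI)
  interpret M: subgroup M S by fact
  show "times_centralizer M B \<subseteq> carrier S" by (auto simp: times_centralizer_def)
  have "\<one> \<in> times_centralizer M B"
    using M.one_closed unfolding times_centralizer_def by blast
  then show "times_centralizer M B \<noteq> {}" by blast
  show "inv g \<in> times_centralizer M B" if g: "g \<in> times_centralizer M B" for g
  proof -
    obtain m where m: "g \<in> carrier S" "m \<in> M" "\<And>b. b \<in> B \<Longrightarrow> g \<otimes> b \<otimes> inv g = m \<otimes> b \<otimes> inv m"
      using g by (auto simp: times_centralizer_def)
    have "inv g \<otimes> b \<otimes> inv (inv g) = inv m \<otimes> b \<otimes> inv (inv m)" if b: "b \<in> B" for b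
    proof -
      let ?c = "inv m \<otimes> b \<otimes> inv (inv m)"
      have c: "?c \<in> B" using normalized_byD[OF norm _ b] m(2) by blast
      have cr: "m \<in> carrier S" "b \<in> carrier S" "?c \<in> carrier S" using m c b B by auto
      have "b = g \<otimes> ?c \<otimes> inv g" unfolding m(3)[OF c] using cr by (simp add: word_simps)
      then have "inv g \<otimes> b \<otimes> inv (inv g) = inv g \<otimes> (g \<otimes> ?c \<otimes> inv g) \<otimes> inv (inv g)" by simp
      then show ?thesis using m(1) cr(3) by (simp add: word_simps del: inv_inv)
    qed
    then show ?thesis
      using inv_closed[OF m(1)] M.m_inv_closed[OF m(2)] unfolding times_centralizer_def by blast
  qed
  show "g \<otimes> h \<in> times_centralizer M B"
    if gh: "g \<in> times_centralizer M B" "h \<in> times_centralizer M B" for g h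
  proof -
    obtain m where m: "g \<in> carrier S" "m \<in> M" "\<And>b. b \<in> B \<Longrightarrow> g \<otimes> b \<otimes> inv g = m \<otimes> b \<otimes> inv m"
      using gh(1) by (auto simp: times_centralizer_def)
    obtain n where n: "h \<in> carrier S" "n \<in> M" "\<And>b. b \<in> B \<Longrightarrow> h \<otimes> b \<otimes> inv h = n \<otimes> b \<otimes> inv n"
      using gh(2) by (auto simp: times_centralizer_def)
    have "(g \<otimes> h) \<otimes> b \<otimes> inv (g \<otimes> h) = (m \<otimes> n) \<otimes> b \<otimes> inv (m \<otimes> n)" if b: "b \<in> B" for b
    proof -
      have cr: "m \<in> carrier S" "n \<in> carrier S" "b \<in> carrier S" using m n b B by auto
      have "(g \<otimes> h) \<otimes> b \<otimes> inv (g \<otimes> h) = g \<otimes> (h \<otimes> b \<otimes> inv h) \<otimes> inv g"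
        using m(1) n(1) cr by (simp add: word_simps)
      also have "\<dots> = m \<otimes> (n \<otimes> b \<otimes> inv n) \<otimes> inv m"
        unfolding n(3)[OF b] using m(3) normalized_byD[OF norm n(2) b] by simp
      also have "\<dots> = (m \<otimes> n) \<otimes> b \<otimes> inv (m \<otimes> n)" using cr by (simp add: word_simps)
      finally show ?thesis .
    qed
    then show ?thesis
      using m_closed[OF m(1) n(1)] M.m_closed[OF m(2) n(2)] unfolding times_centralizer_def by blast
  qed
qed

lemma subset_times_centralizer: "subgroup M S \<Longrightarrow> M \<subseteq> times_centralizer M B"
  using subgroup.subset unfolding times_centralizer_def by blast

lemma normalized_by_times_centralizer:
  "normalized_by M B \<Longrightarrow> normalized_by (times_centralizer M B) B"
  unfolding normalized_by_def times_centralizer_def by auto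

lemma times_centralizer_decompose:
  assumes M: "subgroup M S" and B: "B \<subseteq> carrier S" and g: "g \<in> times_centralizer M B"
  shows "\<exists>m\<in>M. inv m \<otimes> g \<in> carrier S \<and> g = m \<otimes> (inv m \<otimes> g) \<and>
    (\<forall>b\<in>B. (inv m \<otimes> g) \<otimes> b \<otimes> inv (inv m \<otimes> g) = b)"
proof -
  obtain m where m: "g \<in> carrier S" "m \<in> M" "\<And>b. b \<in> B \<Longrightarrow> g \<otimes> b \<otimes> inv g = m \<otimes> b \<otimes> inv m"
    using g by (auto simp: times_centralizer_def)
  have mS: "m \<in> carrier S" using m(2) subgroup.mem_carrier[OF M] by blast
  have "(inv m \<otimes> g) \<otimes> b \<otimes> inv (inv m \<otimes> g) = b" if b: "b \<in> B" for b
  proof -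
    have bS: "b \<in> carrier S" using b B by auto
    have "(inv m \<otimes> g) \<otimes> b \<otimes> inv (inv m \<otimes> g) = inv m \<otimes> (g \<otimes> b \<otimes> inv g) \<otimes> m"
      using m(1) mS bS by (simp add: word_simps)
    also have "\<dots> = b" unfolding m(3)[OF b] using mS bS by (simp add: word_simps)
    finally show ?thesis .
  qed
  then show ?thesis using m(1,2) mS by (intro bexI[of _ m]) (simp_all add: mult_inv_cancel)
qed

lemma subgroup_normalizing:
  assumes L: "subgroup L S" and M: "subgroup M S"
  shows "subgroup {g \<in> L. normalized_by {g} M} S" (is "subgroup ?N S")
proof (rule subgroupI)
  interpret L: subgroup L S by fact
  interpret M: subgroup M S by fact
  show "?N \<subseteq> carrier S" by auto
  have "\<one> \<in> ?N" by (auto simp: normalized_by_def)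
  then show "?N \<noteq> {}" by blast
  show "inv g \<in> ?N" if g: "g \<in> ?N" for g
  proof -
    have gS: "g \<in> carrier S" using g by auto
    let ?c = "\<lambda>x. g \<otimes> x \<otimes> inv g"
    have "?c ` M = M"
    proof (rule endo_inj_surj[OF finite_subgroup[OF M]])
      show "?c ` M \<subseteq> M" using g by (auto simp: normalized_by_def)
      show "inj_on ?c M" using gS by (auto simp: inj_on_def)
    qed
    have "inv g \<otimes> x \<otimes> inv (inv g) \<in> M" if x: "x \<in> M" for x
    proof -
      obtain y where y: "y \<in> M" "x = ?c y" using \<open>?c ` M = M\<close> x by blast
      have "inv g \<otimes> x \<otimes> inv (inv g) = y" unfolding y(2) using gS M.mem_carrier[OF y(1)] by (simp add: word_simps)
      then show ?thesis using y(1) by simp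
    qed
    then show ?thesis using g by (auto simp: normalized_by_def)
  qed
  show "g \<otimes> h \<in> ?N" if gh: "g \<in> ?N" "h \<in> ?N" for g h
  proof -
    have "(g \<otimes> h) \<otimes> x \<otimes> inv (g \<otimes> h) \<in> M" if x: "x \<in> M" for x
    proof -
      have "g \<otimes> (h \<otimes> x \<otimes> inv h) \<otimes> inv g \<in> M" using gh x by (simp add: normalized_by_def)
      moreover have "g \<otimes> (h \<otimes> x \<otimes> inv h) \<otimes> inv g = (g \<otimes> h) \<otimes> x \<otimes> inv (g \<otimes> h)"
        using gh M.mem_carrier[OF x] L.mem_carrier by (simp add: word_simps)
      ultimately show ?thesis by simp
    qed
    then show ?thesis using gh by (auto simp: normalized_by_def)
  qed
qed

text \<open>The closure properties that the proof of the fusion theorem uses. The theorem is applied to the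
morphisms of a subsystem and to the morphisms that respect a given normal subgroup.\<close>

definition morphism_class :: "('a set \<Rightarrow> ('a \<Rightarrow> 'a) \<Rightarrow> bool) \<Rightarrow> bool"
  where "morphism_class good \<longleftrightarrow>
    (\<forall>P \<phi> \<psi>. good P \<phi> \<longrightarrow> (\<forall>x\<in>P. \<phi> x = \<psi> x) \<longrightarrow> good P \<psi>) \<and>
    (\<forall>P \<phi> \<psi>. good P \<phi> \<longrightarrow> good (\<phi> ` P) \<psi> \<longrightarrow> good P (\<lambda>x. \<psi> (\<phi> x))) \<and>
    (\<forall>P \<phi>. good P \<phi> \<longrightarrow> inj_on \<phi> P \<longrightarrow> good (\<phi> ` P) (inv_into P \<phi>)) \<and>
    (\<forall>P Q \<phi>. good P \<phi> \<longrightarrow> subgroup Q S \<longrightarrow> Q \<subseteq> P \<longrightarrow> good Q \<phi>) \<and>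
    (\<forall>P g. subgroup P S \<longrightarrow> g \<in> carrier S \<longrightarrow> good P (\<lambda>x. g \<otimes> x \<otimes> inv g))"

lemma morphism_classD:
  assumes "morphism_class good"
  shows "good P \<phi> \<Longrightarrow> (\<And>x. x \<in> P \<Longrightarrow> \<phi> x = \<psi> x) \<Longrightarrow> good P \<psi>"
    "good P \<phi> \<Longrightarrow> good (\<phi> ` P) \<psi> \<Longrightarrow> good P (\<lambda>x. \<psi> (\<phi> x))"
    "good P \<phi> \<Longrightarrow> inj_on \<phi> P \<Longrightarrow> good (\<phi> ` P) (inv_into P \<phi>)"
    "good P \<phi> \<Longrightarrow> subgroup Q S \<Longrightarrow> Q \<subseteq> P \<Longrightarrow> good Q \<phi>"
    "subgroup P S \<Longrightarrow> g \<in> carrier S \<Longrightarrow> good P (\<lambda>x. g \<otimes> x \<otimes> inv g)"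
  using assms unfolding morphism_class_def by blast+

end

lemma (in fusion_system) p'_automorphism_iff_Aut_fusion:
  assumes P: "subgroup P S" and z: "z \<in> F P P"
  shows "p'_automorphism P z \<longleftrightarrow> (\<exists>n::nat. coprime n p \<and> z [^]\<^bsub>Aut_fusion F P\<^esub> n = \<one>\<^bsub>Aut_fusion F P\<^esub>)"
proof -
  interpret A: group "Aut_fusion F P" by (rule Aut_fusion_simps(5)[OF P])
  have m: "mor P z" "z ` P = P" using z Aut_fusion_simps(4)[OF P] by auto
  have "z [^]\<^bsub>Aut_fusion F P\<^esub> n = \<one>\<^bsub>Aut_fusion F P\<^esub> \<longleftrightarrow> (\<forall>x\<in>P. (z ^^ n) x = x)" for n :: nat
  proof -
    have "z [^]\<^bsub>Aut_fusion F P\<^esub> n \<in> extensional P"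
      using A.nat_pow_closed[of z n] z Aut_fusion_simps(1,4)[OF P] by auto
    then have "z [^]\<^bsub>Aut_fusion F P\<^esub> n = restrict (z ^^ n) P"
      using Aut_fusion_pow[OF P z] by (intro extensionalityI[where A = P]) auto
    then show ?thesis unfolding Aut_fusion_simps(2)[OF P] by (auto simp: restrict_def fun_eq_iff)
  qed
  then show ?thesis using m mor_injective_hom(3)[OF m(1)] by (auto simp: p'_automorphism_def)
qed

context saturated_fusion_system
begin

text \<open>Start from any isomorphism onto a receptive and fully automized subgroup and follow it by an
automorphism that moves a Sylow subgroup of the stabilizer of the image of $B$ into the group of
conjugations.\<close>

lemma exists_receptive_with_relative_sylow:
  assumes M: "subgroup M S" and B: "B \<subseteq> M"
  shows "\<exists>\<phi> W. mor M \<phi> \<and> receptive (\<phi> ` M) \<and>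
    subgroup {z \<in> F (\<phi> ` M) (\<phi> ` M). \<forall>b\<in>B. z (\<phi> b) = \<phi> b} (Aut_fusion F (\<phi> ` M)) \<and>
    sylow_subgroup p
      ((Aut_fusion F (\<phi> ` M))\<lparr>carrier := {z \<in> F (\<phi> ` M) (\<phi> ` M). \<forall>b\<in>B. z (\<phi> b) = \<phi> b}\<rparr>) W \<and>
    W \<subseteq> Hom_conj S (\<phi> ` M) (\<phi> ` M)"
proof -
  obtain \<eta> where \<eta>: "mor M \<eta>" "automized (\<eta> ` M)" "receptive (\<eta> ` M)"
    using exists_automized_receptive[OF M] by auto
  define P where "P = \<eta> ` M"
  let ?A = "Aut_fusion F P"
  have P: "subgroup P S" using \<eta>(3) by (simp add: receptive_def P_def)
  interpret A: group "Aut_fusion F P" by (rule Aut_fusion_simps(5)[OF P])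
  note A = Aut_fusion_simps[OF P]
  note Ai = Aut_fusion_inv[OF P]
  have \<eta>P: "\<eta> b \<in> P" if "b \<in> B" for b using that B by (auto simp: P_def)
  let ?Z = "{z \<in> F P P. \<forall>b\<in>B. z (\<eta> b) = \<eta> b}"
  have Z: "subgroup ?Z (Aut_fusion F P)"
  proof (rule A.subgroupI)
    show "?Z \<subseteq> carrier (Aut_fusion F P)" using A(1) by auto
    have "\<one>\<^bsub>?A\<^esub> \<in> ?Z" using A.one_closed A(1,2) \<eta>P by auto
    then show "?Z \<noteq> {}" by blast
    show "inv\<^bsub>?A\<^esub> z \<in> ?Z" if "z \<in> ?Z" for z
    proof -
      have "(inv\<^bsub>?A\<^esub> z) (\<eta> b) = \<eta> b" if b: "b \<in> B" for b
        using Ai(1)[of z "\<eta> b"] \<eta>P[OF b] \<open>z \<in> ?Z\<close> b by auto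
      then show ?thesis using Ai(2)[of z] that by auto
    qed
    show "y \<otimes>\<^bsub>?A\<^esub> z \<in> ?Z" if yz: "y \<in> ?Z" "z \<in> ?Z" for y z
    proof -
      have "y \<otimes>\<^bsub>?A\<^esub> z \<in> F P P" using yz A.m_closed A(1) by auto
      then show ?thesis using yz A(3)[of y z] \<eta>P by (auto simp: compose_def)
    qed
  qed
  have syl: "sylow_subgroup p (Aut_fusion F P) (Hom_conj S P P)" using \<eta>(2) by (simp add: automized_def P_def)
  obtain \<kappa> W where \<kappa>: "\<kappa> \<in> carrier (Aut_fusion F P)"
    and W: "subgroup ((\<lambda>z. \<kappa> \<otimes>\<^bsub>?A\<^esub> z \<otimes>\<^bsub>?A\<^esub> inv\<^bsub>?A\<^esub> \<kappa>) ` ?Z) (Aut_fusion F P)"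
     "sylow_subgroup p ((Aut_fusion F P)\<lparr>carrier := (\<lambda>z. \<kappa> \<otimes>\<^bsub>?A\<^esub> z \<otimes>\<^bsub>?A\<^esub> inv\<^bsub>?A\<^esub> \<kappa>) ` ?Z\<rparr>) W"
     "W \<subseteq> Hom_conj S P P"
    using A.exists_conjugate_with_sylow_in[OF A(6) prime_p syl Z] by blast
  have \<kappa>F: "\<kappa> \<in> F P P" using \<kappa> A(1) by simp
  then have \<kappa>P: "mor P \<kappa>" "\<kappa> ` P = P" using A(4) by auto
  have img: "(\<lambda>z. \<kappa> \<otimes>\<^bsub>?A\<^esub> z \<otimes>\<^bsub>?A\<^esub> inv\<^bsub>?A\<^esub> \<kappa>) ` ?Z =
      {z \<in> F P P. \<forall>b\<in>B. z (\<kappa> (\<eta> b)) = \<kappa> (\<eta> b)}" (is "?c ` ?Z = ?Z'")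
  proof
    show "?c ` ?Z \<subseteq> ?Z'"
    proof (rule image_subsetI)
      fix z assume z: "z \<in> ?Z"
      have c: "?c z \<in> F P P" "?c z \<otimes>\<^bsub>?A\<^esub> \<kappa> = \<kappa> \<otimes>\<^bsub>?A\<^esub> z"
        using z \<kappa> unfolding A(1)[symmetric] by (auto simp: A.m_assoc)
      have eq: "compose P (?c z) \<kappa> = compose P \<kappa> z"
        using c(2) A(3)[OF c(1) \<kappa>F] A(3)[OF \<kappa>F, of z] z by simp
      then have "?c z (\<kappa> (\<eta> b)) = \<kappa> (\<eta> b)" if "b \<in> B" for b
        using fun_cong[OF eq, of "\<eta> b", unfolded compose_eq[OF \<eta>P[OF that]]] z that by simp
      then show "?c z \<in> ?Z'" using c(1) by simp
    qed
    show "?Z' \<subseteq> ?c ` ?Z"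
    proof
      fix y assume y: "y \<in> ?Z'"
      let ?z = "inv\<^bsub>?A\<^esub> \<kappa> \<otimes>\<^bsub>?A\<^esub> y \<otimes>\<^bsub>?A\<^esub> \<kappa>"
      have yc: "y \<in> carrier (Aut_fusion F P)" using y A(1) by auto
      have z: "?z \<in> F P P" "\<kappa> \<otimes>\<^bsub>?A\<^esub> ?z = y \<otimes>\<^bsub>?A\<^esub> \<kappa>" "?c ?z = y"
        using yc \<kappa> unfolding A(1)[symmetric] by (auto simp: A.word_simps)
      have eq: "compose P \<kappa> ?z = compose P y \<kappa>"
        using z(2) A(3)[OF \<kappa>F z(1)] A(3)[OF _ \<kappa>F, of y] y by simp
      then have "\<kappa> (?z (\<eta> b)) = \<kappa> (\<eta> b)" if "b \<in> B" for b
        using fun_cong[OF eq, of "\<eta> b", unfolded compose_eq[OF \<eta>P[OF that]]] y that by simp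
      moreover have "?z x \<in> P" if "x \<in> P" for x using z(1) A(4) that by blast
      ultimately have "?z (\<eta> b) = \<eta> b" if "b \<in> B" for b
        using inj_onD[OF mor_injective_hom(1)[OF \<kappa>P(1)]] \<eta>P that by blast
      then have "?z \<in> ?Z" using z(1) by simp
      then show "y \<in> ?c ` ?Z" using z(3) by (metis (no_types, lifting) imageI)
    qed
  qed
  have "mor M (\<lambda>x. \<kappa> (\<eta> x))" using mor_comp[OF \<eta>(1)] \<kappa>P by (simp add: P_def)
  moreover have "(\<lambda>x. \<kappa> (\<eta> x)) ` M = P" using \<kappa>P(2) by (auto simp: P_def)
  ultimately show ?thesis
    using W \<eta>(3) unfolding img by (intro exI[of _ "\<lambda>x. \<kappa> (\<eta> x)"] exI[of _ W]) (simp add: P_def)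
qed

end

context saturated_fusion_system
begin

text \<open>Alperin's fusion theorem for the morphisms that fix $B$ pointwise, without proving that these form a
saturated fusion system on their own. The induction is downwards on the order of $M$. Choose
$\<phi>$ from $M$ onto a receptive subgroup $P$ with a Sylow subgroup of the stabilizer of $\<phi>(B)$
consisting of conjugations. Since $B$ is receptive, the inverse of $\<phi>$ on $\<phi>(B)$ extends to
$\<psi>$ on $P C_S(\<phi>(B))$, and $M_3 = \<psi>(P)$ serves as the fully normalized member of the
class of $M$. Its automorphisms fixing $B$ are generated by conjugations and automorphisms of order
prime to $p$, so they are good. Both $M$ and $\<delta>(M)$ map to $M_3$ by morphisms that extend to
their normalizers in $M C_S(B)$ and are good by induction. If $M = M C_S(B)$ there is nothing to
extend, but then all three subgroups coincide.\<close>

lemma relative_fusion_theorem: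
  assumes B: "receptive B" and cls: "morphism_class good"
    and p': "\<And>X \<alpha>. mor X \<alpha> \<Longrightarrow> \<alpha> ` X = X \<Longrightarrow> p'_automorphism X \<alpha> \<Longrightarrow> B \<subseteq> X \<Longrightarrow> normalized_by X B \<Longrightarrow>
      (\<And>b. b \<in> B \<Longrightarrow> \<alpha> b = b) \<Longrightarrow> good X \<alpha>"
    and \<delta>: "mor M \<delta>" "B \<subseteq> M" "normalized_by M B" "\<And>b. b \<in> B \<Longrightarrow> \<delta> b = b"
  shows "good M \<delta>"
  using \<delta>
proof (induction "card (carrier S) - card M" arbitrary: M \<delta> rule: less_induct)
  case less
  note good = morphism_classD[OF cls]
  have M: "subgroup M S" using less.prems(1) by (rule mor_subgroup)
  interpret M: subgroup M S by fact
  have BS: "B \<subseteq> carrier S" using less.prems(2) M.subset by auto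
  have IH: "good N \<eta>" if "mor N \<eta>" "card M < card N" "B \<subseteq> N" "normalized_by N B" "\<And>b. b \<in> B \<Longrightarrow> \<eta> b = b" for N \<eta>
  proof (rule less.hyps[OF _ that(1,3,4,5)])
    have "card N \<le> card (carrier S)"
      using card_mono[OF finite_carrier] subgroup.subset[OF mor_subgroup[OF that(1)]] by auto
    then show "card (carrier S) - card N < card (carrier S) - card M" using that(2) by simp
  qed
  obtain \<phi> W where \<phi>: "mor M \<phi>" "receptive (\<phi> ` M)"
    and Z: "subgroup {z \<in> F (\<phi> ` M) (\<phi> ` M). \<forall>b\<in>B. z (\<phi> b) = \<phi> b} (Aut_fusion F (\<phi> ` M))"
    and W: "sylow_subgroup p ((Aut_fusion F (\<phi> ` M))\<lparr>carrier :=
        {z \<in> F (\<phi> ` M) (\<phi> ` M). \<forall>b\<in>B. z (\<phi> b) = \<phi> b}\<rparr>) W"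
      "W \<subseteq> Hom_conj S (\<phi> ` M) (\<phi> ` M)"
    using exists_receptive_with_relative_sylow[OF M less.prems(2)] by blast
  define P where "P = \<phi> ` M"
  let ?A = "Aut_fusion F P"
  define E where "E = \<phi> ` B"
  define Z where "Z = {z \<in> F P P. \<forall>b\<in>B. z (\<phi> b) = \<phi> b}"
  note \<phi> = \<phi>[folded P_def] and Zsub = Z[folded P_def, folded Z_def] and W = W[folded P_def, folded Z_def]
  have P: "subgroup P S" using mor_fusion_iso(1)[OF \<phi>(1)] by (simp add: P_def)
  interpret P: subgroup P S by fact
  interpret A: group "Aut_fusion F P" by (rule Aut_fusion_simps(5)[OF P])
  note A = Aut_fusion_simps[OF P]
  have \<phi>P: "\<phi> x \<in> P" if "x \<in> M" for x using that by (simp add: P_def)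
  have EP: "E \<subseteq> P" using less.prems(2) by (auto simp: E_def P_def)
  have normE: "normalized_by P E"
    unfolding normalized_by_def
  proof (intro ballI)
    fix g e assume "g \<in> P" "e \<in> E"
    then obtain m b where m: "m \<in> M" "g = \<phi> m" "b \<in> B" "e = \<phi> b" by (auto simp: P_def E_def)
    have "\<phi> (m \<otimes> b \<otimes> inv m) = g \<otimes> e \<otimes> inv g" using mor_conjugate[OF \<phi>(1) m(1)] m less.prems(2) by auto
    then show "g \<otimes> e \<otimes> inv g \<in> E"
      using normalized_byD[OF less.prems(3) m(1,3)] unfolding E_def by (metis imageI)
  qed
  let ?L = "times_centralizer P E"
  have ES: "E \<subseteq> carrier S" using EP P.subset by auto
  have L: "subgroup ?L S" using subgroup_times_centralizer[OF P ES normE] .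
  have PL: "P \<subseteq> ?L" using subset_times_centralizer[OF P] .
  have inj: "inj_on \<phi> M" using mor_injective_hom(1)[OF \<phi>(1)] .
  have "subgroup B S" using B by (simp add: receptive_def)
  have EM: "mor E (inv_into M \<phi>)" "subgroup E S"
  proof -
    show "subgroup E S"
      using mor_fusion_iso(1)[OF mor_restrict[OF \<phi>(1) \<open>subgroup B S\<close> less.prems(2)]] by (simp add: E_def)
    then show "mor E (inv_into M \<phi>)"
      using mor_restrict[OF mor_inv_into[OF \<phi>(1)]] EP by (simp add: P_def)
  qed
  have inv\<phi>: "inv_into M \<phi> (\<phi> x) = x" if "x \<in> M" for x using inj that by simp
  have "\<exists>\<psi>. mor ?L \<psi> \<and> (\<forall>x\<in>E. \<psi> x = inv_into M \<phi> x)"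
  proof (rule receptiveD[OF B EM(1) _ L])
    show "inv_into M \<phi> ` E = B" using inv\<phi> less.prems(2) unfolding E_def by force
    show "E \<subseteq> ?L" using EP PL by auto
    show "normalized_by ?L E" using normalized_by_times_centralizer[OF normE] .
    fix g assume "g \<in> ?L"
    then obtain y where y: "y \<in> P" "\<And>e. e \<in> E \<Longrightarrow> g \<otimes> e \<otimes> inv g = y \<otimes> e \<otimes> inv y"
      by (auto simp: times_centralizer_def)
    obtain m where m: "m \<in> M" "y = \<phi> m" using y(1) by (auto simp: P_def)
    have "inv_into M \<phi> (g \<otimes> e \<otimes> inv g) = m \<otimes> inv_into M \<phi> e \<otimes> inv m" if e: "e \<in> E" for e
    proof -
      obtain b where b: "b \<in> B" "e = \<phi> b" using e by (auto simp: E_def)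
      have bM: "b \<in> M" using b less.prems(2) by auto
      have "g \<otimes> e \<otimes> inv g = \<phi> (m \<otimes> b \<otimes> inv m)"
        using y(2)[OF e] m(2) b(2) mor_conjugate[OF \<phi>(1) m(1) bM] by simp
      then show ?thesis using inv\<phi> b(2) m(1) bM by simp
    qed
    then show "\<exists>h\<in>carrier S. \<forall>x\<in>E. inv_into M \<phi> (g \<otimes> x \<otimes> inv g) = h \<otimes> inv_into M \<phi> x \<otimes> inv h"
      using M.mem_carrier[OF m(1)] by blast
  qed
  then obtain \<psi> where \<psi>: "mor ?L \<psi>" "\<And>e. e \<in> E \<Longrightarrow> \<psi> e = inv_into M \<phi> e" by blast
  have \<psi>B: "\<psi> (\<phi> b) = b" if b: "b \<in> B" for b
    using \<psi>(2)[of "\<phi> b"] inv\<phi>[of b] b less.prems(2) by (auto simp: E_def)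
  note \<psi> = \<psi>(1)
  have \<psi>P: "mor P \<psi>" using mor_restrict[OF \<psi> P PL] .
  have inj\<psi>: "inj_on \<psi> P" using mor_injective_hom(1)[OF \<psi>P] .
  define M3 where "M3 = \<psi> ` P"
  have M3: "subgroup M3 S" using mor_fusion_iso(1)[OF \<psi>P] by (simp add: M3_def)
  have BM3: "B \<subseteq> M3" using \<psi>B \<phi>P less.prems(2) unfolding M3_def by force
  have normM3: "normalized_by M3 B"
    unfolding normalized_by_def
  proof (intro ballI)
    fix g b assume "g \<in> M3" and b: "b \<in> B"
    then obtain y where y: "y \<in> P" "g = \<psi> y" by (auto simp: M3_def)
    have e: "\<phi> b \<in> E" using b by (simp add: E_def)
    have "\<psi> (y \<otimes> \<phi> b \<otimes> inv y) = g \<otimes> b \<otimes> inv g"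
      using mor_conjugate[OF \<psi>P y(1), of "\<phi> b"] e EP y(2) \<psi>B[OF b] by auto
    moreover obtain c where "c \<in> B" "y \<otimes> \<phi> b \<otimes> inv y = \<phi> c"
      using normalized_byD[OF normE y(1) e] by (auto simp: E_def)
    ultimately show "g \<otimes> b \<otimes> inv g \<in> B" using \<psi>B by metis
  qed
  have inv\<psi>: "inv_into P \<psi> (\<psi> y) = y" if "y \<in> P" for y using inj\<psi> that by simp
  have im\<psi>: "inv_into P \<psi> ` M3 = P" using inv\<psi> unfolding M3_def by (simp add: image_image)
  have good_aut: "good M3 \<beta>" if \<beta>: "mor M3 \<beta>" "\<beta> ` M3 = M3" "\<And>b. b \<in> B \<Longrightarrow> \<beta> b = b" for \<beta>
  proof -
    let ?c = "\<lambda>z y. \<psi> (z (inv_into P \<psi> y))"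
    have goodM3: "good M3 \<xi>" if "good M3 \<zeta>" "\<And>x. x \<in> P \<Longrightarrow> \<zeta> (\<psi> x) = \<xi> (\<psi> x)" for \<zeta> \<xi>
      using good(1)[OF that(1)] that(2) by (auto simp: M3_def)
    have img: "?c z ` M3 = M3" if "z \<in> F P P" for z
    proof -
      have "z ` P = P" using that A(4) by blast
      have "?c z ` M3 = \<psi> ` z ` inv_into P \<psi> ` M3" by (simp add: image_image)
      then show ?thesis unfolding im\<psi> \<open>z ` P = P\<close> by (simp add: M3_def)
    qed
    define H where "H = {z \<in> F P P. good M3 (?c z)}"
    have H: "subgroup H (Aut_fusion F P)"
    proof (rule A.subgroupI)
      show "H \<subseteq> carrier (Aut_fusion F P)" using A(1) by (auto simp: H_def)
      have "good M3 (\<lambda>x. \<one> \<otimes> x \<otimes> inv \<one>)" using good(5)[OF M3, of \<one>] by simp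
      then have "good M3 (?c \<one>\<^bsub>?A\<^esub>)"
        by (rule goodM3) (use inv\<psi> mor_injective_hom(2)[OF \<psi>P] A(2) in simp)
      then have "\<one>\<^bsub>?A\<^esub> \<in> H" using A.one_closed A(1) by (simp add: H_def)
      then show "H \<noteq> {}" by blast
      show "inv\<^bsub>?A\<^esub> z \<in> H" if z: "z \<in> H" for z
      proof -
        have zF: "z \<in> F P P" "good M3 (?c z)" using z by (auto simp: H_def)
        have zP: "z ` P = P" "inj_on z P" using zF A(4) mor_injective_hom(1) by blast+
        have injc: "inj_on (?c z) M3"
        proof (rule inj_onI)
          fix u v assume "u \<in> M3" "v \<in> M3" and eq: "?c z u = ?c z v"
          then obtain x y where xy: "x \<in> P" "y \<in> P" "u = \<psi> x" "v = \<psi> y" by (auto simp: M3_def)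
          then have "z x \<in> P" "z y \<in> P" using zP by auto
          then have "z x = z y" using eq xy inv\<psi> inj_onD[OF inj\<psi>] by auto
          then show "u = v" using inj_onD[OF zP(2)] xy by auto
        qed
        have "good M3 (inv_into M3 (?c z))" using good(3)[OF zF(2) injc] img[OF zF(1)] by simp
        then have "good M3 (?c (inv\<^bsub>?A\<^esub> z))"
        proof (rule goodM3)
          fix x assume x: "x \<in> P"
          then obtain y where y: "y \<in> P" "x = z y" using zP by auto
          have "\<psi> x = ?c z (\<psi> y)" using y inv\<psi> by simp
          then have "inv_into M3 (?c z) (\<psi> x) = \<psi> y"
            using inv_into_f_f[OF injc, of "\<psi> y"] y by (simp add: M3_def)
          then show "inv_into M3 (?c z) (\<psi> x) = ?c (inv\<^bsub>?A\<^esub> z) (\<psi> x)"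
            using inv\<psi>[OF x] Aut_fusion_inv(1)[OF P zF(1) y(1)] y by simp
        qed
        then show ?thesis using Aut_fusion_inv(2)[OF P zF(1)] by (simp add: H_def)
      qed
      show "y \<otimes>\<^bsub>?A\<^esub> z \<in> H" if yz: "y \<in> H" "z \<in> H" for y z
      proof -
        have F: "y \<in> F P P" "z \<in> F P P" "good M3 (?c y)" "good M3 (?c z)" using yz by (auto simp: H_def)
        have "good M3 (\<lambda>x. ?c y (?c z x))"
          using good(2)[OF F(4), of "?c y"] F(3) img[OF F(2)] by simp
        then have "good M3 (?c (y \<otimes>\<^bsub>?A\<^esub> z))"
        proof (rule goodM3)
          fix x assume x: "x \<in> P"
          have "z x \<in> P" using F(2) A(4) x by blast
          then show "?c y (?c z (\<psi> x)) = ?c (y \<otimes>\<^bsub>?A\<^esub> z) (\<psi> x)"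
            using x F(1,2) inv\<psi> A(3)[OF F(1,2)] by (simp add: compose_eq)
        qed
        then show ?thesis using A.m_closed[of y z] F(1,2) A(1) by (simp add: H_def)
      qed
    qed
    have "Z \<subseteq> H"
    proof (rule A.sylow_and_p'_elements_exhaust[OF A(6) prime_p Zsub H W(1)])
      show "W \<subseteq> H"
      proof
        fix w assume w: "w \<in> W"
        have wZ: "w \<in> Z" using A.sylow_subgroupD(2)[OF Zsub W(1)] w by auto
        obtain h where h: "h \<in> carrier S" "w = conj_map S h P" using W(2) w by (auto simp: Hom_conj_def)
        \<comment> \<open>conjugation by h on P fixes the image E of B, so h lies in the domain of the extension of the inverse isomorphism\<close>
        have "h \<otimes> e \<otimes> inv h = \<one> \<otimes> e \<otimes> inv \<one>" if e: "e \<in> E" for e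
        proof -
          have "w e = e" using wZ e by (auto simp: Z_def E_def)
          moreover have "e \<in> P" "e \<in> carrier S" using e EP ES by auto
          ultimately show ?thesis using h(2) by (simp add: conj_map_def)
        qed
        then have hL: "h \<in> ?L" using h(1) P.one_closed unfolding times_centralizer_def by blast
        have "good M3 (\<lambda>x. \<psi> h \<otimes> x \<otimes> inv (\<psi> h))"
          using good(5)[OF M3] mor_injective_hom(2)[OF \<psi> hL] by simp
        then have "good M3 (?c w)"
        proof (rule goodM3)
          fix x assume x: "x \<in> P"
          then have "\<psi> (h \<otimes> x \<otimes> inv h) = \<psi> h \<otimes> \<psi> x \<otimes> inv (\<psi> h)"
            using mor_conjugate[OF \<psi> hL] PL by auto
          then show "\<psi> h \<otimes> \<psi> x \<otimes> inv (\<psi> h) = ?c w (\<psi> x)"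
            using inv\<psi>[OF x] x by (simp add: h(2) conj_map_def)
        qed
        then show "w \<in> H" using wZ by (simp add: H_def Z_def)
      qed
      fix z n assume z: "z \<in> Z" and n: "coprime (n::nat) p" "z [^]\<^bsub>?A\<^esub> n = \<one>\<^bsub>?A\<^esub>"
      have zF: "z \<in> F P P" using z by (simp add: Z_def)
      have zm: "mor P z" "z ` P = P" using zF A(4) by auto
      have "p'_automorphism P z" using p'_automorphism_iff_Aut_fusion[OF P zF] n by blast
      then have "p'_automorphism M3 (?c z)"
        by (rule p'_automorphism_conj[OF P])
          (use inj\<psi> mor_injective_hom(3)[OF \<psi>P] in \<open>auto simp: bij_betw_def M3_def\<close>)
      moreover have "mor M3 (?c z)"
      proof -
        have 1: "mor M3 (inv_into P \<psi>)" using mor_inv_into[OF \<psi>P] by (simp add: M3_def)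
        have 2: "mor M3 (\<lambda>y. z (inv_into P \<psi> y))" using mor_comp[OF 1] im\<psi> zm by simp
        have "(\<lambda>y. z (inv_into P \<psi> y)) ` M3 = z ` inv_into P \<psi> ` M3" by (simp add: image_image)
        then have "(\<lambda>y. z (inv_into P \<psi> y)) ` M3 = P" unfolding im\<psi> zm(2) .
        then show ?thesis using mor_comp[OF 2] \<psi>P by simp
      qed
      moreover have "?c z b = b" if b: "b \<in> B" for b
      proof -
        have "\<phi> b \<in> P" using b less.prems(2) \<phi>P by auto
        then show ?thesis using inv\<psi>[of "\<phi> b"] \<psi>B[OF b] z b by (simp add: Z_def)
      qed
      ultimately have "good M3 (?c z)" using p'[of M3 "?c z"] img[OF zF] BM3 normM3 by blast
      then show "z \<in> H" using zF by (simp add: H_def)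
    qed
    define z where "z = (\<lambda>y\<in>P. inv_into P \<psi> (\<beta> (\<psi> y)))"
    have \<beta>M3: "\<beta> (\<psi> y) \<in> M3" if "y \<in> P" for y using \<beta>(2) that by (auto simp: M3_def)
    have \<psi>z: "\<psi> (z y) = \<beta> (\<psi> y)" if "y \<in> P" for y
      using \<beta>M3[OF that] that by (simp add: z_def M3_def f_inv_into_f)
    have "z \<in> F P P"
      unfolding A(4)
    proof (intro conjI)
      show "z \<in> extensional P" by (simp add: z_def)
      have 1: "mor P (\<lambda>y. \<beta> (\<psi> y))" using mor_comp[OF \<psi>P] \<beta>(1) by (simp add: M3_def)
      have "(\<lambda>y. \<beta> (\<psi> y)) ` P = \<beta> ` M3" by (simp add: M3_def image_image)
      then have im1: "(\<lambda>y. \<beta> (\<psi> y)) ` P = M3" using \<beta>(2) by simp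
      have 2: "mor M3 (inv_into P \<psi>)" using mor_inv_into[OF \<psi>P] by (simp add: M3_def)
      have "mor P (\<lambda>y. inv_into P \<psi> (\<beta> (\<psi> y)))" using mor_comp[OF 1] 2 im1 by simp
      then show "mor P z" using mor_cong[of P z "\<lambda>y. inv_into P \<psi> (\<beta> (\<psi> y))"] by (simp add: z_def)
      have "z ` P = inv_into P \<psi> ` (\<lambda>y. \<beta> (\<psi> y)) ` P" by (auto simp: z_def)
      also have "\<dots> = P" unfolding im1 im\<psi> ..
      finally show "z ` P = P" .
    qed
    moreover have "z (\<phi> b) = \<phi> b" if b: "b \<in> B" for b
    proof -
      have "\<phi> b \<in> P" using b less.prems(2) \<phi>P by auto
      then show ?thesis using inv\<psi>[of "\<phi> b"] \<psi>B[OF b] \<beta>(3)[OF b] by (simp add: z_def)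
    qed
    ultimately have "z \<in> H" using \<open>Z \<subseteq> H\<close> by (auto simp: Z_def)
    then have "good M3 (?c z)" by (simp add: H_def)
    then show "good M3 \<beta>" by (rule goodM3) (use inv\<psi> \<psi>z in simp)
  qed
  have extension: "\<exists>\<delta>'. mor Q \<delta>' \<and> \<delta>' ` Q = M3 \<and> (\<forall>b\<in>B. \<delta>' b = b) \<and> good Q \<delta>'"
    if Q: "B \<subseteq> Q" "normalized_by Q B" "Q \<noteq> times_centralizer Q B" "card Q = card M"
      and \<eta>: "mor Q \<eta>" "\<eta> ` Q = P" "\<And>b. b \<in> B \<Longrightarrow> \<eta> b = \<phi> b" for Q \<eta>
  proof -
    have QS: "subgroup Q S" using \<eta>(1) by (rule mor_subgroup)
    interpret Q: subgroup Q S by fact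
    let ?K = "times_centralizer Q B"
    have K: "subgroup ?K S" using subgroup_times_centralizer[OF QS BS Q(2)] .
    define N where "N = {g \<in> ?K. normalized_by {g} Q}"
    have N: "subgroup N S" using subgroup_normalizing[OF K QS] by (simp add: N_def)
    have QN: "Q \<subseteq> N"
      using subset_times_centralizer[OF QS] by (auto simp: N_def normalized_by_def)
    have NQ: "normalized_by N Q" by (auto simp: N_def normalized_by_def)
    have NB: "normalized_by N B"
      using normalized_by_times_centralizer[OF Q(2)] by (auto simp: N_def normalized_by_def)
    have "Q \<subset> ?K" using subset_times_centralizer[OF QS] Q(3) by blast
    then obtain g where "g \<in> ?K - Q" "\<forall>x\<in>Q. g \<otimes> x \<otimes> inv g \<in> Q"
      using normalizers_grow[OF QS K] by blast
    then have "g \<in> N - Q" by (auto simp: N_def normalized_by_def)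
    then have card: "card Q < card N" using psubset_card_mono[OF finite_subgroup[OF N]] QN by blast
    define V where "V = N \<inter> {g \<in> carrier S. \<forall>b\<in>B. g \<otimes> b = b \<otimes> g}"
    have V: "subgroup V S" unfolding V_def using subgroups_Inter_pair[OF N subgroup_commuting[OF BS]] .
    have VQ: "normalized_by V Q" using NQ by (auto simp: V_def normalized_by_def)
    have "\<exists>\<kappa>\<in>Z. \<exists>\<xi>. mor N \<xi> \<and> (\<forall>x\<in>Q. \<xi> x = \<kappa> (\<eta> x))"
    proof (rule extend_up_to_automorphism[OF \<phi>(2) Zsub W \<eta>(1,2) V VQ _ N QN NQ])
      fix g assume g: "g \<in> V"
      have gS: "g \<in> carrier S" using g by (simp add: V_def)
      have \<eta>inv: "inv_into Q \<eta> (\<eta> x) = x" if "x \<in> Q" for x using mor_injective_hom(1)[OF \<eta>(1)] that by simp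
      let ?f = "\<lambda>y\<in>P. \<eta> (g \<otimes> inv_into Q \<eta> y \<otimes> inv g)"
      have "normalized_by {g} Q" using VQ g by (simp add: normalized_by_def)
      then have "?f \<in> F P P" using transported_conj_in_Aut_fusion[OF \<eta>(1,2) gS] by blast
      moreover have "?f (\<phi> b) = \<phi> b" if b: "b \<in> B" for b
      proof -
        have bQ: "b \<in> Q" "\<phi> b \<in> P" "b \<in> carrier S" using b Q(1) \<phi>P less.prems(2) BS by auto
        have "g \<otimes> b = b \<otimes> g" using g b by (simp add: V_def)
        then have "g \<otimes> b \<otimes> inv g = b" using bQ gS by (simp add: m_assoc)
        then show ?thesis using bQ \<eta>inv[OF bQ(1)] \<eta>(3)[OF b] by simp
      qed
      ultimately show "?f \<in> Z" by (simp add: Z_def)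
    next
      fix g assume g: "g \<in> N"
      obtain m where m: "m \<in> Q" "inv m \<otimes> g \<in> carrier S" "g = m \<otimes> (inv m \<otimes> g)"
          "\<And>b. b \<in> B \<Longrightarrow> (inv m \<otimes> g) \<otimes> b \<otimes> inv (inv m \<otimes> g) = b"
        using times_centralizer_decompose[OF QS BS, of g] g by (auto simp: N_def)
      have "inv m \<otimes> g \<in> N"
        using subgroup.m_closed[OF N subgroup.m_inv_closed[OF N]] m(1) QN g by blast
      moreover have "(inv m \<otimes> g) \<otimes> b = b \<otimes> (inv m \<otimes> g)" if b: "b \<in> B" for b
      proof -
        have bS: "b \<in> carrier S" using b BS by auto
        have "(inv m \<otimes> g) \<otimes> b = ((inv m \<otimes> g) \<otimes> b \<otimes> inv (inv m \<otimes> g)) \<otimes> (inv m \<otimes> g)"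
          using m(2) bS by (simp add: m_assoc del: inv_mult_group)
        then show ?thesis unfolding m(4)[OF b] .
      qed
      ultimately have "inv m \<otimes> g \<in> V" using m(2) by (simp add: V_def)
      then show "\<exists>m\<in>Q. \<exists>v\<in>V. g = m \<otimes> v" using m(1,3) by blast
    qed
    then obtain \<kappa> \<xi> where \<kappa>: "\<kappa> \<in> Z" and \<xi>: "mor N \<xi>" "\<And>x. x \<in> Q \<Longrightarrow> \<xi> x = \<kappa> (\<eta> x)"
      by blast
    have \<kappa>P: "\<kappa> ` P = P" "\<And>b. b \<in> B \<Longrightarrow> \<kappa> (\<phi> b) = \<phi> b" using \<kappa> A(4) by (auto simp: Z_def)
    have "\<xi> ` Q = \<kappa> ` \<eta> ` Q" using \<xi>(2) by (simp add: image_image)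
    then have \<xi>Q: "\<xi> ` Q = P" unfolding \<eta>(2) \<kappa>P(1) .
    have \<xi>B: "\<xi> b = \<phi> b" if "b \<in> B" for b using \<xi>(2)[of b] \<eta>(3) \<kappa>P(2) that Q(1) by auto
    \<comment> \<open>N acts on B as Q does, so its image acts on E as P does\<close>
    have "\<xi> ` N \<subseteq> ?L"
    proof (rule image_subsetI)
      fix g assume g: "g \<in> N"
      obtain m where m: "m \<in> Q" "\<And>b. b \<in> B \<Longrightarrow> g \<otimes> b \<otimes> inv g = m \<otimes> b \<otimes> inv m"
        using g by (auto simp: N_def times_centralizer_def)
      have "\<xi> g \<otimes> e \<otimes> inv (\<xi> g) = \<xi> m \<otimes> e \<otimes> inv (\<xi> m)" if "e \<in> E" for e
      proof -
        obtain b where b: "b \<in> B" "e = \<xi> b" using \<open>e \<in> E\<close> \<xi>B by (auto simp: E_def)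
        have "b \<in> N" "m \<in> N" using b Q(1) QN m(1) by auto
        then show ?thesis
          using mor_conjugate[OF \<xi>(1) g, of b] mor_conjugate[OF \<xi>(1), of m b] m(2)[OF b(1)] b(2) by simp
      qed
      moreover have "\<xi> m \<in> P" using \<xi>Q m(1) by auto
      ultimately show "\<xi> g \<in> ?L"
        using mor_injective_hom(2)[OF \<xi>(1) g] unfolding times_centralizer_def by blast
    qed
    then have ext: "mor N (\<lambda>x. \<psi> (\<xi> x))"
      using mor_comp[OF \<xi>(1)] mor_restrict[OF \<psi> mor_fusion_iso(1)[OF \<xi>(1)]] by blast
    have fixB: "\<psi> (\<xi> b) = b" if "b \<in> B" for b using \<xi>B \<psi>B that by simp
    have "good N (\<lambda>x. \<psi> (\<xi> x))"
      by (rule IH[OF ext]) (use card Q(4) Q(1) QN NB fixB in auto)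
    then have "good Q (\<lambda>x. \<psi> (\<xi> x))" using good(4) QS QN by blast
    moreover have "(\<lambda>x. \<psi> (\<xi> x)) ` Q = M3" unfolding M3_def \<xi>Q[symmetric] by (simp add: image_image)
    ultimately show ?thesis using mor_restrict[OF ext QS QN] fixB by blast
  qed
  have image_in: "\<eta> ` M \<subseteq> times_centralizer M B" if \<eta>: "mor M \<eta>" "\<And>b. b \<in> B \<Longrightarrow> \<eta> b = b" for \<eta>
  proof (rule image_subsetI)
    fix x assume x: "x \<in> M"
    have "\<eta> x \<otimes> b \<otimes> inv (\<eta> x) = x \<otimes> b \<otimes> inv x" if b: "b \<in> B" for b
      using mor_conjugate[OF \<eta>(1) x, of b] \<eta>(2)[OF b] \<eta>(2)[OF normalized_byD[OF less.prems(3) x b]]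
        b less.prems(2) by auto
    then show "\<eta> x \<in> times_centralizer M B"
      using mor_injective_hom(2)[OF \<eta>(1) x] x unfolding times_centralizer_def by blast
  qed
  have card_image': "card (\<eta> ` M) = card M" if "mor M \<eta>" for \<eta>
    using card_image[OF mor_injective_hom(1)[OF that]] .
  show "good M \<delta>"
  proof (cases "M = times_centralizer M B")
    case True
    have onto: "\<eta> ` M = M" if "mor M \<eta>" "\<And>b. b \<in> B \<Longrightarrow> \<eta> b = b" for \<eta>
      using image_in[OF that] True card_image'[OF that(1)] finite_subgroup[OF M] by (intro card_seteq) auto
    have "mor M (\<lambda>x. \<psi> (\<phi> x))" using mor_comp[OF \<phi>(1)] \<psi>P by (simp add: P_def)
    then have "(\<lambda>x. \<psi> (\<phi> x)) ` M = M" using onto \<psi>B by blast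
    then have "M3 = M" by (simp add: M3_def P_def image_image)
    then show ?thesis using good_aut[of \<delta>] onto[OF less.prems(1,4)] less.prems(1,4) by simp
  next
    case False
    define M2 where "M2 = \<delta> ` M"
    note d = less.prems
    obtain \<delta>1 where d1: "mor M \<delta>1" "\<delta>1 ` M = M3" "\<And>b. b \<in> B \<Longrightarrow> \<delta>1 b = b" "good M \<delta>1"
      using extension[OF d(2,3) False _ \<phi>(1)] by (auto simp: P_def)
    have dM2: "mor M2 (inv_into M \<delta>)" using mor_inv_into[OF d(1)] by (simp add: M2_def)
    have inv\<delta>: "inv_into M \<delta> (\<delta> x) = x" if "x \<in> M" for x using mor_injective_hom(1)[OF d(1)] that by simp
    have M2: "subgroup M2 S" using mor_fusion_iso(1)[OF d(1)] by (simp add: M2_def)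
    have BM2: "B \<subseteq> M2" using d(2,4) unfolding M2_def by force
    have conj2: "\<delta> x \<otimes> b \<otimes> inv (\<delta> x) = x \<otimes> b \<otimes> inv x" if "x \<in> M" "b \<in> B" for x b
      using mor_conjugate[OF d(1) that(1), of b] d(4)[OF that(2)] d(4)[OF normalized_byD[OF d(3) that]]
        that d(2) by auto
    have normM2: "normalized_by M2 B"
      using normalized_byD[OF d(3)] conj2 by (auto simp: M2_def normalized_by_def)
    have "times_centralizer M2 B = times_centralizer M B"
      using conj2 by (auto simp: times_centralizer_def M2_def)
    moreover have "card M2 = card M" using card_image'[OF d(1)] by (simp add: M2_def)
    moreover have "card M < card (times_centralizer M B)"
      using psubset_card_mono[OF finite_subgroup[OF subgroup_times_centralizer[OF M BS d(3)]]]
        subset_times_centralizer[OF M] False by blast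
    ultimately have ne: "M2 \<noteq> times_centralizer M2 B" and c2: "card M2 = card M" by auto
    have im: "inv_into M \<delta> ` M2 = M" using inv\<delta> by (simp add: M2_def image_image)
    have \<eta>2: "mor M2 (\<lambda>x. \<phi> (inv_into M \<delta> x))" using mor_comp[OF dM2] \<phi>(1) im by simp
    have "(\<lambda>x. \<phi> (inv_into M \<delta> x)) ` M2 = \<phi> ` inv_into M \<delta> ` M2" by (simp add: image_image)
    then have \<eta>2P: "(\<lambda>x. \<phi> (inv_into M \<delta> x)) ` M2 = P" unfolding im by (simp add: P_def)
    have \<eta>2B: "\<phi> (inv_into M \<delta> b) = \<phi> b" if "b \<in> B" for b
      using inv\<delta>[of b] d(2,4) that by auto
    obtain \<delta>2 where d2: "mor M2 \<delta>2" "\<delta>2 ` M2 = M3" "\<And>b. b \<in> B \<Longrightarrow> \<delta>2 b = b" "good M2 \<delta>2"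
      using extension[OF BM2 normM2 ne c2 \<eta>2 \<eta>2P \<eta>2B] by auto
    have inv1: "inv_into M \<delta>1 (\<delta>1 x) = x" if "x \<in> M" for x using mor_injective_hom(1)[OF d1(1)] that by simp
    \<comment> \<open>the automorphism of M3 through which the given morphism differs from two good ones\<close>
    let ?\<beta> = "\<lambda>y. \<delta>2 (\<delta> (inv_into M \<delta>1 y))"
    have "good M3 ?\<beta>"
    proof (rule good_aut)
      have 1: "mor M3 (inv_into M \<delta>1)" using mor_inv_into[OF d1(1)] d1(2) by simp
      have im1: "inv_into M \<delta>1 ` M3 = M" using inv1 by (simp add: image_image flip: d1(2))
      have 2: "mor M3 (\<lambda>y. \<delta> (inv_into M \<delta>1 y))" using mor_comp[OF 1] d(1) im1 by simp
      have "(\<lambda>y. \<delta> (inv_into M \<delta>1 y)) ` M3 = \<delta> ` inv_into M \<delta>1 ` M3" by (simp add: image_image)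
      then have im2: "(\<lambda>y. \<delta> (inv_into M \<delta>1 y)) ` M3 = M2" unfolding im1 by (simp add: M2_def)
      show "mor M3 ?\<beta>" using mor_comp[OF 2] d2(1) im2 by simp
      have "?\<beta> ` M3 = \<delta>2 ` (\<lambda>y. \<delta> (inv_into M \<delta>1 y)) ` M3" by (simp add: image_image)
      then show "?\<beta> ` M3 = M3" unfolding im2 d2(2) .
      show "?\<beta> b = b" if "b \<in> B" for b
        using inv1[of b] d(2,4) d1(3) d2(3) that by auto
    qed
    moreover have im\<beta>: "(\<lambda>x. ?\<beta> (\<delta>1 x)) ` M = M3"
    proof -
      have "(\<lambda>x. ?\<beta> (\<delta>1 x)) ` M = (\<lambda>x. \<delta>2 (\<delta> x)) ` M" using inv1 by simp
      also have "\<dots> = \<delta>2 ` \<delta> ` M" by (simp add: image_image)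
      finally show ?thesis using d2(2) by (simp add: M2_def)
    qed
    ultimately have "good M (\<lambda>x. ?\<beta> (\<delta>1 x))" using good(2)[OF d1(4)] d1(2) by simp
    moreover have "good M3 (inv_into M2 \<delta>2)"
      using good(3)[OF d2(4) mor_injective_hom(1)[OF d2(1)]] d2(2) by simp
    ultimately have "good M (\<lambda>x. inv_into M2 \<delta>2 (?\<beta> (\<delta>1 x)))"
      using good(2)[of M "\<lambda>x. ?\<beta> (\<delta>1 x)" "inv_into M2 \<delta>2"] im\<beta> by simp
    then show ?thesis
      by (rule good(1)) (use inv1 mor_injective_hom(1)[OF d2(1)] in \<open>simp add: M2_def\<close>)
  qed
qed

end

section \<open>The hyperfocal subgroup\<close>

context finite_p_group
begin

text \<open>The normalizer $N_S(M)$; since $S$ is finite, mapping $M$ into itself suffices.\<close>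

definition normalizing :: "'a set \<Rightarrow> 'a set"
  where "normalizing M = {g \<in> carrier S. normalized_by {g} M}"

lemma normalizing_simps:
  assumes M: "subgroup M S"
  shows "subgroup (normalizing M) S" "M \<subseteq> normalizing M" "normalized_by (normalizing M) M"
    "g \<in> carrier S \<Longrightarrow> (\<And>x. x \<in> M \<Longrightarrow> g \<otimes> x \<otimes> inv g \<in> M) \<Longrightarrow> g \<in> normalizing M"
proof -
  interpret M: subgroup M S by fact
  show "subgroup (normalizing M) S"
    using subgroup_normalizing[OF subgroup_self M] by (simp add: normalizing_def)
qed (use subgroup.subset[OF M] M in \<open>auto simp: normalizing_def normalized_by_def subgroup_def\<close>)

lemma normalized_by_subset_normalizing:
  "X \<subseteq> carrier S \<Longrightarrow> normalized_by X M \<Longrightarrow> X \<subseteq> normalizing M"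
  by (auto simp: normalizing_def normalized_by_def)

lemma small_abelian_test_subgroup:
  assumes "small_abelian A"
  shows "test_subgroup S p A"
proof -
  have A: "subgroup A S" "\<And>x y. x \<in> A \<Longrightarrow> y \<in> A \<Longrightarrow> x \<otimes> y = y \<otimes> x"
      "\<And>x. x \<in> A \<Longrightarrow> x [^] (if p = 2 then 4 else p) = \<one>"
    using assms by (auto simp: small_abelian_def)
  interpret A: group "S\<lparr>carrier := A\<rparr>" by (rule subgroup_group[OF A(1)])
  have comm: "comm_group (S\<lparr>carrier := A\<rparr>)"
    by (rule A.group_comm_groupI) (use A(2) in simp)
  have pow: "x [^]\<^bsub>S\<lparr>carrier := A\<rparr>\<^esub> (if p = 2 then 4 else p) = \<one>" if "x \<in> A" for x
    using A(3)[OF that] nat_pow_consistent by simp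
  show ?thesis
  proof (cases "p = 2")
    case True
    have "group_exponent (S\<lparr>carrier := A\<rparr>) \<le> 4"
      unfolding group_exponent_def by (rule Least_le) (use pow True in auto)
    then show ?thesis using True A(1) comm by (simp add: test_subgroup_def)
  next
    case False
    then show ?thesis using A(1) comm pow by (simp add: test_subgroup_def elementary_abelian_def)
  qed
qed

end

context fusion_system
begin

lemma small_abelian_image:
  assumes A: "small_abelian A" and \<phi>: "mor A \<phi>"
  shows "small_abelian (\<phi> ` A)"
proof -
  note h = mor_injective_hom[OF \<phi>]
  interpret A: subgroup A S using A by (simp add: small_abelian_def)
  have "\<phi> (x [^] n) = \<phi> x [^] n \<and> x [^] n \<in> A" if "x \<in> A" for x and n :: nat
    by (induction n) (use that h in auto)
  then have "\<phi> x [^] (if p = 2 then 4 else p) = \<one>" if "x \<in> A" for x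
    using that A h(5) unfolding small_abelian_def by metis
  moreover have "\<phi> x \<otimes> \<phi> y = \<phi> y \<otimes> \<phi> x" if "x \<in> A" "y \<in> A" for x y
    using that A h(3) unfolding small_abelian_def by metis
  ultimately show ?thesis using mor_fusion_iso(1)[OF \<phi>] by (auto simp: small_abelian_def)
qed

lemma normalized_by_image:
  assumes \<psi>: "mor N \<psi>" and "M \<subseteq> N" "normalized_by N M"
  shows "normalized_by (\<psi> ` N) (\<psi> ` M)"
  unfolding normalized_by_def
proof (intro ballI)
  fix g x assume "g \<in> \<psi> ` N" "x \<in> \<psi> ` M"
  then obtain h y where h: "h \<in> N" "g = \<psi> h" "y \<in> M" "x = \<psi> y" by auto
  then have "\<psi> (h \<otimes> y \<otimes> inv h) = g \<otimes> x \<otimes> inv g" using mor_conjugate[OF \<psi> h(1)] assms(2) by auto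
  then show "g \<otimes> x \<otimes> inv g \<in> \<psi> ` M" using normalized_byD[OF assms(3) h(1,3)] by (metis imageI)
qed

lemma exists_extension_to_normalizer:
  assumes P: "automized P" "receptive P" and \<eta>: "mor M \<eta>" "\<eta> ` M = P"
  shows "\<exists>\<psi>. mor (normalizing M) \<psi> \<and> \<psi> ` M = P"
proof -
  have M: "subgroup M S" and PS: "subgroup P S"
    using mor_subgroup[OF \<eta>(1)] P(1) by (auto simp: automized_def)
  note N = normalizing_simps[OF M]
  interpret A: group "Aut_fusion F P" by (rule Aut_fusion_simps(5)[OF PS])
  have W: "sylow_subgroup p ((Aut_fusion F P)\<lparr>carrier := carrier (Aut_fusion F P)\<rparr>) (Hom_conj S P P)"
    using P(1) by (simp add: automized_def)
  have "\<exists>\<kappa>\<in>carrier (Aut_fusion F P). \<exists>\<psi>. mor (normalizing M) \<psi> \<and> (\<forall>x\<in>M. \<psi> x = \<kappa> (\<eta> x))"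
  proof (rule extend_up_to_automorphism[OF P(2) A.subgroup_self W subset_refl \<eta> N(1,3) _ N(1,2,3)])
    fix g assume g: "g \<in> normalizing M"
    then show "(\<lambda>y\<in>P. \<eta> (g \<otimes> inv_into M \<eta> y \<otimes> inv g)) \<in> carrier (Aut_fusion F P)"
      using transported_conj_in_Aut_fusion[OF \<eta>, of g] Aut_fusion_simps(1)[OF PS] by (simp add: normalizing_def)
    show "\<exists>m\<in>M. \<exists>v\<in>normalizing M. g = m \<otimes> v"
      using g subgroup.one_closed[OF M] by (intro bexI[of _ \<one>] bexI[of _ g]) (auto simp: normalizing_def)
  qed
  then obtain \<kappa> \<psi> where \<psi>: "\<kappa> \<in> F P P" "mor (normalizing M) \<psi>" "\<And>x. x \<in> M \<Longrightarrow> \<psi> x = \<kappa> (\<eta> x)"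
    unfolding Aut_fusion_simps(1)[OF PS] by blast
  have "\<psi> ` M = \<kappa> ` \<eta> ` M" using \<psi>(3) by (simp add: image_image)
  then have "\<psi> ` M = P" using \<psi>(1) Aut_fusion_simps(4)[OF PS] \<eta>(2) by simp
  then show ?thesis using \<psi>(2) by blast
qed

text \<open>As $O^p$ of an automorphism group is generated by the elements of order prime to $p$, and the
displacement of a composite is a product of displacements, these elements already generate the
hyperfocal subgroup. In this form it is visibly normal in $S$.\<close>

lemma hyperfocal_generated_by_p'_automorphisms:
  "hyperfocal S p F = generate S {inv x \<otimes> \<alpha> x |Q x \<alpha>.
    mor Q \<alpha> \<and> \<alpha> ` Q = Q \<and> p'_automorphism Q \<alpha> \<and> x \<in> Q}" (is "_ = generate S ?A")
proof
  have A: "?A \<subseteq> carrier S"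
    using subgroup.mem_carrier[OF mor_subgroup] mor_injective_hom(2) by auto
  interpret gen: subgroup "generate S ?A" S by (rule generate_is_subgroup[OF A])
  define C where "C = {inv x \<otimes> \<phi> x | Q x \<phi>. subgroup Q S \<and> x \<in> Q \<and> \<phi> \<in> p_residual p (Aut_fusion F Q)}"
  have res: "p_residual p (Aut_fusion F Q) = generate (Aut_fusion F Q) {z \<in> F Q Q. p'_automorphism Q z}"
    if Q: "subgroup Q S" for Q
  proof -
    interpret A: group "Aut_fusion F Q" by (rule Aut_fusion_simps(5)[OF Q])
    have "{z \<in> carrier (Aut_fusion F Q). \<exists>n::nat. coprime n p \<and> z [^]\<^bsub>Aut_fusion F Q\<^esub> n = \<one>\<^bsub>Aut_fusion F Q\<^esub>} =
        {z \<in> F Q Q. p'_automorphism Q z}"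
      using p'_automorphism_iff_Aut_fusion[OF Q] Aut_fusion_simps(1)[OF Q] by auto
    then show ?thesis
      using A.p_residual_generated_by_p'_elements[OF Aut_fusion_simps(6)[OF Q] prime_p] by simp
  qed
  have "C \<subseteq> generate S ?A"
  proof
    fix c assume "c \<in> C"
    then obtain Q x \<phi> where Q: "subgroup Q S" "x \<in> Q" "c = inv x \<otimes> \<phi> x"
        "\<phi> \<in> generate (Aut_fusion F Q) {z \<in> F Q Q. p'_automorphism Q z}"
      unfolding C_def using res by auto
    interpret Q: subgroup Q S by fact
    note AQ = Aut_fusion_simps[OF Q(1)]
    interpret A: group "Aut_fusion F Q" by (rule AQ(5))
    have "generate (Aut_fusion F Q) {z \<in> F Q Q. p'_automorphism Q z} \<subseteq> F Q Q"
      using A.generate_incl[of "{z \<in> F Q Q. p'_automorphism Q z}"] AQ(1) by auto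
    then have memF: "\<phi> \<in> F Q Q" if "\<phi> \<in> generate (Aut_fusion F Q) {z \<in> F Q Q. p'_automorphism Q z}" for \<phi>
      using that by blast
    have base: "inv x \<otimes> h x \<in> generate S ?A" if "h \<in> {z \<in> F Q Q. p'_automorphism Q z}" "x \<in> Q" for h x
    proof (rule generate.incl)
      have "mor Q h" "h ` Q = Q" "p'_automorphism Q h" using that AQ(4) by auto
      then show "inv x \<otimes> h x \<in> ?A" using that(2) by blast
    qed
    have "\<forall>x\<in>Q. inv x \<otimes> \<phi> x \<in> generate S ?A"
      using Q(4)
    proof (induction rule: generate.induct)
      case one
      then show ?case using gen.one_closed AQ(2) by simp
    next
      case (incl h)
      then show ?case using base by blast
    next
      case (inv h)
      have hF: "h \<in> F Q Q" using inv by simp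
      show ?case
      proof
        fix x assume x: "x \<in> Q"
        then obtain y where y: "y \<in> Q" "x = h y" using hF AQ(4) by blast
        have "inv (inv y \<otimes> h y) \<in> generate S ?A" using base[OF inv y(1)] by (rule gen.m_inv_closed)
        then show "inv x \<otimes> (inv\<^bsub>Aut_fusion F Q\<^esub> h) x \<in> generate S ?A"
          using y x Aut_fusion_inv(1)[OF Q(1) hF y(1)] Q.mem_carrier by (simp add: inv_mult_group)
      qed
    next
      case (eng h1 h2)
      have F: "h1 \<in> F Q Q" "h2 \<in> F Q Q" using memF eng.hyps by blast+
      show ?case
      proof
        fix x assume x: "x \<in> Q"
        have Q2: "h2 x \<in> Q" "h1 (h2 x) \<in> Q" using F AQ(4) x by blast+
        have "(inv x \<otimes> h2 x) \<otimes> (inv (h2 x) \<otimes> h1 (h2 x)) \<in> generate S ?A"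
          by (rule gen.m_closed[OF bspec[OF eng.IH(2) x] bspec[OF eng.IH(1) Q2(1)]])
        also have "(inv x \<otimes> h2 x) \<otimes> (inv (h2 x) \<otimes> h1 (h2 x)) = inv x \<otimes> h1 (h2 x)"
          using x Q2 Q.mem_carrier by (simp add: word_simps)
        finally show "inv x \<otimes> (h1 \<otimes>\<^bsub>Aut_fusion F Q\<^esub> h2) x \<in> generate S ?A"
          using AQ(3)[OF F] x by (simp add: compose_eq)
      qed
    qed
    then show "c \<in> generate S ?A" using Q(2,3) by simp
  qed
  then show "hyperfocal S p F \<subseteq> generate S ?A"
    unfolding hyperfocal_def C_def[symmetric] by (rule generate_subgroup_incl) (rule gen.subgroup_axioms)
  have CS: "C \<subseteq> carrier S" using \<open>C \<subseteq> generate S ?A\<close> gen.subset by auto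
  have "?A \<subseteq> generate S C"
  proof
    fix a assume "a \<in> ?A"
    then obtain Q x \<alpha> where Q: "mor Q \<alpha>" "\<alpha> ` Q = Q" "p'_automorphism Q \<alpha>" "x \<in> Q" "a = inv x \<otimes> \<alpha> x"
      by blast
    have QS: "subgroup Q S" using mor_subgroup[OF Q(1)] .
    let ?\<alpha> = "restrict \<alpha> Q"
    have r: "?\<alpha> \<in> F Q Q" using mor_into[OF Q(1) QS] Q(2) by simp
    have "p'_automorphism Q ?\<alpha>"
    proof -
      obtain n where n: "coprime n p" "\<And>x. x \<in> Q \<Longrightarrow> (\<alpha> ^^ n) x = x"
        using Q(3) by (auto simp: p'_automorphism_def)
      have "(?\<alpha> ^^ i) x = (\<alpha> ^^ i) x \<and> (\<alpha> ^^ i) x \<in> Q" if "x \<in> Q" for i x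
        by (induction i) (use that Q(2) in auto)
      then show ?thesis
        unfolding p'_automorphism_def
        using n Q(2) p'_automorphismD(2)[OF Q(3)] subgroup.m_closed[OF QS] by auto
    qed
    then have "?\<alpha> \<in> p_residual p (Aut_fusion F Q)" unfolding res[OF QS] using r by (auto intro: generate.incl)
    moreover have "a = inv x \<otimes> ?\<alpha> x" using Q(4,5) by simp
    ultimately have "a \<in> C" unfolding C_def using QS Q(4) by blast
    then show "a \<in> generate S C" by (rule generate.incl)
  qed
  then show "generate S ?A \<subseteq> hyperfocal S p F"
    unfolding hyperfocal_def C_def[symmetric]
    by (rule generate_subgroup_incl) (rule generate_is_subgroup[OF CS])
qed

lemma p'_automorphism_displacement_in_hyperfocal:
  assumes "mor Q \<alpha>" "\<alpha> ` Q = Q" "p'_automorphism Q \<alpha>" "x \<in> Q"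
  shows "inv x \<otimes> \<alpha> x \<in> hyperfocal S p F"
  unfolding hyperfocal_generated_by_p'_automorphisms using assms by (intro generate.incl) blast

lemma subgroup_hyperfocal: "subgroup (hyperfocal S p F) S"
  unfolding hyperfocal_generated_by_p'_automorphisms
  by (rule generate_is_subgroup)
    (use subgroup.mem_carrier[OF mor_subgroup] mor_injective_hom(2) in auto)

lemma hyperfocal_normal:
  assumes g: "g \<in> carrier S" and a: "a \<in> hyperfocal S p F"
  shows "g \<otimes> a \<otimes> inv g \<in> hyperfocal S p F"
  using a unfolding hyperfocal_generated_by_p'_automorphisms
proof (rule generate_closed_under_hom[OF subgroup_self, rotated -1])
  let ?A = "{inv x \<otimes> \<alpha> x |Q x \<alpha>. mor Q \<alpha> \<and> \<alpha> ` Q = Q \<and> p'_automorphism Q \<alpha> \<and> x \<in> Q}"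
  let ?c = "\<lambda>x. g \<otimes> x \<otimes> inv g"
  show "?A \<subseteq> carrier S"
    using subgroup.mem_carrier[OF mor_subgroup] mor_injective_hom(2) by auto
  show "?c (x \<otimes> y) = ?c x \<otimes> ?c y" if "x \<in> carrier S" "y \<in> carrier S" for x y
    using that g by (simp add: word_simps)
  show "?c x \<in> carrier S" if "x \<in> carrier S" for x using that g by simp
  fix b assume "b \<in> ?A"
  then obtain Q x \<alpha> where Q: "mor Q \<alpha>" "\<alpha> ` Q = Q" "p'_automorphism Q \<alpha>" "x \<in> Q" "b = inv x \<otimes> \<alpha> x"
    by blast
  have QS: "subgroup Q S" using mor_subgroup[OF Q(1)] .
  interpret Q: subgroup Q S by fact
  let ?Q = "?c ` Q"
  let ?\<alpha> = "\<lambda>y. ?c (\<alpha> (inv_into Q ?c y))"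
  have c: "mor Q ?c" using mor_conj[OF QS g] .
  have inj: "inj_on ?c Q" using mor_injective_hom(1)[OF c] .
  have 1: "mor ?Q (inv_into Q ?c)" using mor_inv_into[OF c] .
  have im1: "inv_into Q ?c ` ?Q = Q" by (rule inv_into_image_cancel[OF inj subset_refl])
  have 2: "mor ?Q (\<lambda>y. \<alpha> (inv_into Q ?c y))" using mor_comp[OF 1] Q(1) im1 by simp
  have "(\<lambda>y. \<alpha> (inv_into Q ?c y)) ` ?Q = \<alpha> ` inv_into Q ?c ` ?Q" by (simp add: image_image)
  then have im2: "(\<lambda>y. \<alpha> (inv_into Q ?c y)) ` ?Q = Q" unfolding im1 Q(2) .
  have 3: "mor ?Q ?\<alpha>" using mor_comp[OF 2, of ?c] c im2 by simp
  have "?\<alpha> ` ?Q = ?c ` (\<lambda>y. \<alpha> (inv_into Q ?c y)) ` ?Q" by (simp add: image_image)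
  then have 4: "?\<alpha> ` ?Q = ?Q" unfolding im2 .
  have 5: "p'_automorphism ?Q ?\<alpha>"
    by (rule p'_automorphism_conj[OF QS Q(3)])
      (use inj mor_injective_hom(3)[OF c] in \<open>auto simp: bij_betw_def\<close>)
  have 6: "?c b = inv (?c x) \<otimes> ?\<alpha> (?c x)"
    unfolding inv_into_f_f[OF inj Q(4)] Q(5)
    using g Q.mem_carrier[OF Q(4)] mor_injective_hom(2)[OF Q(1) Q(4)] by (simp add: word_simps)
  have "?c x \<in> ?Q" using Q(4) by simp
  then have "?c b \<in> ?A"
    by (intro CollectI exI[of _ ?Q] exI[of _ "?c x"] exI[of _ ?\<alpha>] conjI 3 4 5 6)
  then show "?c b \<in> generate S ?A" by (rule generate.incl)
qed

end

text \<open>Apply the fusion theorem with $B$ trivial: conjugations preserve the hyperfocal subgroup since it is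
normal, and an automorphism of order prime to $p$ changes $x$ only by an element of it.\<close>

lemma (in saturated_fusion_system) hyperfocal_strongly_closed:
  assumes "mor P \<phi>" "x \<in> P"
  shows "\<phi> x \<in> hyperfocal S p F \<longleftrightarrow> x \<in> hyperfocal S p F"
proof -
  let ?h = "hyperfocal S p F"
  let ?good = "\<lambda>P \<phi>. \<forall>x\<in>P. \<phi> x \<in> ?h \<longleftrightarrow> x \<in> ?h"
  interpret h: subgroup ?h S by (rule subgroup_hyperfocal)
  have P: "subgroup P S" using mor_subgroup[OF assms(1)] .
  have "receptive {\<one>}"
    unfolding receptive_def
  proof (intro conjI triv_subgroup allI impI, elim conjE)
    fix Q \<eta> N assume \<eta>: "mor Q \<eta>" "\<eta> ` Q = {\<one>}" and N: "subgroup N S"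
    have "x = \<one>" if "x \<in> Q" for x
      using mor_injective_hom(1,5)[OF \<eta>(1)] \<eta>(2) that subgroup.one_closed[OF mor_subgroup[OF \<eta>(1)]]
      by (metis imageI inj_onD singletonD)
    then show "\<exists>\<psi>. mor N \<psi> \<and> (\<forall>x\<in>Q. \<psi> x = \<eta> x)"
      using mor_id[OF N] mor_injective_hom(5)[OF \<eta>(1)] by metis
  qed
  moreover have "morphism_class ?good"
    unfolding morphism_class_def
  proof (intro conjI allI impI)
    show "\<forall>x\<in>P. g \<otimes> x \<otimes> inv g \<in> ?h \<longleftrightarrow> x \<in> ?h" if P: "subgroup P S" and g: "g \<in> carrier S" for P g
    proof
      fix x assume "x \<in> P"
      then have x: "x \<in> carrier S" using subgroup.mem_carrier[OF P] by blast
      have "inv g \<otimes> (g \<otimes> x \<otimes> inv g) \<otimes> inv (inv g) = x" using g x by (simp add: word_simps)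
      then show "g \<otimes> x \<otimes> inv g \<in> ?h \<longleftrightarrow> x \<in> ?h"
        using hyperfocal_normal[OF g] hyperfocal_normal[of "inv g" "g \<otimes> x \<otimes> inv g"] g by auto
    qed
  qed (auto simp: inv_into_into f_inv_into_f)
  ultimately have "?good P \<phi>"
  proof (rule relative_fusion_theorem[OF _ _ _ assms(1)])
    fix X \<alpha> assume \<alpha>: "mor X \<alpha>" "\<alpha> ` X = X" "p'_automorphism X \<alpha>"
    show "?good X \<alpha>"
    proof
      fix x assume x: "x \<in> X"
      have d: "inv x \<otimes> \<alpha> x \<in> ?h" using p'_automorphism_displacement_in_hyperfocal[OF \<alpha> x] .
      have c: "x \<in> carrier S" "\<alpha> x \<in> carrier S"
        using subgroup.mem_carrier[OF mor_subgroup[OF \<alpha>(1)] x] mor_injective_hom(2)[OF \<alpha>(1) x] by auto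
      have e: "x \<otimes> (inv x \<otimes> \<alpha> x) = \<alpha> x" "\<alpha> x \<otimes> inv (inv x \<otimes> \<alpha> x) = x"
        using c by (simp_all add: word_simps)
      show "\<alpha> x \<in> ?h \<longleftrightarrow> x \<in> ?h"
        using h.m_closed[OF _ d, of x] h.m_closed[OF _ h.m_inv_closed[OF d], of "\<alpha> x"] unfolding e by blast
    qed
  qed (use P mor_injective_hom(5)[OF assms(1)] subgroup.one_closed[OF P] subgroup.mem_carrier[OF P]
      in \<open>auto simp: normalized_by_def\<close>)
  then show ?thesis using assms(2) by blast
qed

section \<open>Comparison of the two fusion systems\<close>

locale saturated_fusion_pair =
  F: saturated_fusion_system S p F + G: saturated_fusion_system S p G
  for S (structure) and p and F G +
  assumes subsystem: "fusion_subsystem S G F"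
    and agreement: "\<And>A B. \<lbrakk>test_subgroup S p A; test_subgroup S p B;
      A \<subseteq> hyperfocal S p F; B \<subseteq> hyperfocal S p F\<rbrakk> \<Longrightarrow> G A B = F A B"
begin

lemma G_mor_imp_F_mor: "G.mor P \<phi> \<Longrightarrow> F.mor P \<phi>"
  using subsystem F.subgroup_self unfolding fusion_subsystem_def G.mor_def F.mor_def by blast

lemma hyperfocal_image: "F.mor P \<phi> \<Longrightarrow> P \<subseteq> hyperfocal S p F \<Longrightarrow> \<phi> ` P \<subseteq> hyperfocal S p F"
  using F.hyperfocal_strongly_closed by auto

lemma agree_on_small_abelian:
  assumes A: "F.small_abelian A" "A \<subseteq> hyperfocal S p F" and \<phi>: "F.mor A \<phi>"
  shows "G.mor A \<phi>"
proof -
  have AS: "subgroup A S" and im: "subgroup (\<phi> ` A) S"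
    using F.mor_subgroup[OF \<phi>] F.mor_fusion_iso(1)[OF \<phi>] by auto
  have "G A (\<phi> ` A) = F A (\<phi> ` A)"
    by (rule agreement)
      (use F.small_abelian_test_subgroup[OF A(1)] F.small_abelian_test_subgroup[OF F.small_abelian_image[OF A(1) \<phi>]]
        A(2) hyperfocal_image[OF \<phi> A(2)] in auto)
  then have "restrict \<phi> A \<in> G A (\<phi> ` A)" using F.mor_into[OF \<phi> im] by simp
  then have "G.mor A (restrict \<phi> A)" using G.morphism_iff_mor[OF AS im] by simp
  then show ?thesis using G.mor_cong[of A \<phi> "restrict \<phi> A"] by simp
qed

lemma Aut_fusion_agree:
  assumes A: "F.small_abelian A" "A \<subseteq> hyperfocal S p F"
  shows "Aut_fusion G A = Aut_fusion F A"
  using agreement[of A A] F.small_abelian_test_subgroup[OF A(1)] A(2) by (simp add: Aut_fusion_def)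

text \<open>The two systems have the same morphisms on $B$, hence the same automorphisms and isomorphism classes.
A member $C$ of the class that is receptive for $G$ then has a normalizer no larger than that of $B$:
extension to normalizers goes from $B$ to $C$ in $G$, and from $C$ to $B$ in $F$. So the extension
$N_S(B) \<rightarrow> N_S(C)$ is an isomorphism in $G$, along which receptivity is carried back.\<close>

lemma automized_receptive_transfer:
  assumes B: "F.small_abelian B" "B \<subseteq> hyperfocal S p F" and sat: "F.automized B" "F.receptive B"
  shows "G.automized B \<and> G.receptive B"
proof
  show "G.automized B"
    using sat(1) unfolding F.automized_def G.automized_def Aut_fusion_agree[OF B] .
  have BS: "subgroup B S" using B(1) by (simp add: F.small_abelian_def)
  obtain \<psi>0 where \<psi>0: "G.mor B \<psi>0" "G.automized (\<psi>0 ` B)" "G.receptive (\<psi>0 ` B)"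
    using G.exists_automized_receptive[OF BS] by auto
  define C where "C = \<psi>0 ` B"
  have CS: "subgroup C S" using G.mor_fusion_iso(1)[OF \<psi>0(1)] by (simp add: C_def)
  note NB = F.normalizing_simps[OF BS] and NC = F.normalizing_simps[OF CS]
  obtain \<psi> where \<psi>: "G.mor (F.normalizing B) \<psi>" "\<psi> ` B = C"
    using G.exists_extension_to_normalizer[OF \<psi>0(2,3,1) refl] unfolding C_def by blast
  have "F.mor C (inv_into B \<psi>0)" using F.mor_inv_into[OF G_mor_imp_F_mor[OF \<psi>0(1)]] by (simp add: C_def)
  moreover have "inv_into B \<psi>0 ` C = B"
    unfolding C_def by (rule inv_into_image_cancel[OF G.mor_injective_hom(1)[OF \<psi>0(1)] subset_refl])
  ultimately obtain \<theta> where \<theta>: "F.mor (F.normalizing C) \<theta>" "\<theta> ` C = B"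
    using F.exists_extension_to_normalizer[OF sat] by blast
  have into_N: "\<xi> ` N \<subseteq> F.normalizing (\<xi> ` M)" if "F.mor N \<xi>" "M \<subseteq> N" "F.normalized_by N M" for \<xi> N M
    using F.normalized_by_subset_normalizing[OF _ F.normalized_by_image[OF that]] F.mor_injective_hom(2)[OF that(1)]
    by blast
  have \<psi>N: "\<psi> ` F.normalizing B \<subseteq> F.normalizing C"
    using into_N[OF G_mor_imp_F_mor[OF \<psi>(1)] NB(2,3)] \<psi>(2) by simp
  have "\<theta> ` F.normalizing C \<subseteq> F.normalizing B"
    using into_N[OF \<theta>(1) NC(2,3)] \<theta>(2) by simp
  then have "card (F.normalizing C) \<le> card (F.normalizing B)"
    using card_image[OF F.mor_injective_hom(1)[OF \<theta>(1)]] card_mono[OF F.finite_subgroup[OF NB(1)]] by metis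
  also have "\<dots> = card (\<psi> ` F.normalizing B)" using card_image[OF G.mor_injective_hom(1)[OF \<psi>(1)]] by simp
  finally have onto: "\<psi> ` F.normalizing B = F.normalizing C"
    using \<psi>N F.finite_subgroup[OF NC(1)] by (intro card_seteq)
  have \<psi>inj: "inj_on \<psi> (F.normalizing B)" using G.mor_injective_hom(1)[OF \<psi>(1)] .
  have \<psi>B: "G.mor B \<psi>" using G.mor_restrict[OF \<psi>(1) BS NB(2)] .
  show "G.receptive B"
    unfolding G.receptive_def
  proof (intro conjI BS allI impI, elim conjE)
    fix Q \<phi> N
    assume \<phi>: "G.mor Q \<phi>" "\<phi> ` Q = B" and N: "subgroup N S" "Q \<subseteq> N" "F.normalized_by N Q"
      and conj: "\<forall>g\<in>N. \<exists>h\<in>carrier S. \<forall>x\<in>Q. \<phi> (g \<otimes> x \<otimes> inv g) = h \<otimes> \<phi> x \<otimes> inv h"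
    have \<psi>\<phi>: "G.mor Q (\<lambda>x. \<psi> (\<phi> x))" using G.mor_comp[OF \<phi>(1)] \<phi>(2) \<psi>B by simp
    have im: "(\<lambda>x. \<psi> (\<phi> x)) ` Q = C" unfolding \<psi>(2)[symmetric] \<phi>(2)[symmetric] by (simp add: image_image)
    have "G.receptive C" using \<psi>0(3) by (simp add: C_def)
    from this \<psi>\<phi> im N have "\<exists>\<xi>. G.mor N \<xi> \<and> (\<forall>x\<in>Q. \<xi> x = \<psi> (\<phi> x))"
    proof (rule G.receptiveD)
      fix g assume g: "g \<in> N"
      obtain h where h: "h \<in> carrier S" "\<And>x. x \<in> Q \<Longrightarrow> \<phi> (g \<otimes> x \<otimes> inv g) = h \<otimes> \<phi> x \<otimes> inv h"
        using conj g by blast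
      have hN: "h \<in> F.normalizing B"
      proof (rule NB(4)[OF h(1)])
        fix b assume "b \<in> B"
        then obtain x where x: "x \<in> Q" "b = \<phi> x" using \<phi>(2) by auto
        then show "h \<otimes> b \<otimes> inv h \<in> B" using h(2) F.normalized_byD[OF N(3) g x(1)] \<phi>(2) by (metis imageI)
      qed
      have "\<psi> (\<phi> (g \<otimes> x \<otimes> inv g)) = \<psi> h \<otimes> \<psi> (\<phi> x) \<otimes> inv (\<psi> h)" if x: "x \<in> Q" for x
      proof -
        have "\<phi> x \<in> F.normalizing B" using x \<phi>(2) NB(2) by auto
        then show ?thesis unfolding h(2)[OF x] by (rule G.mor_conjugate[OF \<psi>(1) hN])
      qed
      then show "\<exists>h\<in>carrier S. \<forall>x\<in>Q. \<psi> (\<phi> (g \<otimes> x \<otimes> inv g)) = h \<otimes> \<psi> (\<phi> x) \<otimes> inv h"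
        using G.mor_injective_hom(2)[OF \<psi>(1) hN] by blast
    qed
    then obtain \<xi> where \<xi>: "G.mor N \<xi>" "\<And>x. x \<in> Q \<Longrightarrow> \<xi> x = \<psi> (\<phi> x)" by blast
    have "\<xi> ` Q = C" using \<xi>(2) im by simp
    then have "\<xi> ` N \<subseteq> F.normalizing C" using into_N[OF G_mor_imp_F_mor[OF \<xi>(1)] N(2,3)] by simp
    then have "G.mor (\<xi> ` N) (inv_into (F.normalizing B) \<psi>)"
      using G.mor_restrict[OF G.mor_inv_into[OF \<psi>(1)]] G.mor_fusion_iso(1)[OF \<xi>(1)] onto by simp
    then have "G.mor N (\<lambda>x. inv_into (F.normalizing B) \<psi> (\<xi> x))" using G.mor_comp[OF \<xi>(1)] by blast
    moreover have "inv_into (F.normalizing B) \<psi> (\<xi> x) = \<phi> x" if x: "x \<in> Q" for x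
    proof -
      have "\<phi> x \<in> F.normalizing B" using x \<phi>(2) NB(2) by auto
      then show ?thesis unfolding \<xi>(2)[OF x] by (rule inv_into_f_f[OF \<psi>inj])
    qed
    ultimately show "\<exists>\<xi>. G.mor N \<xi> \<and> (\<forall>x\<in>Q. \<xi> x = \<phi> x)" by blast
  qed
qed

lemma morphism_class_G: "F.morphism_class G.mor"
  unfolding F.morphism_class_def
proof (intro conjI allI impI)
  show "G.mor P \<psi>" if "G.mor P \<phi>" "\<forall>x\<in>P. \<phi> x = \<psi> x" for P \<phi> \<psi>
    using that G.mor_cong[of P \<phi> \<psi>] by blast
qed (blast intro: G.mor_comp G.mor_inv_into G.mor_restrict G.mor_conj)+

text \<open>Downward induction on the order of $A$. The restrictions of $\<phi>$ and of its inverse to $A$ and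
$\<phi>(A)$ lie in $G$ by assumption; receptivity of a conjugate $B$ of $A$ in $G$ turns them into
morphisms of $G$ defined on $X$ and on $\<phi>(X)$. Up to these, $\<phi>$ becomes a morphism of $F$
that fixes $B$ pointwise, and the relative fusion theorem reduces it to automorphisms of order prime
to $p$ of subgroups $Z$ normalizing $B$. If $Z$ normalizes a larger small abelian subgroup of
$Z \<inter> \mathfrak{hyp}(F)$ containing $B$, such an automorphism is in $G$ by induction; otherwise it is
trivial, because it is trivial on $B$ and on $Z$ modulo the hyperfocal subgroup.\<close>

lemma F_mor_imp_G_mor_over_small_abelian:
  assumes "F.small_abelian A" "A \<subseteq> hyperfocal S p F" "F.mor X \<phi>" "A \<subseteq> X" "F.normalized_by X A"
  shows "G.mor X \<phi>"
  using assms
proof (induction "card (carrier S) - card A" arbitrary: A X \<phi> rule: less_induct)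
  case less
  note A = less.prems(1,2) and \<phi> = less.prems(3) and AX = less.prems(4,5)
  let ?h = "hyperfocal S p F"
  have IH: "G.mor Y \<eta>" if "F.small_abelian A'" "A' \<subseteq> ?h" "F.mor Y \<eta>" "A' \<subseteq> Y" "F.normalized_by Y A'" "card A < card A'"
    for A' Y \<eta>
  proof (rule less.hyps[OF _ that(1-5)])
    have "card A' \<le> card (carrier S)"
      using that(1) card_mono[OF F.finite_carrier] subgroup.subset by (auto simp: F.small_abelian_def)
    then show "card (carrier S) - card A' < card (carrier S) - card A" using that(6) by simp
  qed
  have AS: "subgroup A S" using A(1) by (simp add: F.small_abelian_def)
  have XS: "subgroup X S" using F.mor_subgroup[OF \<phi>] .
  obtain \<chi>0 where \<chi>0: "F.mor A \<chi>0" "F.automized (\<chi>0 ` A)" "F.receptive (\<chi>0 ` A)"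
    using F.exists_automized_receptive[OF AS] by auto
  define B where "B = \<chi>0 ` A"
  have B: "F.small_abelian B" "B \<subseteq> ?h"
    using F.small_abelian_image[OF A(1) \<chi>0(1)] hyperfocal_image[OF \<chi>0(1) A(2)] by (auto simp: B_def)
  have cardB: "card B = card A" using card_image[OF F.mor_injective_hom(1)[OF \<chi>0(1)]] by (simp add: B_def)
  have BF: "F.automized B" "F.receptive B" using \<chi>0 by (auto simp: B_def)
  have BG: "G.automized B" "G.receptive B" using automized_receptive_transfer[OF B BF] by auto
  have \<chi>0G: "G.mor A \<chi>0" "\<chi>0 ` A = B" using agree_on_small_abelian[OF A \<chi>0(1)] by (auto simp: B_def)
  obtain \<chi>1 where \<chi>1': "G.mor (F.normalizing A) \<chi>1" "\<chi>1 ` A = B"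
    using G.exists_extension_to_normalizer[OF BG \<chi>0G] by blast
  have "X \<subseteq> F.normalizing A" using F.normalized_by_subset_normalizing[OF subgroup.subset[OF XS] AX(2)] .
  then have \<chi>1: "G.mor X \<chi>1" using G.mor_restrict[OF \<chi>1'(1) XS] by blast
  have inj\<phi>: "inj_on \<phi> X" and inj1: "inj_on \<chi>1 X"
    using F.mor_injective_hom(1)[OF \<phi>] G.mor_injective_hom(1)[OF \<chi>1] by auto
  have inv\<phi>: "inv_into X \<phi> (\<phi> x) = x" and inv1: "inv_into X \<chi>1 (\<chi>1 x) = x" if "x \<in> X" for x
    using that inj\<phi> inj1 by simp_all
  define Y where "Y = \<phi> ` X"
  define A2 where "A2 = \<phi> ` A"
  have \<phi>A: "F.mor A \<phi>" using F.mor_restrict[OF \<phi> AS AX(1)] .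
  have A2: "F.small_abelian A2" "A2 \<subseteq> ?h"
    using F.small_abelian_image[OF A(1) \<phi>A] hyperfocal_image[OF \<phi>A A(2)] by (auto simp: A2_def)
  have YS: "subgroup Y S" using F.mor_fusion_iso(1)[OF \<phi>] by (simp add: Y_def)
  have A2Y: "A2 \<subseteq> Y" using AX(1) by (auto simp: A2_def Y_def)
  have nY: "F.normalized_by Y A2" using F.normalized_by_image[OF \<phi> AX] by (simp add: Y_def A2_def)
  let ?\<chi>2 = "\<lambda>y. \<chi>1 (inv_into X \<phi> y)"
  have "F.mor Y ?\<chi>2"
    using F.mor_comp[OF F.mor_inv_into[OF \<phi>], of \<chi>1] G_mor_imp_F_mor[OF \<chi>1]
      inv_into_image_cancel[OF inj\<phi> subset_refl] by (simp add: Y_def)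
  then have "F.mor A2 ?\<chi>2" using F.mor_restrict A2Y A2(1) by (auto simp: F.small_abelian_def)
  then have \<chi>2: "G.mor A2 ?\<chi>2" using agree_on_small_abelian[OF A2] by blast
  have \<chi>2val: "?\<chi>2 (\<phi> x) = \<chi>1 x" if "x \<in> X" for x using inv\<phi>[OF that] by simp
  have \<chi>2im: "?\<chi>2 ` A2 = B"
  proof -
    have "?\<chi>2 ` A2 = (\<lambda>x. ?\<chi>2 (\<phi> x)) ` A" by (simp add: A2_def image_image)
    also have "\<dots> = \<chi>1 ` A" using \<chi>2val AX(1) by (intro image_cong) auto
    finally show ?thesis using \<chi>1'(2) by simp
  qed
  from BG(2) \<chi>2 \<chi>2im YS A2Y nY have "\<exists>\<xi>. G.mor Y \<xi> \<and> (\<forall>y\<in>A2. \<xi> y = ?\<chi>2 y)"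
  proof (rule G.receptiveD)
    fix g assume "g \<in> Y"
    then obtain x where x: "x \<in> X" "g = \<phi> x" by (auto simp: Y_def)
    have "?\<chi>2 (g \<otimes> y \<otimes> inv g) = \<chi>1 x \<otimes> ?\<chi>2 y \<otimes> inv (\<chi>1 x)" if "y \<in> A2" for y
    proof -
      obtain a where a: "a \<in> A" "y = \<phi> a" using \<open>y \<in> A2\<close> by (auto simp: A2_def)
      have aX: "a \<in> X" using a AX(1) by auto
      have "g \<otimes> y \<otimes> inv g = \<phi> (x \<otimes> a \<otimes> inv x)" using F.mor_conjugate[OF \<phi> x(1) aX] x(2) a(2) by simp
      moreover have "x \<otimes> a \<otimes> inv x \<in> X" using F.normalized_byD[OF AX(2) x(1) a(1)] AX(1) by auto
      ultimately show ?thesis using \<chi>2val aX a(2) G.mor_conjugate[OF \<chi>1 x(1) aX] by simp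
    qed
    then show "\<exists>h\<in>carrier S. \<forall>y\<in>A2. ?\<chi>2 (g \<otimes> y \<otimes> inv g) = h \<otimes> ?\<chi>2 y \<otimes> inv h"
      using G.mor_injective_hom(2)[OF \<chi>1 x(1)] by blast
  qed
  then obtain \<xi> where \<xi>: "G.mor Y \<xi>" "\<And>y. y \<in> A2 \<Longrightarrow> \<xi> y = ?\<chi>2 y" by blast
  let ?\<delta> = "\<lambda>z. \<xi> (\<phi> (inv_into X \<chi>1 z))"
  have "G.mor (\<chi>1 ` X) ?\<delta>"
  proof (rule F.relative_fusion_theorem[OF BF(2) morphism_class_G])
    have 1: "F.mor (\<chi>1 ` X) (inv_into X \<chi>1)" using F.mor_inv_into[OF G_mor_imp_F_mor[OF \<chi>1]] .
    have im1: "inv_into X \<chi>1 ` \<chi>1 ` X = X" by (rule inv_into_image_cancel[OF inj1 subset_refl])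
    have 2: "F.mor (\<chi>1 ` X) (\<lambda>z. \<phi> (inv_into X \<chi>1 z))" using F.mor_comp[OF 1] \<phi> im1 by simp
    have "(\<lambda>z. \<phi> (inv_into X \<chi>1 z)) ` \<chi>1 ` X = \<phi> ` inv_into X \<chi>1 ` \<chi>1 ` X" by (simp add: image_image)
    then have "(\<lambda>z. \<phi> (inv_into X \<chi>1 z)) ` \<chi>1 ` X = Y" unfolding im1 by (simp add: Y_def)
    then show "F.mor (\<chi>1 ` X) ?\<delta>" using F.mor_comp[OF 2] G_mor_imp_F_mor[OF \<xi>(1)] by simp
    show "B \<subseteq> \<chi>1 ` X" using \<chi>1'(2) AX(1) by auto
    show "F.normalized_by (\<chi>1 ` X) B"
      using F.normalized_by_image[OF G_mor_imp_F_mor[OF \<chi>1] AX] \<chi>1'(2) by simp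
    show "?\<delta> b = b" if b: "b \<in> B" for b
    proof -
      obtain a where a: "a \<in> A" "b = \<chi>1 a" using b \<chi>1'(2) by auto
      have aX: "a \<in> X" using a AX(1) by auto
      have "\<xi> (\<phi> a) = \<chi>1 a" using \<xi>(2)[of "\<phi> a"] \<chi>2val[OF aX] a(1) by (simp add: A2_def)
      then show ?thesis using inv1[OF aX] a(2) by simp
    qed
  next
    fix Z \<alpha> assume \<alpha>: "F.mor Z \<alpha>" "\<alpha> ` Z = Z" "F.p'_automorphism Z \<alpha>" and BZ: "B \<subseteq> Z" "F.normalized_by Z B"
      and fix_B: "\<And>b. b \<in> B \<Longrightarrow> \<alpha> b = b"
    have ZS: "subgroup Z S" using F.mor_subgroup[OF \<alpha>(1)] .
    interpret Z: subgroup Z S by fact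
    let ?T = "Z \<inter> ?h"
    have T: "subgroup ?T S" using F.subgroups_Inter_pair[OF ZS F.subgroup_hyperfocal] .
    show "G.mor Z \<alpha>"
    proof (cases "\<exists>B'. F.small_abelian B' \<and> B \<subseteq> B' \<and> B' \<subseteq> ?T \<and> F.normalized_by Z B' \<and> B' \<noteq> B")
      case True
      then obtain B' where B': "F.small_abelian B'" "B \<subset> B'" "B' \<subseteq> ?T" "F.normalized_by Z B'" by blast
      have "card A < card B'"
        using psubset_card_mono[OF F.finite_subgroup B'(2)] B'(1) cardB by (simp add: F.small_abelian_def)
      then show ?thesis using IH[OF B'(1) _ \<alpha>(1) _ B'(4)] B'(3) by blast
    next
      case False
      have nT: "F.normalized_by Z ?T"
        using F.hyperfocal_normal by (auto simp: F.normalized_by_def)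
      have "F.relative_p'_automorphism Z ?T B \<alpha>"
        unfolding F.relative_p'_automorphism_def
      proof (intro conjI ballI \<alpha>(3))
        show "\<alpha> b = b" if "b \<in> B" for b using fix_B[OF that] .
        show "inv x \<otimes> \<alpha> x \<in> ?T" if x: "x \<in> Z" for x
        proof -
          have "\<alpha> x \<in> Z" using \<alpha>(2) x by blast
          then show ?thesis using F.p'_automorphism_displacement_in_hyperfocal[OF \<alpha> x] x by simp
        qed
      qed
      then have "\<alpha> x = x" if "x \<in> Z" for x
        using F.p'_automorphism_detected_on_small_abelian[OF ZS T _ nT B(1) _ BZ(2)] False BZ(1) B(2) that
        by blast
      then show ?thesis using G.mor_cong[of Z \<alpha> "\<lambda>x. x"] G.mor_id[OF ZS] by simp
    qed
  qed
  then have G1: "G.mor X (\<lambda>x. ?\<delta> (\<chi>1 x))" using G.mor_comp[OF \<chi>1] by blast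
  have "(\<lambda>x. ?\<delta> (\<chi>1 x)) ` X = \<xi> ` Y"
    using inv1 by (simp add: Y_def image_image)
  moreover have "G.mor (\<xi> ` Y) (inv_into Y \<xi>)" using G.mor_inv_into[OF \<xi>(1)] .
  ultimately have "G.mor X (\<lambda>x. inv_into Y \<xi> (?\<delta> (\<chi>1 x)))" using G.mor_comp[OF G1, of "inv_into Y \<xi>"] by simp
  moreover have "inv_into Y \<xi> (?\<delta> (\<chi>1 x)) = \<phi> x" if x: "x \<in> X" for x
    unfolding inv1[OF x] by (rule inv_into_f_f[OF G.mor_injective_hom(1)[OF \<xi>(1)]]) (use x in \<open>simp add: Y_def\<close>)
  ultimately show "G.mor X \<phi>" using G.mor_cong[of X _ \<phi>] by (metis (no_types, lifting))
qed

lemma fusion_systems_equal: "G = F"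
proof (intro ext)
  fix P Q
  show "G P Q = F P Q"
  proof (cases "subgroup P S \<and> subgroup Q S")
    case True
    then have P: "subgroup P S" and Q: "subgroup Q S" by auto
    interpret P: subgroup P S by fact
    have triv: "F.small_abelian {\<one>}" "{\<one>} \<subseteq> hyperfocal S p F" "F.normalized_by P {\<one>}"
      using F.triv_subgroup subgroup.one_closed[OF F.subgroup_hyperfocal]
      by (auto simp: F.small_abelian_def F.normalized_by_def)
    have "F.mor P \<phi> \<longleftrightarrow> G.mor P \<phi>" for \<phi>
      using F_mor_imp_G_mor_over_small_abelian[OF triv(1,2) _ _ triv(3)] G_mor_imp_F_mor
        P.one_closed by blast
    then show ?thesis using F.morphism_iff_mor[OF P Q] G.morphism_iff_mor[OF P Q] by auto
  next
    case False
    then show ?thesis using F.objects G.objects by simp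
  qed
qed

end


theorem theorem1:
  fixes S :: "('a, 'b) monoid_scheme" and p :: nat
    and F G :: "'a set \<Rightarrow> 'a set \<Rightarrow> ('a \<Rightarrow> 'a) set"
  assumes "saturated_fusion_system S p F"
    and "saturated_fusion_system S p G"
    and "fusion_subsystem S G F"
    and "\<And>A B. \<lbrakk>test_subgroup S p A; test_subgroup S p B;
           A \<subseteq> hyperfocal S p F; B \<subseteq> hyperfocal S p F\<rbrakk> \<Longrightarrow> G A B = F A B"
  shows "G = F"
proof -
  interpret saturated_fusion_pair S p F G
    using assms by (intro saturated_fusion_pair.intro saturated_fusion_pair_axioms.intro)
  show ?thesis by (rule fusion_systems_equal)
qed

end
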